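(* Let $d\ge 4$ and let $\mu$ be a compactly supported Borel probability measure on $\mathbb{R}^d$. For $\theta\in[0,1]$, define $$T_d(\theta):=\begin{cases}2+d\theta, & 0\le\theta<\dfrac{\sqrt d-2}{d},\\[1ex] \sqrt d, & \dfrac{\sqrt d-2}{d}\le\theta<d^{-1/2},\\[1ex] \dfrac{2+d\theta}{1+2\theta}, & d^{-1/2}\le\theta<\dfrac12,\\[2ex] 1+\dfrac{d\theta}{2}, & \dfrac12\le\theta\le 1.\end{cases}$$ If, for some $\theta\in[0,1]$, $\dim_{\mathrm F}^{\theta}\mu\ge T_d(\theta)$, then $$\dim_{\mathrm H} D(\operatorname{supp}\mu)=1.$$ Moreover, $\dim_{\mathrm H} D_x(\operatorname{supp}\mu)=1$ for $\mu$-almost all $x$.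
   Context: For $E\subseteq\mathbb{R}^d$ and $x\in\mathbb{R}^d$, $D(E)=\{|x-y|:x,y\in E\}$ is the distance set and $D_x(E)=\{|x-y|:y\in E\}$ is the pinned distance set; $\dim_{\mathrm H}$ is Hausdorff dimension. For a finite Borel measure $\mu$ on $\mathbb{R}^d$, $\widehat\mu(z)=\int e^{-2\pi i z\cdot x}\,d\mu(x)$. For $s\ge 0$ define $$\mathcal{J}_{s,\theta}(\mu)=\left(\int_{\mathbb{R}^d}|\widehat\mu(z)|^{2/\theta}|z|^{s/\theta-d}\,dz\right)^{\theta}\ (\theta\in(0,1]),\qquad \mathcal{J}_{s,0}(\mu)=\sup_{z\in\mathbb{R}^d}|\widehat\mu(z)|^2|z|^s.$$ The Fourier spectrum of $\mu$ at $\theta\in[0,1]$ is $\dim_{\mathrm F}^{\theta}\mu=\sup\{s\ge 0:\mathcal{J}_{s,\theta}(\mu)<\infty\}$ (with $\sup\emptyset=0$). *)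

theory Defs
  imports "HOL-Probability.Probability"
begin

section \<open>Hausdorff dimension\<close>

text \<open>
  The value \<open>(diam U)\<^sup>s\<close> with the usual conventions: the empty set contributes \<open>0\<close> and,
  for \<open>s = 0\<close>, every nonempty set contributes \<open>1\<close>
  (the library's \<open>0 powr 0\<close> is \<open>0\<close>, hence the explicit case).
\<close>
definition diam_powr :: "'a::metric_space set \<Rightarrow> real \<Rightarrow> ennreal" where
  "diam_powr U s =
     (if U = {} then 0 else if s = 0 then 1 else ennreal (diameter U powr s))"

text \<open>
  \<^const>\<open>diameter\<close> is meaningful only on bounded sets, so boundedness is part of the
  requirement that the covering sets have diameter at most \<open>\<delta>\<close>.
\<close>
definition hausdorff_content :: "real \<Rightarrow> real \<Rightarrow> 'a::metric_space set \<Rightarrow> ennreal" where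
  "hausdorff_content s \<delta> E =
     (INF U \<in> {U :: nat \<Rightarrow> 'a set.
                 (\<forall>i. bounded (U i) \<and> diameter (U i) \<le> \<delta>) \<and> E \<subseteq> (\<Union>i. U i)}.
        \<Sum>i. diam_powr (U i) s)"

definition hausdorff_measure :: "real \<Rightarrow> 'a::metric_space set \<Rightarrow> ennreal" where
  "hausdorff_measure s E = (SUP \<delta> \<in> {0<..}. hausdorff_content s \<delta> E)"

definition hausdorff_dim :: "'a::metric_space set \<Rightarrow> ennreal" where
  "hausdorff_dim E = Inf (ennreal ` {s. 0 \<le> s \<and> hausdorff_measure s E = 0})"

section \<open>Distance sets\<close>

definition distance_set :: "'a::metric_space set \<Rightarrow> real set" where
  "distance_set E = {dist x y | x y. x \<in> E \<and> y \<in> E}"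

definition pinned_distance_set :: "'a::metric_space \<Rightarrow> 'a set \<Rightarrow> real set" where
  "pinned_distance_set x E = {dist x y | y. y \<in> E}"

section \<open>Support and Fourier spectrum of a measure\<close>

definition measure_support :: "'a::topological_space measure \<Rightarrow> 'a set" where
  "measure_support \<mu> = {x. \<forall>U. open U \<and> x \<in> U \<longrightarrow> emeasure \<mu> U > 0}"

definition fourier_transform :: "(real ^ 'n) measure \<Rightarrow> real ^ 'n \<Rightarrow> complex" where
  "fourier_transform \<mu> z = (\<integral>x. exp (- 2 * complex_of_real pi * \<i> * complex_of_real (z \<bullet> x)) \<partial>\<mu>)"

definition ennreal_powr :: "ennreal \<Rightarrow> real \<Rightarrow> ennreal" where
  "ennreal_powr x p = (if x = \<top> then \<top> else ennreal (enn2real x powr p))"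

text \<open>
  Only \<open>s \<ge> 0\<close> and \<open>\<theta> \<in> [0,1]\<close> are relevant, so \<^const>\<open>ennreal_powr\<close> is used with positive
  exponents only. The value at \<open>z = 0\<close> does not matter: for \<open>\<theta> > 0\<close> the point is a null set,
  and for \<open>\<theta> = 0 = s\<close> reading \<open>0\<^sup>0\<close> as \<open>0\<close> or \<open>1\<close> gives the same supremum by continuity of
  the Fourier transform of a finite measure.
\<close>
definition fourier_energy :: "real \<Rightarrow> real \<Rightarrow> (real ^ 'n) measure \<Rightarrow> ennreal" where
  "fourier_energy s \<theta> \<mu> =
     (if \<theta> = 0
      then (SUP z. ennreal ((cmod (fourier_transform \<mu> z))\<^sup>2 * norm z powr s))
      else ennreal_powr
             (\<integral>\<^sup>+ z. ennreal (cmod (fourier_transform \<mu> z) powr (2 / \<theta>)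
                            * norm z powr (s / \<theta> - real CARD('n))) \<partial>lborel) \<theta>)"

text \<open>In \<^typ>\<open>ennreal\<close> the supremum of the empty set is \<open>0\<close>; the spectrum may be \<open>\<top>\<close>.\<close>
definition fourier_spectrum :: "real \<Rightarrow> (real ^ 'n) measure \<Rightarrow> ennreal" where
  "fourier_spectrum \<theta> \<mu> = Sup (ennreal ` {s. 0 \<le> s \<and> fourier_energy s \<theta> \<mu> < \<top>})"

section \<open>The threshold\<close>

definition spectrum_threshold :: "nat \<Rightarrow> real \<Rightarrow> real" where
  "spectrum_threshold d \<theta> =
     (if \<theta> < (sqrt d - 2) / d then 2 + d * \<theta>
      else if \<theta> < d powr (-1/2) then sqrt d
      else if \<theta> < 1/2 then (2 + d * \<theta>) / (1 + 2 * \<theta>)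
      else 1 + d * \<theta> / 2)"

end

theory Submission
  imports Defs
begin

text \<open>
  Write \<open>d\<close> for the dimension and \<open>m\<close> for the Fourier transform of \<open>\<mu>\<close>. For points \<open>x, y, y'\<close>
    \<open>|x - y|\<^sup>2 - |x - y'|\<^sup>2 = |y|\<^sup>2 - |y'|\<^sup>2 + 2 x \<bullet> (y' - y)\<close>,
  which is affine in the pin \<open>x\<close>. Averaging the character \<open>e(t (|x - y|\<^sup>2 - |x - y'|\<^sup>2))\<close> over \<open>x\<close> therefore
  gives, up to a factor of modulus \<open>1\<close>, the value of \<open>m\<close> at \<open>2t (y' - y)\<close>. So the mean square over the pins \<open>x\<close>
  of the Fourier transform at \<open>t\<close> of the image of \<open>\<mu>\<close> under \<open>y \<mapsto> |x - y|\<^sup>2\<close> is at most the chord average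
    \<open>A t = \<integral>\<integral> |m (2t (y' - y))| d\<mu>(y) d\<mu>(y')\<close>.
  If \<open>A t = O(|t| powr - b)\<close>, then for almost every pin this image has finite energy of every order below \<open>b\<close>,
  and the mass distribution principle bounds the dimension of the pinned distance set below by \<open>b\<close>
  (lemma \<open>hausdorff_dim_distance_sets\<close>). It remains to prove such decay for every \<open>b < 1\<close>.

  As \<open>\<mu>\<close> lives on a bounded set, weighting the pins with the Gaussian \<open>exp (- pi |x|\<^sup>2)\<close> costs only a constant. It
  replaces \<open>m\<close> by an average of \<open>m\<close> against a Gaussian, and this lets Lebesgue integrals of \<open>m\<close>, which are
  what the Fourier spectrum controls, bound values at the points \<open>2t (y' - y)\<close>, even where these form a null set.
  Gaussians are the only functions to which Fourier inversion is applied.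

  The chord average is estimated in two ways.

  \<^item> If the Fourier spectrum at \<open>\<theta>\<close> is at least \<open>2 + d \<theta>\<close>, then \<open>m\<close> after smoothing is \<open>O(|z| powr - a)\<close> for each \<open>a < 1\<close>. This decay,
    used once at \<open>2t (y' - y)\<close> and once more to bound how often \<open>|y' - y|\<close> is small, gives \<open>A t = O(|t| powr - b)\<close>
    for \<open>b < a\<close> (lemma \<open>chord_average_decay_if_windowed_ft_decay\<close>).

  \<^item> Smoothing turns \<open>A t\<close> into \<open>\<integral> |m| \<rho>\<close>, where \<open>\<rho>\<close> is the density of \<open>2t (y' - y)\<close> blurred at unit scale. The
    three quantities \<open>\<integral> \<rho> = 1\<close>, \<open>\<integral> \<rho>\<^sup>2\<close> and \<open>\<integral> |m| powr (2/\<theta>)\<close> over the ball of radius \<open>O(|t|)\<close> are combined by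
    the inequality between weighted arithmetic and geometric means with weights \<open>1 - \<theta>\<close>, \<open>\<theta>/2\<close> and \<open>\<theta>/2\<close>. The second
    of them is governed by \<open>\<integral> |m| ^ 4\<close>, which is bounded in terms of the third by \<open>|m| \<le> 1\<close> if \<open>\<theta> \<ge> 1/2\<close> and by Hoelder's
    inequality if \<open>\<theta> < 1/2\<close>. The resulting exponent is \<open>1\<close> exactly at \<open>s = 1 + d \<theta>/2\<close> and at
    \<open>s = (2 + d \<theta>) / (1 + 2 \<theta>)\<close>, respectively (lemma \<open>chord_average_decay_if_weighted_Lp\<close>).

  The second estimate needs \<open>s \<le> d \<theta>\<close>, which for \<open>d \<ge> 4\<close> and these values of \<open>s\<close> means \<open>\<theta> \<ge> 1 / sqrt d\<close>. Finiteness of the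
  energy passes from \<open>\<theta>\<close> to larger exponents at an arbitrarily small loss in \<open>s\<close>
  (lemma \<open>weighted_Lp_if_energy\<close>), so for smaller \<open>\<theta>\<close> one may move to \<open>1 / sqrt d\<close>, where the critical
  value of \<open>s\<close> is \<open>sqrt d\<close>: this is the constant piece of the threshold.
\<close>

section \<open>Gaussians and their Fourier transforms\<close>

text \<open>
  The characteristic function of the standard normal distribution, rescaled.
\<close>
lemma gaussian_fourier_real:
  fixes \<tau> u :: real
  assumes "\<tau> > 0"
  shows "has_bochner_integral lborel
           (\<lambda>w. complex_of_real (exp (- pi * w\<^sup>2 / \<tau>\<^sup>2)) * cis (2 * pi * (w * u)))
           (complex_of_real (\<tau> * exp (- pi * \<tau>\<^sup>2 * u\<^sup>2)))"
proof -
  interpret real_distribution std_normal_distribution by (rule real_dist_normal_dist)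
  define t where "t = sqrt (2 * pi) * \<tau> * u"
  define c where "c = \<tau> / sqrt (2 * pi)"
  have c: "c > 0" "c \<noteq> 0" using assms by (auto simp: c_def)
  have i1: "integrable std_normal_distribution (\<lambda>x. iexp (t * x))"
    by (rule integrable_iexp) auto
  have i2: "integrable lborel (\<lambda>x. std_normal_density x *\<^sub>R iexp (t * x))"
    using i1 by (subst (asm) integrable_density) auto
  have "(\<integral>x. std_normal_density x *\<^sub>R iexp (t * x) \<partial>lborel) = char std_normal_distribution t"
    unfolding char_def by (subst integral_density) auto
  also have "\<dots> = complex_of_real (exp (- t\<^sup>2 / 2))"
    by (simp add: char_std_normal_distribution)
  finally have "has_bochner_integral lborel (\<lambda>x. std_normal_density x *\<^sub>R iexp (t * x))
      (complex_of_real (exp (- t\<^sup>2 / 2)))"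
    using i2 by (simp add: has_bochner_integral_iff)
  then have h: "has_bochner_integral lborel
      (\<lambda>x. complex_of_real (sqrt (2 * pi)) * (std_normal_density x *\<^sub>R iexp (t * x)))
      (complex_of_real (sqrt (2 * pi)) * (complex_of_real (exp (- t\<^sup>2 / 2))))"
    by (rule has_bochner_integral_mult_right) 
  have cc: "c\<^sup>2 = \<tau>\<^sup>2 / (2 * pi)" by (simp add: c_def power_divide)
  have f: "(\<lambda>x. complex_of_real (exp (- pi * (0 + c * x)\<^sup>2 / \<tau>\<^sup>2)) * cis (2 * pi * ((0 + c * x) * u)))
     = (\<lambda>x. complex_of_real (sqrt (2 * pi)) * (std_normal_density x *\<^sub>R iexp (t * x)))"
  proof
    fix x
    have e1: "- pi * (0 + c * x)\<^sup>2 / \<tau>\<^sup>2 = - x\<^sup>2 / 2"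
      using assms by (simp add: power_mult_distrib cc)
    have e2: "2 * pi * ((0 + c * x) * u) = t * x"
    proof -
      have "2 * pi * c = sqrt (2 * pi) * \<tau>"
        unfolding c_def by (simp add: field_simps) 
      then show ?thesis unfolding t_def by (simp add: algebra_simps)
    qed
    show "complex_of_real (exp (- pi * (0 + c * x)\<^sup>2 / \<tau>\<^sup>2)) * cis (2 * pi * ((0 + c * x) * u))
     = complex_of_real (sqrt (2 * pi)) * (std_normal_density x *\<^sub>R iexp (t * x))"
      unfolding e1 e2 by (simp add: std_normal_density_def cis_conv_exp scaleR_conv_of_real flip: of_real_mult)
  qed
  have v: "complex_of_real (\<tau> * exp (- pi * \<tau>\<^sup>2 * u\<^sup>2)) /\<^sub>R \<bar>c\<bar> =
     complex_of_real (sqrt (2 * pi)) * (complex_of_real (exp (- t\<^sup>2 / 2)))"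
  proof -
    have "- pi * \<tau>\<^sup>2 * u\<^sup>2 = - t\<^sup>2 / 2" by (simp add: t_def power_mult_distrib)
    moreover have "\<tau> / c = sqrt (2 * pi)" using assms by (simp add: c_def)
    ultimately show ?thesis using c
      by (simp add: scaleR_conv_of_real divide_simps flip: of_real_mult) 
  qed
  show ?thesis
    by (subst lborel_has_bochner_integral_real_affine_iff[OF c(2), where t = 0])
       (subst f, subst v, rule h)
qed

lemma gaussian_fourier:
  fixes u :: "'a::euclidean_space" and \<tau> :: real
  assumes "\<tau> > 0"
  shows "has_bochner_integral lborel
           (\<lambda>w. complex_of_real (exp (- pi * (norm w)\<^sup>2 / \<tau>\<^sup>2)) * cis (2 * pi * (w \<bullet> u)))
           (complex_of_real (\<tau> ^ DIM('a) * exp (- pi * \<tau>\<^sup>2 * (norm u)\<^sup>2)))"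
proof -
  interpret product_sigma_finite "\<lambda>_::'a. lborel :: real measure" ..
  define f where "f b w = complex_of_real (exp (- pi * w\<^sup>2 / \<tau>\<^sup>2)) * cis (2 * pi * (w * (u \<bullet> b)))" for b :: 'a and w
  have fi: "integrable lborel (f b)" "integral\<^sup>L lborel (f b) = complex_of_real (\<tau> * exp (- pi * \<tau>\<^sup>2 * (u \<bullet> b)\<^sup>2))" for b
    using gaussian_fourier_real[OF assms, of "u \<bullet> b"] unfolding f_def[abs_def] has_bochner_integral_iff by auto
  have norm2: "(norm x)\<^sup>2 = (\<Sum>b\<in>Basis. (x \<bullet> b)\<^sup>2)" for x :: 'a
    unfolding power2_norm_eq_inner by (subst euclidean_inner) (simp add: power2_eq_square)
  have cisprod: "cis (sum g A) = (\<Prod>i\<in>A. cis (g i))" if "finite A" for g :: "'a \<Rightarrow> real" and A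
    using that by induction (auto simp flip: cis_mult)
  have F: "complex_of_real (exp (- pi * (norm w)\<^sup>2 / \<tau>\<^sup>2)) * cis (2 * pi * (w \<bullet> u)) = (\<Prod>b\<in>Basis. f b (w \<bullet> b))" for w
  proof -
    have "exp (- pi * (norm w)\<^sup>2 / \<tau>\<^sup>2) = (\<Prod>b\<in>Basis. exp (- pi * (w \<bullet> b)\<^sup>2 / \<tau>\<^sup>2))"
      unfolding norm2 by (subst exp_sum[symmetric]) (auto simp: sum_distrib_left sum_divide_distrib)
    moreover have "cis (2 * pi * (w \<bullet> u)) = (\<Prod>b\<in>Basis. cis (2 * pi * ((w \<bullet> b) * (u \<bullet> b))))"
      by (subst cisprod[symmetric]) (auto simp: euclidean_inner[of w u] sum_distrib_left)
    ultimately show ?thesis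
      by (simp add: f_def prod.distrib)
  qed
  have V: "complex_of_real (\<tau> ^ DIM('a) * exp (- pi * \<tau>\<^sup>2 * (norm u)\<^sup>2)) = (\<Prod>b\<in>Basis. integral\<^sup>L lborel (f b))"
  proof -
    have "exp (- pi * \<tau>\<^sup>2 * (norm u)\<^sup>2) = (\<Prod>b\<in>Basis. exp (- pi * \<tau>\<^sup>2 * (u \<bullet> b)\<^sup>2))"
      unfolding norm2 by (subst exp_sum[symmetric]) (auto simp: sum_distrib_left)
    then show ?thesis by (simp add: fi prod.distrib)
  qed
  have m: "(\<lambda>f. \<Sum>b\<in>Basis. f b *\<^sub>R b) \<in> (\<Pi>\<^sub>M b\<in>(Basis::'a set). lborel) \<rightarrow>\<^sub>M (borel :: 'a measure)"
    by measurable
  have fm[measurable]: "f b \<in> borel_measurable borel" for b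
    using fi(1)[of b] by (simp add: integrable_iff_bounded) 
  have comp: "(\<Prod>b\<in>Basis. f b ((\<Sum>b\<in>Basis. x b *\<^sub>R b) \<bullet> b)) = (\<Prod>b\<in>Basis. f b (x b))" for x
    by (intro prod.cong) auto
  have i: "integrable (\<Pi>\<^sub>M b\<in>(Basis::'a set). lborel) (\<lambda>x. (\<Prod>b\<in>Basis. f b (x b)))"
    by (intro product_integrable_prod) (auto simp: fi)
  show ?thesis
    unfolding F V has_bochner_integral_iff
  proof
    show "integrable lborel (\<lambda>w. \<Prod>b\<in>Basis. f b (w \<bullet> b))"
      by (subst lborel_eq, subst integrable_distr_eq[OF m]) (auto simp: comp i)
    show "(\<integral>w. (\<Prod>b\<in>Basis. f b (w \<bullet> b)) \<partial>lborel) = (\<Prod>b\<in>Basis. integral\<^sup>L lborel (f b))"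
      by (subst lborel_eq, subst integral_distr[OF m]) (auto simp: comp intro!: product_integral_prod fi)
  qed
qed

lemma gaussian_integrable:
  assumes "\<tau> > 0"
  shows "integrable lborel (\<lambda>w::'a::euclidean_space. exp (- pi * (norm w)\<^sup>2 / \<tau>\<^sup>2))"
proof -
  have "integrable lborel (\<lambda>w::'a. complex_of_real (exp (- pi * (norm w)\<^sup>2 / \<tau>\<^sup>2)))"
    using gaussian_fourier[OF assms, of "0::'a"] by (auto simp: has_bochner_integral_iff)
  then show ?thesis by (simp only: complex_of_real_integrable_eq)
qed

lemma nn_integral_gaussian:
  assumes "\<tau> > 0"
  shows "(\<integral>\<^sup>+ w. ennreal (exp (- pi * (norm (w::'a::euclidean_space))\<^sup>2 / \<tau>\<^sup>2)) \<partial>lborel) = ennreal (\<tau> ^ DIM('a))"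
proof -
  have "(\<integral>w. complex_of_real (exp (- pi * (norm (w::'a))\<^sup>2 / \<tau>\<^sup>2)) \<partial>lborel) = complex_of_real (\<tau> ^ DIM('a))"
    using gaussian_fourier[OF assms, of "0::'a"] by (auto simp: has_bochner_integral_iff)
  then have "(\<integral>w. exp (- pi * (norm (w::'a))\<^sup>2 / \<tau>\<^sup>2) \<partial>lborel) = \<tau> ^ DIM('a)"
    by (simp only: integral_complex_of_real of_real_eq_iff)
  then show ?thesis
    by (subst nn_integral_eq_integral[OF gaussian_integrable[OF assms]]) auto
qed

lemma borel_measurable_cis [measurable]: "cis \<in> borel_measurable borel"
  by (intro borel_measurable_continuous_onI continuous_intros)

text \<open>
  Expand the Gaussian \<open>exp (- pi \<tau>\<^sup>2 |u|\<^sup>2)\<close> as a superposition of characters \<open>cis (2 pi w \<bullet> u)\<close> and exchange the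
  integrals. With \<open>f = 1\<close> this is a concentration inequality of Esseen type: the law of \<open>u\<close> cannot have much
  mass near the origin if its characteristic function is small on average. With \<open>f\<close> a character and \<open>u\<close> the identity
  it dominates a windowed Fourier transform by a Gaussian average of the plain one.
\<close>
lemma gaussian_weighted_integral_le:
  fixes u :: "'b \<Rightarrow> 'a::euclidean_space" and f :: "'b \<Rightarrow> complex"
  assumes M: "finite_measure M"
    and f [measurable]: "f \<in> borel_measurable M"
    and u [measurable]: "u \<in> borel_measurable M"
    and B: "\<And>y. cmod (f y) \<le> B" and \<tau>: "\<tau> > 0"
  shows "ennreal (cmod (\<integral>y. exp (- pi * \<tau>\<^sup>2 * (norm (u y))\<^sup>2) *\<^sub>R f y \<partial>M))
    \<le> ennreal (1 / \<tau> ^ DIM('a)) *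
       (\<integral>\<^sup>+ w. ennreal (exp (- pi * (norm w)\<^sup>2 / \<tau>\<^sup>2) * cmod (\<integral>y. cis (2 * pi * (w \<bullet> u y)) * f y \<partial>M)) \<partial>lborel)"
proof -
  interpret finite_measure M by (rule M)
  interpret pair_sigma_finite lborel M ..
  define g :: "'a \<Rightarrow> real" where "g w = exp (- pi * (norm w)\<^sup>2 / \<tau>\<^sup>2)" for w
  define h where "h w y = complex_of_real (g w) * cis (2 * pi * (w \<bullet> u y)) * f y" for w y
  have g0: "g w > 0" for w by (simp add: g_def)
  have [measurable]: "g \<in> borel_measurable borel" unfolding g_def[abs_def] by measurable
  have fi: "integrable M (\<lambda>y. cmod (f y))"
    using B by (intro integrable_const_bound[where B = B]) auto
  have ch: "case_prod h \<in> borel_measurable (lborel \<Otimes>\<^sub>M M)"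
    unfolding h_def[abs_def] by measurable
  have nh: "cmod (h w y) = g w * cmod (f y)" for w y
    using g0[of w] by (simp add: h_def norm_mult)
  have hM: "integrable M (h w)" for w
  proof -
    have "h w \<in> borel_measurable M" unfolding h_def[abs_def] by measurable
    then show ?thesis
      using B g0[of w] by (intro integrable_const_bound[where B = "g w * B"]) (auto simp: nh)
  qed
  have int: "integrable (lborel \<Otimes>\<^sub>M M) (case_prod h)"
  proof (rule Fubini_integrable[OF ch])
    show "integrable lborel (\<lambda>x. \<integral>y. cmod (case (x, y) of (x, y) \<Rightarrow> h x y) \<partial>M)"
      using gaussian_integrable[OF \<tau>, where 'a='a] by (simp add: nh g_def)
    show "AE x in lborel. integrable M (\<lambda>y. case (x, y) of (x, y) \<Rightarrow> h x y)"
      using hM by simp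
  qed
  have inner: "(\<integral>w. h w y \<partial>lborel) = complex_of_real (\<tau> ^ DIM('a)) * (exp (- pi * \<tau>\<^sup>2 * (norm (u y))\<^sup>2) *\<^sub>R f y)" for y
    using gaussian_fourier[OF \<tau>, of "u y"]
    by (simp add: h_def g_def has_bochner_integral_iff scaleR_conv_of_real)
  have "complex_of_real (\<tau> ^ DIM('a)) * (\<integral>y. exp (- pi * \<tau>\<^sup>2 * (norm (u y))\<^sup>2) *\<^sub>R f y \<partial>M)
      = (\<integral>y. (\<integral>w. h w y \<partial>lborel) \<partial>M)"
    unfolding inner by (rule integral_mult_right_zero[symmetric])
  also have "\<dots> = (\<integral>w. (\<integral>y. h w y \<partial>M) \<partial>lborel)"
    by (rule Fubini_integral[OF int])
  also have "\<dots> = (\<integral>w. g w *\<^sub>R (\<integral>y. cis (2 * pi * (w \<bullet> u y)) * f y \<partial>M) \<partial>lborel)"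
    unfolding h_def mult.assoc by (simp add: scaleR_conv_of_real)
  finally have eq: "complex_of_real (\<tau> ^ DIM('a)) * (\<integral>y. exp (- pi * \<tau>\<^sup>2 * (norm (u y))\<^sup>2) *\<^sub>R f y \<partial>M)
      = (\<integral>w. g w *\<^sub>R (\<integral>y. cis (2 * pi * (w \<bullet> u y)) * f y \<partial>M) \<partial>lborel)" .
  have "integrable lborel (\<lambda>w. \<integral>y. h w y \<partial>M)"
    using integrable_fst'[OF int] by simp
  moreover have "(\<lambda>w. \<integral>y. h w y \<partial>M) = (\<lambda>w. g w *\<^sub>R (\<integral>y. cis (2 * pi * (w \<bullet> u y)) * f y \<partial>M))"
    unfolding h_def mult.assoc by (simp add: scaleR_conv_of_real)
  ultimately have i: "integrable lborel (\<lambda>w. g w *\<^sub>R (\<integral>y. cis (2 * pi * (w \<bullet> u y)) * f y \<partial>M))" by simp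
  have "ennreal (cmod (\<integral>w. g w *\<^sub>R (\<integral>y. cis (2 * pi * (w \<bullet> u y)) * f y \<partial>M) \<partial>lborel))
     \<le> (\<integral>\<^sup>+ w. ennreal (cmod (g w *\<^sub>R (\<integral>y. cis (2 * pi * (w \<bullet> u y)) * f y \<partial>M))) \<partial>lborel)"
    by (rule integral_norm_bound_ennreal[OF i])
  also have "\<dots> = (\<integral>\<^sup>+ w. ennreal (g w * cmod (\<integral>y. cis (2 * pi * (w \<bullet> u y)) * f y \<partial>M)) \<partial>lborel)"
    using g0 by (simp add: less_imp_le)
  finally have "ennreal (\<tau> ^ DIM('a) * cmod (\<integral>y. exp (- pi * \<tau>\<^sup>2 * (norm (u y))\<^sup>2) *\<^sub>R f y \<partial>M))
     \<le> (\<integral>\<^sup>+ w. ennreal (g w * cmod (\<integral>y. cis (2 * pi * (w \<bullet> u y)) * f y \<partial>M)) \<partial>lborel)"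
    unfolding eq[symmetric] using \<tau> by (simp add: norm_mult norm_power)
  then have "ennreal (1 / \<tau> ^ DIM('a)) * ennreal (\<tau> ^ DIM('a) * cmod (\<integral>y. exp (- pi * \<tau>\<^sup>2 * (norm (u y))\<^sup>2) *\<^sub>R f y \<partial>M))
     \<le> ennreal (1 / \<tau> ^ DIM('a)) * (\<integral>\<^sup>+ w. ennreal (g w * cmod (\<integral>y. cis (2 * pi * (w \<bullet> u y)) * f y \<partial>M)) \<partial>lborel)"
    by (rule mult_left_mono) simp
  moreover have "ennreal (1 / \<tau> ^ DIM('a)) * ennreal (\<tau> ^ DIM('a) * cmod (\<integral>y. exp (- pi * \<tau>\<^sup>2 * (norm (u y))\<^sup>2) *\<^sub>R f y \<partial>M))
      = ennreal (cmod (\<integral>y. exp (- pi * \<tau>\<^sup>2 * (norm (u y))\<^sup>2) *\<^sub>R f y \<partial>M))"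
    using \<tau> by (subst ennreal_mult[symmetric]) auto
  ultimately show ?thesis by (simp add: g_def)
qed

lemma nn_integral_gaussian_weighted_le:
  fixes u :: "'b \<Rightarrow> 'a::euclidean_space" and f :: "'b \<Rightarrow> real"
  assumes M: "finite_measure M"
    and f [measurable]: "f \<in> borel_measurable M"
    and u [measurable]: "u \<in> borel_measurable M"
    and f01: "\<And>y. 0 \<le> f y" "\<And>y. f y \<le> 1" and \<tau>: "\<tau> > 0"
  shows "(\<integral>\<^sup>+ y. ennreal (exp (- pi * \<tau>\<^sup>2 * (norm (u y))\<^sup>2) * f y) \<partial>M)
    \<le> ennreal (1 / \<tau> ^ DIM('a)) *
       (\<integral>\<^sup>+ w. ennreal (exp (- pi * (norm w)\<^sup>2 / \<tau>\<^sup>2) * cmod (\<integral>y. cis (2 * pi * (w \<bullet> u y)) * complex_of_real (f y) \<partial>M)) \<partial>lborel)"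
proof -
  interpret finite_measure M by (rule M)
  let ?g = "\<lambda>y. exp (- pi * \<tau>\<^sup>2 * (norm (u y))\<^sup>2) * f y"
  have "(\<integral>\<^sup>+ y. ennreal (?g y) \<partial>M) = ennreal (\<integral>y. ?g y \<partial>M)"
    using f01 by (intro nn_integral_eq_integral integrable_const_bound[where B = 1]) (auto simp: mult_le_one)
  also have "(\<integral>y. ?g y \<partial>M) = cmod (complex_of_real (\<integral>y. ?g y \<partial>M))"
    using f01 by (simp add: integral_nonneg_AE)
  also have "complex_of_real (\<integral>y. ?g y \<partial>M) = (\<integral>y. exp (- pi * \<tau>\<^sup>2 * (norm (u y))\<^sup>2) *\<^sub>R complex_of_real (f y) \<partial>M)"
    by (subst integral_complex_of_real[symmetric]) (simp add: scaleR_conv_of_real)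
  finally show ?thesis
    using gaussian_weighted_integral_le[OF M, of "\<lambda>y. complex_of_real (f y)" u 1 \<tau>] f01 \<tau> by simp
qed

lemma suminf_dyadic_powr:
  fixes \<delta> :: real
  assumes "\<delta> > 0"
  shows "(\<Sum>k. ennreal ((2 ^ k) powr (- \<delta>))) = ennreal (1 / (1 - 2 powr (- \<delta>)))"
proof -
  have lt: "2 powr (- \<delta>) < (1::real)" using assms by (simp add: powr_less_one)
  have "(2 ^ k) powr (- \<delta>) = (2 powr (- \<delta>)) ^ k" for k :: nat
    by (simp add: powr_powr powr_realpow[symmetric] mult.commute)
  moreover have "(\<Sum>k. ennreal ((2 powr (- \<delta>)) ^ k)) = ennreal (\<Sum>k. (2 powr (- \<delta>)) ^ k)"
    using lt by (intro suminf_ennreal2) (auto intro!: summable_geometric)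
  ultimately show ?thesis using lt by (simp add: suminf_geometric)
qed

text \<open>
  A power of \<open>1 + |z|\<close> is dominated by a superposition of Gaussians of dyadic widths: the term with
  \<open>|z| \<le> 2 ^ k \<le> 2 (1 + |z|)\<close> alone suffices. Integrals of powers thus reduce to Gaussian integrals.
\<close>
lemma powr_le_suminf_gaussian:
  fixes z :: "'a::euclidean_space"
  assumes "a \<ge> 0"
  shows "ennreal ((1 + norm z) powr (- a))
    \<le> ennreal (2 powr a * exp pi) * (\<Sum>k. ennreal ((2 ^ k) powr (- a) * exp (- pi * (norm z)\<^sup>2 / (2 ^ k)\<^sup>2)))"
proof -
  obtain k0 :: nat where "norm z < 2 ^ k0" using real_arch_pow[of 2 "norm z"] by auto
  then have ex: "\<exists>k::nat. norm z \<le> 2 ^ k" by (auto intro: less_imp_le)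
  define k where "k = (LEAST k::nat. norm z \<le> 2 ^ k)"
  have k: "norm z \<le> 2 ^ k" unfolding k_def by (rule LeastI_ex[OF ex])
  have "2 ^ k \<le> 2 * (1 + norm z)"
  proof (cases k)
    case (Suc j)
    then have "\<not> norm z \<le> 2 ^ j" using not_less_Least[of j "\<lambda>k. norm z \<le> 2 ^ k"] k_def by auto
    then show ?thesis using Suc by simp
  qed (use norm_ge_zero[of z] in simp)
  then have "(2 * (1 + norm z)) powr (- a) \<le> (2 ^ k) powr (- a)"
    using assms by (intro powr_mono2') auto
  moreover have "(2 * (1 + norm z)) powr (- a) = 2 powr (- a) * (1 + norm z) powr (- a)"
    by (intro powr_mult)
  ultimately have "2 powr a * (2 powr (- a) * (1 + norm z) powr (- a)) \<le> 2 powr a * (2 ^ k) powr (- a)"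
    by (intro mult_left_mono) auto
  then have 1: "(1 + norm z) powr (- a) \<le> 2 powr a * (2 ^ k) powr (- a)"
    by (simp add: powr_add[symmetric] flip: mult.assoc)
  have "(norm z)\<^sup>2 / (2 ^ k)\<^sup>2 \<le> 1"
    using k by (simp add: divide_le_eq_1 power_mono)
  then have "1 \<le> exp pi * exp (- pi * (norm z)\<^sup>2 / (2 ^ k)\<^sup>2)"
    by (simp add: exp_add[symmetric] field_simps)
  then have "(1 + norm z) powr (- a) \<le> (2 powr a * (2 ^ k) powr (- a)) * (exp pi * exp (- pi * (norm z)\<^sup>2 / (2 ^ k)\<^sup>2))"
    using 1 by (smt (verit) mult_left_mono mult_cancel_left2 mult_nonneg_nonneg powr_ge_zero)
  then have "ennreal ((1 + norm z) powr (- a)) \<le> ennreal ((2 powr a * exp pi) * ((2 ^ k) powr (- a) * exp (- pi * (norm z)\<^sup>2 / (2 ^ k)\<^sup>2)))"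
    by (intro ennreal_leI) (simp add: mult_ac)
  also have "\<dots> = ennreal (2 powr a * exp pi) * (\<Sum>k\<in>{k}. ennreal ((2 ^ k) powr (- a) * exp (- pi * (norm z)\<^sup>2 / (2 ^ k)\<^sup>2)))"
    by (subst ennreal_mult) auto
  also have "\<dots> \<le> ennreal (2 powr a * exp pi) * (\<Sum>k. ennreal ((2 ^ k) powr (- a) * exp (- pi * (norm z)\<^sup>2 / (2 ^ k)\<^sup>2)))"
    by (intro mult_left_mono sum_le_suminf) auto
  finally show ?thesis .
qed

lemma nn_integral_powr_finite:
  fixes \<kappa> :: real
  assumes "\<kappa> > 0"
  shows "(\<integral>\<^sup>+ w. ennreal ((1 + norm (w::'a::euclidean_space)) powr (- (DIM('a) + \<kappa>))) \<partial>lborel) < \<top>"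
proof -
  define a where "a = DIM('a) + \<kappa>"
  have a: "a \<ge> 0" using assms by (simp add: a_def)
  have e: "(2 ^ k) powr (- a) * (2 ^ k) ^ DIM('a) = (2 ^ k) powr (- \<kappa>)" for k :: nat
  proof -
    have "((2::real) ^ k) ^ DIM('a) = (2 ^ k) powr DIM('a)" by (simp add: powr_realpow)
    then show ?thesis by (simp add: a_def powr_add[symmetric])
  qed
  have "(\<integral>\<^sup>+ w. ennreal ((1 + norm (w::'a)) powr (- a)) \<partial>lborel)
    \<le> (\<integral>\<^sup>+ w. ennreal (2 powr a * exp pi) * (\<Sum>k. ennreal ((2 ^ k) powr (- a) * exp (- pi * (norm (w::'a))\<^sup>2 / (2 ^ k)\<^sup>2))) \<partial>lborel)"
    by (intro nn_integral_mono powr_le_suminf_gaussian[OF a])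
  also have "\<dots> = ennreal (2 powr a * exp pi) * (\<Sum>k. \<integral>\<^sup>+ w. ennreal ((2 ^ k) powr (- a) * exp (- pi * (norm (w::'a))\<^sup>2 / (2 ^ k)\<^sup>2)) \<partial>lborel)"
    by (simp add: nn_integral_cmult nn_integral_suminf)
  also have "\<dots> = ennreal (2 powr a * exp pi) * (\<Sum>k. ennreal ((2 ^ k) powr (- \<kappa>)))"
    by (simp add: ennreal_mult nn_integral_cmult nn_integral_gaussian[where 'a='a, unfolded mult_minus_left minus_divide_left[symmetric]] flip: e)
  also have "\<dots> < \<top>"
    unfolding suminf_dyadic_powr[OF assms] by (simp add: ennreal_mult[symmetric] ennreal_mult_less_top)
  finally show ?thesis by (simp add: a_def)
qed

text \<open>
  The left-hand side is of order \<open>\<tau> powr (DIM('a) - b)\<close> for large \<open>\<tau>\<close> and \<open>b < DIM('a)\<close>. Giving up a little of the exponent leaves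
  room for the geometric series over dyadic scales, and covers \<open>b \<ge> DIM('a)\<close> as well.
\<close>
lemma nn_integral_gaussian_powr_le:
  fixes b b' :: real
  assumes b: "0 < b'" "b' < b" "b' \<le> DIM('a::euclidean_space)"
  shows "\<exists>C\<ge>0. \<forall>\<tau>>0. (\<integral>\<^sup>+ w. ennreal (exp (- pi * (norm (w::'a))\<^sup>2 / \<tau>\<^sup>2) * (1 + norm w) powr (- b)) \<partial>lborel)
     \<le> ennreal (C * \<tau> powr (DIM('a) - b'))"
proof -
  define C where "C = 2 powr b * exp pi * (1 / (1 - 2 powr (- (b - b'))))"
  have lt: "2 powr (- (b - b')) < (1::real)" using b by (simp add: powr_less_one)
  have C: "C \<ge> 0" using lt by (simp add: C_def)
  have "(\<integral>\<^sup>+ w. ennreal (exp (- pi * (norm (w::'a))\<^sup>2 / \<tau>\<^sup>2) * (1 + norm w) powr (- b)) \<partial>lborel)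
     \<le> ennreal (C * \<tau> powr (DIM('a) - b'))" if \<tau>: "\<tau> > 0" for \<tau>
  proof -
    let ?G = "\<lambda>\<tau> (w::'a). exp (- pi * (norm w)\<^sup>2 / \<tau>\<^sup>2)"
    have trm: "(\<integral>\<^sup>+ w. ennreal (?G \<tau> w * ((2 ^ k) powr (- b) * ?G (2 ^ k) w)) \<partial>lborel)
        \<le> ennreal (\<tau> powr (DIM('a) - b')) * ennreal ((2 ^ k) powr (- (b - b')))" for k :: nat
    proof -
      \<comment> \<open>The product of two centred Gaussians is at most the narrower one.\<close>
      define m where "m = min \<tau> (2 ^ k)"
      have m: "m > 0" using \<tau> by (simp add: m_def)
      have G1: "?G \<sigma> w \<le> 1" for \<sigma> w by simp
      have "?G \<tau> w * ?G (2 ^ k) w \<le> ?G m w" for w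
      proof (cases "\<tau> \<le> 2 ^ k")
        case True then have "m = \<tau>" by (simp add: m_def)
        then show ?thesis using G1[of w "2 ^ k"] by (metis exp_ge_zero mult_left_le)
      next
        case False then have "m = 2 ^ k" by (simp add: m_def)
        then show ?thesis using G1[of w \<tau>] by (metis exp_ge_zero mult_left_le mult.commute)
      qed
      then have "(\<integral>\<^sup>+ w. ennreal (?G \<tau> w * ((2 ^ k) powr (- b) * ?G (2 ^ k) w)) \<partial>lborel)
        \<le> (\<integral>\<^sup>+ w. ennreal ((2 ^ k) powr (- b) * ?G m w) \<partial>lborel)"
        by (intro nn_integral_mono ennreal_leI) (simp add: mult.left_commute mult_left_mono)
      also have "\<dots> = ennreal ((2 ^ k) powr (- b)) * ennreal (m ^ DIM('a))"
        by (simp add: ennreal_mult nn_integral_cmult nn_integral_gaussian[OF m, unfolded mult_minus_left minus_divide_left[symmetric]])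
      also have "m ^ DIM('a) = m powr (DIM('a) - b') * m powr b'"
        using m by (simp add: powr_add[symmetric] powr_realpow)
      also have "ennreal ((2 ^ k) powr (- b)) * ennreal (m powr (DIM('a) - b') * m powr b')
         \<le> ennreal ((2 ^ k) powr (- b)) * ennreal (\<tau> powr (DIM('a) - b') * (2 ^ k) powr b')"
        using b m by (intro mult_left_mono ennreal_leI mult_mono powr_mono2) (auto simp: m_def)
      also have "\<dots> = ennreal (\<tau> powr (DIM('a) - b')) * ennreal ((2 ^ k) powr (- (b - b')))"
      proof -
        have "((2::real) ^ k) powr (- (b - b')) = (2 ^ k) powr (- b) * (2 ^ k) powr b'"
          by (simp add: powr_add[symmetric])
        then show ?thesis by (simp add: ennreal_mult mult_ac)
      qed
      finally show ?thesis .
    qed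
    have "(\<integral>\<^sup>+ w. ennreal (?G \<tau> w * (1 + norm w) powr (- b)) \<partial>lborel)
      \<le> (\<integral>\<^sup>+ w. ennreal (2 powr b * exp pi) * (\<Sum>k. ennreal (?G \<tau> w * ((2 ^ k) powr (- b) * ?G (2 ^ k) w))) \<partial>lborel)"
    proof (intro nn_integral_mono)
      fix w :: 'a
      have "ennreal (?G \<tau> w * (1 + norm w) powr (- b)) = ennreal (?G \<tau> w) * ennreal ((1 + norm w) powr (- b))"
        by (rule ennreal_mult) auto
      also have "\<dots> \<le> ennreal (?G \<tau> w) * (ennreal (2 powr b * exp pi) * (\<Sum>k. ennreal ((2 ^ k) powr (- b) * ?G (2 ^ k) w)))"
        using b by (intro mult_left_mono powr_le_suminf_gaussian) auto
      also have "\<dots> = ennreal (2 powr b * exp pi) * (\<Sum>k. ennreal (?G \<tau> w) * ennreal ((2 ^ k) powr (- b) * ?G (2 ^ k) w))"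
        by (simp add: mult.left_commute)
      also have "\<dots> = ennreal (2 powr b * exp pi) * (\<Sum>k. ennreal (?G \<tau> w * ((2 ^ k) powr (- b) * ?G (2 ^ k) w)))"
        by (simp add: ennreal_mult)
      finally show "ennreal (?G \<tau> w * (1 + norm w) powr (- b)) \<le> ennreal (2 powr b * exp pi) * (\<Sum>k. ennreal (?G \<tau> w * ((2 ^ k) powr (- b) * ?G (2 ^ k) w)))" .
    qed
    also have "\<dots> = ennreal (2 powr b * exp pi) * (\<Sum>k. \<integral>\<^sup>+ w. ennreal (?G \<tau> w * ((2 ^ k) powr (- b) * ?G (2 ^ k) w)) \<partial>lborel)"
      by (simp add: nn_integral_cmult nn_integral_suminf)
    also have "\<dots> \<le> ennreal (2 powr b * exp pi) * (\<Sum>k. ennreal (\<tau> powr (DIM('a) - b')) * ennreal ((2 ^ k) powr (- (b - b'))))"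
      by (intro mult_left_mono suminf_le trm) auto
    also have "\<dots> = ennreal (2 powr b * exp pi) * (ennreal (\<tau> powr (DIM('a) - b')) * ennreal (1 / (1 - 2 powr (- (b - b')))))"
      using b by (subst ennreal_suminf_cmult) (subst suminf_dyadic_powr, auto)
    also have "\<dots> = ennreal (C * \<tau> powr (DIM('a) - b'))"
      using lt by (simp add: C_def ennreal_mult[symmetric] mult_ac)
    finally show ?thesis .
  qed
  with C show ?thesis by blast
qed

lemma nn_integral_lborel_translate:
  fixes z :: "'a::euclidean_space"
  assumes "f \<in> borel_measurable borel"
  shows "(\<integral>\<^sup>+ u. f (u + z) \<partial>lborel) = (\<integral>\<^sup>+ u. f u \<partial>lborel)"
proof -
  have "(\<integral>\<^sup>+ u. f u \<partial>lborel) = (\<integral>\<^sup>+ u. f u \<partial>distr lborel borel ((+) z))"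
    by (simp add: lborel_distr_plus)
  also have "\<dots> = (\<integral>\<^sup>+ u. f (z + u) \<partial>lborel)"
    using assms by (subst nn_integral_distr) auto
  finally show ?thesis by (simp add: add.commute)
qed

text \<open>
  A Gaussian absorbs polynomial growth at the price of half of its exponent.
\<close>
lemma gaussian_powr_le:
  fixes x a :: real
  assumes "x \<ge> 0" "a \<ge> 0"
  shows "exp (- pi * x\<^sup>2) * (1 + x) powr a \<le> exp (a\<^sup>2 / 2) * exp (- pi * x\<^sup>2 / 2)"
proof -
  have "(1 + x) powr a \<le> exp x powr a" using assms by (intro powr_mono2) auto
  also have "\<dots> = exp (a * x)" by (simp add: powr_def)
  finally have "exp (- pi * x\<^sup>2) * (1 + x) powr a \<le> exp (- pi * x\<^sup>2) * exp (a * x)" by simp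
  also have "\<dots> \<le> exp (a\<^sup>2 / 2) * exp (- pi * x\<^sup>2 / 2)"
  proof -
    have "a * x \<le> a\<^sup>2 / 2 + x\<^sup>2 / 2" using sum_squares_bound[of a x] by simp
    also have "\<dots> \<le> a\<^sup>2 / 2 + pi * x\<^sup>2 / 2"
      using pi_gt3 mult_right_mono[of 1 pi "x\<^sup>2"] by simp
    finally show ?thesis by (simp add: exp_add[symmetric])
  qed
  finally show ?thesis .
qed

lemma integral_prod_mult:
  fixes f :: "'a \<Rightarrow> complex" and g :: "'b \<Rightarrow> complex"
  assumes M: "prob_space M1" "prob_space M2"
    and f[measurable]: "f \<in> borel_measurable M1" and g[measurable]: "g \<in> borel_measurable M2"
    and le: "\<And>x. cmod (f x) \<le> 1" "\<And>y. cmod (g y) \<le> 1"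
  shows "(\<integral>p. f (fst p) * g (snd p) \<partial>(M1 \<Otimes>\<^sub>M M2)) = (\<integral>x. f x \<partial>M1) * (\<integral>y. g y \<partial>M2)"
proof -
  interpret M1: prob_space M1 by (rule M)
  interpret M2: prob_space M2 by (rule M)
  interpret P: pair_prob_space M1 M2 ..
  have "integrable (M1 \<Otimes>\<^sub>M M2) (\<lambda>p. f (fst p) * g (snd p))"
    using le by (intro P.P.integrable_const_bound[where B = 1]) (auto simp: norm_mult mult_le_one)
  from P.integral_fst'[OF this] show ?thesis by simp
qed

text \<open>
  Weighted arithmetic-geometric mean inequality in a crude form. Applied pointwise to suitably normalised
  functions it takes the place of Hoelder's inequality with three factors.
\<close>
lemma powr_mult_le_sum:
  fixes x y z a b c :: real
  assumes "0 \<le> x" "0 \<le> y" "0 \<le> z" "0 \<le> a" "0 \<le> b" "0 \<le> c" "a + b + c = 1"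
  shows "x powr a * y powr b * z powr c \<le> x + y + z"
proof (cases "x = 0 \<or> y = 0 \<or> z = 0")
  case True then show ?thesis using assms by auto
next
  case False
  define m where "m = x + y + z"
  have m: "m > 0" using False assms by (auto simp: m_def)
  have "x powr a * y powr b * z powr c \<le> m powr a * m powr b * m powr c"
    using assms by (intro mult_mono powr_mono2) (auto simp: m_def)
  also have "\<dots> = m powr 1" unfolding assms(7)[symmetric] by (simp add: powr_add)
  finally show ?thesis using m by (simp add: m_def)
qed

section \<open>Lower and upper bounds for Hausdorff dimension\<close>

lemma hausdorff_measure_mono: "A \<subseteq> B \<Longrightarrow> hausdorff_measure s A \<le> hausdorff_measure s B"
  unfolding hausdorff_measure_def hausdorff_content_def
  by (intro SUP_mono' INF_superset_mono) auto

lemma hausdorff_dim_mono: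
  assumes "A \<subseteq> B" shows "hausdorff_dim A \<le> hausdorff_dim B"
proof -
  have "hausdorff_measure s A = 0" if "hausdorff_measure s B = 0" for s
    using hausdorff_measure_mono[OF assms, of s] that by simp
  then show ?thesis
    unfolding hausdorff_dim_def by (intro Inf_superset_mono image_mono) blast
qed

text \<open>
  Cover by \<open>N\<close> intervals of length \<open>2 L / N\<close>; their contribution \<open>(2 L) powr s * N powr (1 - s)\<close> tends to \<open>0\<close>.
\<close>
lemma hausdorff_measure_bounded_real_eq_0:
  fixes E :: "real set"
  assumes E: "bounded E" and s: "s > 1"
  shows "hausdorff_measure s E = 0"
proof -
  obtain L where L: "L > 0" "\<And>x. x \<in> E \<Longrightarrow> \<bar>x\<bar> \<le> L"
    using E unfolding bounded_pos by auto
  have "hausdorff_content s \<delta> E \<le> 0" if \<delta>: "\<delta> > 0" for \<delta>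
  proof (rule tendsto_lowerbound)
    have "((\<lambda>N. (2 * L) powr s * real N powr (- (s - 1))) \<longlongrightarrow> (2 * L) powr s * 0) sequentially"
      using s by (intro tendsto_mult tendsto_const tendsto_neg_powr filterlim_real_sequentially) auto
    then show "((\<lambda>N. ennreal ((2 * L) powr s * real N powr (- (s - 1)))) \<longlongrightarrow> 0) sequentially"
      using tendsto_ennrealI by fastforce
    have "eventually (\<lambda>N. N \<ge> 1 \<and> real N \<ge> 2 * L / \<delta>) sequentially"
      by (intro eventually_conj eventually_ge_at_top) (use eventually_ge_at_top[of "nat \<lceil>2 * L / \<delta>\<rceil>"] in eventually_elim, linarith)
    then show "eventually (\<lambda>N. hausdorff_content s \<delta> E \<le> ennreal ((2 * L) powr s * real N powr (- (s - 1)))) sequentially"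
    proof eventually_elim
      case (elim N)
      define h where "h = 2 * L / N"
      have h: "h > 0" "h \<le> \<delta>" "N * h = 2 * L" using elim L \<delta> by (auto simp: h_def field_simps)
      define U :: "nat \<Rightarrow> real set" where "U i = (if i < N then {- L + i * h .. - L + i * h + h} else {})" for i
      have diam: "diameter (U i) = (if i < N then h else 0)" for i
        using h by (simp add: U_def)
      have cover: "E \<subseteq> (\<Union>i. U i)"
      proof
        fix x assume "x \<in> E"
        then have x: "- L \<le> x" "x \<le> L" using L(2)[of x] by auto
        show "x \<in> (\<Union>i. U i)"
        proof (cases "x = L")
          case True
          have "real (N - 1) = N - 1" using elim by simp
          then have "x \<in> U (N - 1)" using True h elim by (simp add: U_def algebra_simps)
          then show ?thesis by blast
        next
          case False
          define i where "i = nat \<lfloor>(x + L) / h\<rfloor>"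
          have q: "(x + L) / h \<ge> 0" using x h by simp
          have i: "real i \<le> (x + L) / h" "(x + L) / h < i + 1"
            using q unfolding i_def by linarith+
          have "(x + L) / h < N" using x False h by (simp add: divide_less_eq)
          then have "i < N" using i(1) by linarith
          moreover have "i * h \<le> x + L" "x + L \<le> i * h + h"
            using i h by (auto simp: field_simps)
          ultimately have "x \<in> U i" by (simp add: U_def algebra_simps)
          then show ?thesis by blast
        qed
      qed
      have "hausdorff_content s \<delta> E \<le> (\<Sum>i. diam_powr (U i) s)"
        unfolding hausdorff_content_def
      proof (rule INF_lower, safe)
        show "bounded (U i)" "diameter (U i) \<le> \<delta>" for i
          using h \<delta> unfolding diam by (auto simp: U_def)
        show "x \<in> (\<Union>i. U i)" if "x \<in> E" for x using cover that by blast
      qed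
      also have "\<dots> = (\<Sum>i\<in>{..<N}. diam_powr (U i) s)"
        by (rule suminf_finite) (auto simp: U_def diam_powr_def)
      also have "\<dots> = (\<Sum>i\<in>{..<N}. ennreal (h powr s))"
      proof (intro sum.cong refl)
        fix i assume "i \<in> {..<N}"
        then have "U i \<noteq> {}" "diameter (U i) = h" using h diam[of i] by (auto simp: U_def)
        then show "diam_powr (U i) s = ennreal (h powr s)" using s by (simp add: diam_powr_def)
      qed
      also have "\<dots> = ennreal (N * h powr s)" by (simp add: ennreal_mult ennreal_of_nat_eq_real_of_nat)
      also have "N * h powr s = (2 * L) powr s * real N powr (- (s - 1))"
      proof -
        have "h powr s = (2 * L) powr s * N powr (- s)"
          using L elim by (simp add: h_def powr_divide powr_minus divide_simps)
        moreover have "real N * N powr (- s) = N powr (- (s - 1))"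
          using elim powr_add[of N 1 "- s"] by simp
        ultimately show ?thesis by (simp add: mult.left_commute)
      qed
      finally show ?case .
    qed
  qed simp
  then have "hausdorff_measure s E \<le> 0" unfolding hausdorff_measure_def by (intro SUP_least) auto
  then show ?thesis by simp
qed

lemma hausdorff_dim_bounded_real_le_1:
  fixes E :: "real set"
  assumes "bounded E"
  shows "hausdorff_dim E \<le> 1"
proof (rule ennreal_le_epsilon)
  fix e :: real assume "0 < e"
  then have "hausdorff_measure (1 + e) E = 0"
    by (intro hausdorff_measure_bounded_real_eq_0 assms) auto
  then have "hausdorff_dim E \<le> ennreal (1 + e)"
    unfolding hausdorff_dim_def using \<open>0 < e\<close> by (intro Inf_lower imageI) auto
  then show "hausdorff_dim E \<le> 1 + ennreal e" using \<open>0 < e\<close> by simp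
qed

text \<open>
  Mass distribution principle: every covering set that meets \<open>N\<close> lies in a ball around a point of \<open>N\<close> whose radius
  is the diameter of the set, so the \<open>\<tau>\<close>-sum of a cover of \<open>E\<close> cannot be small.
\<close>
lemma hausdorff_dim_ge_if_ball_growth:
  fixes E :: "'a::{metric_space, second_countable_topology} set"
  assumes \<nu>: "sets \<nu> = sets borel"
    and \<tau>: "\<tau> > 0" and N: "N \<in> sets \<nu>" "emeasure \<nu> N > 0" "N \<subseteq> E" and C: "C \<ge> 0"
    and growth: "\<And>a \<delta>. a \<in> N \<Longrightarrow> 0 \<le> \<delta> \<Longrightarrow> \<delta> \<le> 1 \<Longrightarrow> emeasure \<nu> (cball a \<delta>) \<le> ennreal (C * \<delta> powr \<tau>)"
  shows "ennreal \<tau> \<le> hausdorff_dim E"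
  unfolding hausdorff_dim_def
proof (rule Inf_greatest)
  fix y assume "y \<in> ennreal ` {s. 0 \<le> s \<and> hausdorff_measure s E = 0}"
  then obtain s where s: "y = ennreal s" "0 \<le> s" "hausdorff_measure s E = 0" by auto
  show "ennreal \<tau> \<le> y"
  proof (rule ccontr)
    assume "\<not> ennreal \<tau> \<le> y"
    then have st: "s \<le> \<tau>" using s \<tau> by (auto simp: not_le ennreal_less_iff)
    have bound: "emeasure \<nu> N \<le> ennreal C * (\<Sum>i. diam_powr (U i) s)"
      if U: "\<forall>i. bounded (U i) \<and> diameter (U i) \<le> 1" "E \<subseteq> (\<Union>i. U i)" for U :: "nat \<Rightarrow> 'a set"
    proof -
      have "\<exists>B. B \<in> sets \<nu> \<and> U i \<inter> N \<subseteq> B \<and> emeasure \<nu> B \<le> ennreal C * diam_powr (U i) s" for i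
      proof (cases "U i \<inter> N = {}")
        case True then show ?thesis by (intro exI[of _ "{}"]) auto
      next
        case False
        then obtain a where a: "a \<in> U i" "a \<in> N" by auto
        define \<delta> where "\<delta> = diameter (U i)"
        have \<delta>: "0 \<le> \<delta>" "\<delta> \<le> 1" using U(1)[rule_format, of i] by (simp_all add: \<delta>_def diameter_ge_0)
        have "U i \<subseteq> cball a \<delta>"
          using diameter_bounded_bound[OF U(1)[rule_format, THEN conjunct1] a(1)] by (simp add: \<delta>_def subset_eq)
        moreover have "emeasure \<nu> (cball a \<delta>) \<le> ennreal C * diam_powr (U i) s"
        proof -
          have "ennreal (\<delta> powr \<tau>) \<le> diam_powr (U i) s"
          proof (cases "s = 0")
            case True
            have "\<delta> powr \<tau> \<le> 1" using \<delta> \<tau> by (intro powr_le1) auto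
            then show ?thesis using True a by (auto simp: diam_powr_def)
          next
            case False
            have "\<delta> powr \<tau> \<le> \<delta> powr s" using \<delta> st by (cases "\<delta> = 0") (auto intro: powr_mono')
            then show ?thesis using False a by (auto simp: diam_powr_def \<delta>_def intro: ennreal_leI)
          qed
          then have "ennreal C * ennreal (\<delta> powr \<tau>) \<le> ennreal C * diam_powr (U i) s"
            by (intro mult_left_mono) auto
          then show ?thesis using growth[OF a(2) \<delta>] C by (simp add: ennreal_mult)
        qed
        ultimately have "cball a \<delta> \<in> sets \<nu> \<and> U i \<inter> N \<subseteq> cball a \<delta> \<and> emeasure \<nu> (cball a \<delta>) \<le> ennreal C * diam_powr (U i) s"
          using \<nu> by (simp add: le_infI1)
        then show ?thesis by (rule exI)
      qed
      then have "\<forall>i. \<exists>B. B \<in> sets \<nu> \<and> U i \<inter> N \<subseteq> B \<and> emeasure \<nu> B \<le> ennreal C * diam_powr (U i) s"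
        by (rule allI)
      from choice[OF this] obtain B where "\<forall>i. B i \<in> sets \<nu> \<and> U i \<inter> N \<subseteq> B i \<and>
        emeasure \<nu> (B i) \<le> ennreal C * diam_powr (U i) s" ..
      then have B: "\<And>i. B i \<in> sets \<nu>" "\<And>i. U i \<inter> N \<subseteq> B i"
        "\<And>i. emeasure \<nu> (B i) \<le> ennreal C * diam_powr (U i) s" by simp_all
      have "N \<subseteq> (\<Union>i. B i)"
      proof
        fix a assume a: "a \<in> N"
        then obtain i where "a \<in> U i" using U(2) N(3) by blast
        then have "a \<in> B i" using B(2)[of i] a by blast
        then show "a \<in> (\<Union>i. B i)" by blast
      qed
      then have "emeasure \<nu> N \<le> emeasure \<nu> (\<Union>i. B i)" using B(1) by (intro emeasure_mono) auto
      also have "\<dots> \<le> (\<Sum>i. emeasure \<nu> (B i))" using B(1) by (intro emeasure_subadditive_countably) auto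
      also have "\<dots> \<le> (\<Sum>i. ennreal C * diam_powr (U i) s)" by (intro suminf_le B(3)) auto
      finally show ?thesis by simp
    qed
    have "hausdorff_content s 1 E \<le> hausdorff_measure s E"
      unfolding hausdorff_measure_def by (rule SUP_upper) simp
    then have "hausdorff_content s 1 E = 0" using s by simp
    \<comment> \<open>\<open>C + 1\<close> rather than \<open>C\<close>, so that the divisor is positive.\<close>
    moreover define \<epsilon> where "\<epsilon> = emeasure \<nu> N / ennreal (C + 1)"
    have "\<epsilon> > 0" using N(2) C unfolding \<epsilon>_def by (simp add: ennreal_zero_less_divide)
    ultimately have "hausdorff_content s 1 E < \<epsilon>" by simp
    then obtain U :: "nat \<Rightarrow> 'a set" where U: "\<forall>i. bounded (U i) \<and> diameter (U i) \<le> 1" "E \<subseteq> (\<Union>i. U i)"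
      "(\<Sum>i. diam_powr (U i) s) < \<epsilon>"
      unfolding hausdorff_content_def INF_less_iff by (elim bexE CollectE conjE)
    note U = U bound[OF U(1,2)]
    have "emeasure \<nu> N \<le> ennreal (C + 1) * (\<Sum>i. diam_powr (U i) s)"
      using C by (intro order_trans[OF U(4)] mult_right_mono ennreal_leI) auto
    also have "\<dots> < ennreal (C + 1) * \<epsilon>"
      using U(3) C by (intro ennreal_mult_strict_left_mono) (auto simp del: ennreal_plus)
    also have "\<dots> = emeasure \<nu> N"
      unfolding \<epsilon>_def ennreal_times_divide using C
      by (subst mult.commute, intro mult_divide_eq_ennreal) auto
    finally show False by simp
  qed
qed

text \<open>
  The assumption is a dyadic form of finite \<open>\<tau>\<close>-energy. The potential \<open>\<Phi>\<close> is then finite almost everywhere, hence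
  bounded on a set of positive mass, and there balls have mass at most a constant times \<open>\<delta> powr \<tau>\<close>.
\<close>
lemma hausdorff_dim_ge_if_dyadic_energy:
  fixes E :: "'a::{metric_space, second_countable_topology} set"
  assumes \<nu>: "prob_space \<nu>" "sets \<nu> = sets borel"
    and E: "E \<in> sets borel" "AE a in \<nu>. a \<in> E" and \<tau>: "\<tau> > 0"
    and energy: "(\<Sum>k. ennreal ((2 ^ k) powr \<tau>) * (\<integral>\<^sup>+ a. emeasure \<nu> (cball a (1 / 2 ^ k)) \<partial>\<nu>)) < \<top>"
  shows "ennreal \<tau> \<le> hausdorff_dim E"
proof -
  interpret prob_space \<nu> by (rule \<nu>(1))
  note [measurable_cong] = \<nu>(2)
  have [measurable]: "(\<lambda>a. emeasure \<nu> (cball a r)) \<in> borel_measurable \<nu>" for r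
  proof -
    have "emeasure \<nu> (cball a r) = (\<integral>\<^sup>+ b. indicator {b. dist a b \<le> r} b \<partial>\<nu>)" for a
      by (subst nn_integral_indicator) (auto simp: \<nu>(2) cball_def)
    moreover have "(\<lambda>a. \<integral>\<^sup>+ b. indicator {b. dist a b \<le> r} b \<partial>\<nu>) \<in> borel_measurable \<nu>"
      unfolding indicator_def by measurable
    ultimately show ?thesis by (simp only:)
  qed
  define \<Phi> where "\<Phi> a = (\<Sum>k. ennreal ((2 ^ k) powr \<tau>) * emeasure \<nu> (cball a (1 / 2 ^ k)))" for a
  have [measurable]: "\<Phi> \<in> borel_measurable \<nu>" unfolding \<Phi>_def[abs_def] by measurable
  have "(\<integral>\<^sup>+ a. \<Phi> a \<partial>\<nu>) < \<top>"
    unfolding \<Phi>_def using energy by (subst nn_integral_suminf) (simp_all add: nn_integral_cmult)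
  then have "AE a in \<nu>. \<Phi> a \<noteq> \<infinity>" by (intro nn_integral_noteq_infinite) auto
  then have ae: "AE a in \<nu>. \<Phi> a \<noteq> \<infinity> \<and> a \<in> E" using E(2) by eventually_elim auto
  define S where "S n = {a\<in>space \<nu>. \<Phi> a \<le> of_nat n \<and> a \<in> E}" for n :: nat
  have [measurable]: "E \<in> sets \<nu>" using E \<nu> by simp
  have S[measurable]: "S n \<in> sets \<nu>" for n unfolding S_def by measurable
  have "\<exists>n. emeasure \<nu> (S n) > 0"
  proof (rule ccontr)
    assume "\<not> ?thesis"
    then have "S n \<in> null_sets \<nu>" for n using S by (auto simp: null_sets_def)
    then have "AE a in \<nu>. \<forall>n. a \<notin> S n" by (subst AE_all_countable) (auto intro: AE_not_in)
    with ae have "AE a in \<nu>. False"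
    proof eventually_elim
      case (elim a)
      then have "\<Phi> a < \<top>" by (simp add: less_top)
      then obtain n :: nat where "\<Phi> a \<le> of_nat n"
        using ennreal_Ex_less_of_nat[of "\<Phi> a"] less_imp_le by blast
      moreover have "a \<in> space \<nu>" using sets_eq_imp_space_eq[OF \<nu>(2)] by simp
      ultimately have "a \<in> S n" using elim unfolding S_def by simp
      then show False using elim by simp
    qed
    then show False by (simp)
  qed
  then obtain n where n: "emeasure \<nu> (S n) > 0" by auto
  have dy: "emeasure \<nu> (cball a (1 / 2 ^ k)) \<le> ennreal (real n * (2 ^ k) powr (- \<tau>))" if "a \<in> S n" for a k
  proof -
    have "(\<Sum>k\<in>{k}. ennreal ((2 ^ k) powr \<tau>) * emeasure \<nu> (cball a (1 / 2 ^ k))) \<le> \<Phi> a"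
      unfolding \<Phi>_def by (rule sum_le_suminf) auto
    also have "\<dots> \<le> of_nat n" using that by (simp add: S_def)
    finally have "ennreal ((2 ^ k) powr (- \<tau>)) * (ennreal ((2 ^ k) powr \<tau>) * emeasure \<nu> (cball a (1 / 2 ^ k))) \<le> ennreal ((2 ^ k) powr (- \<tau>)) * of_nat n"
      by (intro mult_left_mono) auto
    moreover have "ennreal ((2 ^ k) powr (- \<tau>)) * ennreal ((2 ^ k) powr \<tau>) = 1"
      by (subst ennreal_mult[symmetric]) (auto simp flip: powr_add)
    ultimately have "emeasure \<nu> (cball a (1 / 2 ^ k)) \<le> ennreal ((2 ^ k) powr (- \<tau>)) * of_nat n"
      by (simp add: mult.assoc[symmetric])
    also have "\<dots> = ennreal (real n * (2 ^ k) powr (- \<tau>))"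
      by (subst mult.commute) (simp add: ennreal_mult ennreal_of_nat_eq_real_of_nat)
    finally show ?thesis .
  qed
  show ?thesis
  proof (rule hausdorff_dim_ge_if_ball_growth[OF \<nu>(2) \<tau> S n, where C = "real n * 2 powr \<tau>"])
    show "S n \<subseteq> E" by (auto simp: S_def)
    show "0 \<le> real n * 2 powr \<tau>" by simp
    fix a and \<delta> :: real assume a: "a \<in> S n" and \<delta>: "0 \<le> \<delta>" "\<delta> \<le> 1"
    show "emeasure \<nu> (cball a \<delta>) \<le> ennreal (real n * 2 powr \<tau> * \<delta> powr \<tau>)"
    \<comment> \<open>A covering set may be a single point, so radius \<open>0\<close> has to be treated: there are no atoms on \<open>S n\<close>.\<close>
    proof (cases "\<delta> = 0")
      case True
      have "emeasure \<nu> (cball a 0) \<le> 0"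
      proof (rule tendsto_lowerbound)
        have "((\<lambda>k. real n * (2 powr (- \<tau>)) ^ k) \<longlongrightarrow> real n * 0) sequentially"
          using \<tau> by (intro tendsto_mult tendsto_const LIMSEQ_realpow_zero) (auto simp: powr_less_one)
        then show "((\<lambda>k. ennreal (real n * (2 powr (- \<tau>)) ^ k)) \<longlongrightarrow> 0) sequentially"
          using tendsto_ennrealI by fastforce
        show "eventually (\<lambda>k. emeasure \<nu> (cball a 0) \<le> ennreal (real n * (2 powr (- \<tau>)) ^ k)) sequentially"
        proof (intro always_eventually allI)
          fix k
          have "(2 ^ k) powr (- \<tau>) = (2 powr (- \<tau>)) ^ k"
            by (simp add: powr_powr powr_realpow[symmetric] mult.commute)
          moreover have "emeasure \<nu> (cball a 0) \<le> emeasure \<nu> (cball a (1 / 2 ^ k))"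
            by (intro emeasure_mono) (auto simp: \<nu>(2))
          ultimately show "emeasure \<nu> (cball a 0) \<le> ennreal (real n * (2 powr (- \<tau>)) ^ k)"
            using dy[OF a, of k] by simp
        qed
      qed simp
      then show ?thesis using True by simp
    next
      case False
      then have d0: "\<delta> > 0" using \<delta> by simp
      obtain m :: nat where "(1 / 2) ^ m < \<delta>" using real_arch_pow_inv[of \<delta> "1/2"] d0 by auto
      then have ex: "\<exists>m::nat. (1 / 2) ^ m < \<delta>" by blast
      define m where "m = (LEAST m::nat. (1 / 2) ^ m < \<delta>)"
      have m: "(1 / 2) ^ m < \<delta>" unfolding m_def by (rule LeastI_ex[OF ex])
      then obtain k where k: "m = Suc k" using \<delta> by (cases m) auto
      have "\<not> (1 / 2) ^ k < \<delta>" using not_less_Least[of k "\<lambda>m. (1 / 2) ^ m < \<delta>"] k m_def by auto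
      then have k1: "\<delta> \<le> 1 / 2 ^ k" by (simp add: power_one_over)
      have k2: "1 / 2 ^ k \<le> 2 * \<delta>" using m k by (simp add: power_one_over)
      have "emeasure \<nu> (cball a \<delta>) \<le> emeasure \<nu> (cball a (1 / 2 ^ k))"
        using k1 by (intro emeasure_mono) (auto simp: \<nu>(2))
      also have "\<dots> \<le> ennreal (real n * (2 ^ k) powr (- \<tau>))" by (rule dy[OF a])
      also have "\<dots> \<le> ennreal (real n * 2 powr \<tau> * \<delta> powr \<tau>)"
      proof (rule ennreal_leI)
        have "(2 ^ k) powr (- \<tau>) = (1 / 2 ^ k) powr \<tau>"
          by (simp add: powr_minus powr_divide divide_simps)
        also have "\<dots> \<le> (2 * \<delta>) powr \<tau>" using k2 \<tau> by (intro powr_mono2) auto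
        also have "\<dots> = 2 powr \<tau> * \<delta> powr \<tau>" using d0 by (simp add: powr_mult)
        finally show "real n * (2 ^ k) powr (- \<tau>) \<le> real n * 2 powr \<tau> * \<delta> powr \<tau>"
          by (simp add: mult.assoc mult_left_mono)
      qed
      finally show ?thesis .
    qed
  qed
qed

text \<open>
  The complement of the support is a union of null sets taken from a countable basis.
\<close>
lemma AE_in_measure_support:
  fixes \<mu> :: "'a::second_countable_topology measure"
  assumes \<mu>: "sets \<mu> = sets borel"
  shows "AE x in \<mu>. x \<in> measure_support \<mu>"
proof -
  obtain B :: "'a set set" where B: "countable B" "topological_basis B"
    using ex_countable_basis by blast
  have op: "U \<in> sets \<mu>" if "open U" for U using that \<mu> by simp
  have "(\<Union>U\<in>{U\<in>B. emeasure \<mu> U = 0}. U) \<in> null_sets \<mu>"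
    using B topological_basis_open[OF B(2)] op
    by (intro null_sets_UN') (auto intro: countable_subset null_setsI)
  moreover have "{x\<in>space \<mu>. x \<notin> measure_support \<mu>} \<subseteq> (\<Union>U\<in>{U\<in>B. emeasure \<mu> U = 0}. U)"
  proof
    fix x assume "x \<in> {x\<in>space \<mu>. x \<notin> measure_support \<mu>}"
    then obtain U where U: "open U" "x \<in> U" "emeasure \<mu> U = 0"
      by (auto simp: measure_support_def)
    then obtain V where V: "V \<in> B" "x \<in> V" "V \<subseteq> U"
      using topological_basisE[OF B(2)] by metis
    have "emeasure \<mu> V \<le> emeasure \<mu> U" using V U(1) op by (intro emeasure_mono) auto
    then show "x \<in> (\<Union>U\<in>{U\<in>B. emeasure \<mu> U = 0}. U)" using U V by auto
  qed
  ultimately show ?thesis by (rule AE_I')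
qed

section \<open>The Fourier transform averaged over chords\<close>

locale bounded_prob = prob_space \<mu> for \<mu> :: "(real ^ 'n) measure" +
  fixes R :: real
  assumes sets_mu: "sets \<mu> = sets borel"
    and R_nonneg: "R \<ge> 0"
    and norm_le_R: "AE x in \<mu>. norm x \<le> R"
begin

lemmas [measurable_cong] = sets_mu

abbreviation abs_ft :: "real ^ 'n \<Rightarrow> real" where
  "abs_ft z \<equiv> cmod (fourier_transform \<mu> z)"

text \<open>
  The Fourier transform of \<open>\<mu>\<close> weighted by a Gaussian. The sign in the exponent is opposite to that of
  \<^const>\<open>fourier_transform\<close>, which does not affect the modulus.
\<close>
definition windowed_ft :: "real ^ 'n \<Rightarrow> complex" where
  "windowed_ft z = (\<integral>x. exp (- pi * (norm x)\<^sup>2) *\<^sub>R cis (2 * pi * (z \<bullet> x)) \<partial>\<mu>)"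

text \<open>
  The modulus of the windowed transform averaged over the vectors \<open>2t (y' - y)\<close>, for independent \<open>y\<close> and \<open>y'\<close>
  with law \<open>\<mu>\<close>.
\<close>
definition chord_average :: "real \<Rightarrow> ennreal" where
  "chord_average t = (\<integral>\<^sup>+ p. ennreal (cmod (windowed_ft ((2 * t) *\<^sub>R (snd p - fst p)))) \<partial>(\<mu> \<Otimes>\<^sub>M \<mu>))"

lemma cmod_integral_cis: "cmod (\<integral>x. cis (2 * pi * (z \<bullet> x)) \<partial>\<mu>) = abs_ft z"
proof -
  have "fourier_transform \<mu> z = (\<integral>x. cnj (cis (2 * pi * (z \<bullet> x))) \<partial>\<mu>)"
    unfolding fourier_transform_def cis_cnj
    by (intro Bochner_Integration.integral_cong refl) (simp add: cis_conv_exp mult_ac)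
  also have "\<dots> = cnj (\<integral>x. cis (2 * pi * (z \<bullet> x)) \<partial>\<mu>)" by (rule Bochner_Integration.integral_cnj)
  finally show ?thesis by simp
qed

lemma abs_ft_le_1: "abs_ft z \<le> 1"
proof -
  have "norm (\<integral>x. cis (2 * pi * (z \<bullet> x)) \<partial>\<mu>) \<le> (\<integral>x. norm (cis (2 * pi * (z \<bullet> x))) \<partial>\<mu>)"
    by (rule integral_norm_bound)
  then show ?thesis by (simp add: cmod_integral_cis prob_space)
qed

lemma abs_ft_measurable [measurable]: "abs_ft \<in> borel_measurable borel"
  unfolding cmod_integral_cis[symmetric] by measurable

lemma windowed_ft_measurable [measurable]: "windowed_ft \<in> borel_measurable borel"
  unfolding windowed_ft_def[abs_def] by measurable

lemma windowed_ft_le_1: "cmod (windowed_ft z) \<le> 1"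
proof -
  have "norm (windowed_ft z) \<le> (\<integral>x. norm (exp (- pi * (norm x)\<^sup>2) *\<^sub>R cis (2 * pi * (z \<bullet> x))) \<partial>\<mu>)"
    unfolding windowed_ft_def by (rule integral_norm_bound)
  also have "\<dots> \<le> (\<integral>x. 1 \<partial>\<mu>)"
    by (intro integral_mono integrable_const_bound[where B = 1]) auto
  finally show ?thesis by (simp add: prob_space)
qed

text \<open>
  The Fourier transform of \<open>\<mu>\<close> times a Gaussian is the convolution of the transform of \<open>\<mu>\<close> with a Gaussian.
\<close>
lemma windowed_ft_le_gaussian_average:
  "ennreal (cmod (windowed_ft z)) \<le> (\<integral>\<^sup>+ w. ennreal (exp (- pi * (norm w)\<^sup>2) * abs_ft (w + z)) \<partial>lborel)"
proof -
  have e: "cmod (\<integral>x. cis (2 * pi * (w \<bullet> x)) * cis (2 * pi * (z \<bullet> x)) \<partial>\<mu>) = abs_ft (w + z)" for w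
    unfolding cmod_integral_cis[symmetric] by (simp add: cis_mult inner_add_left distrib_left)
  have "ennreal (cmod (\<integral>x. exp (- pi * 1\<^sup>2 * (norm x)\<^sup>2) *\<^sub>R cis (2 * pi * (z \<bullet> x)) \<partial>\<mu>))
    \<le> ennreal (1 / 1 ^ DIM(real ^ 'n)) * (\<integral>\<^sup>+ w. ennreal (exp (- pi * (norm w)\<^sup>2 / 1\<^sup>2) * cmod (\<integral>x. cis (2 * pi * (w \<bullet> x)) * cis (2 * pi * (z \<bullet> x)) \<partial>\<mu>)) \<partial>lborel)"
    by (rule gaussian_weighted_integral_le[where B = 1]) (auto intro: finite_measure_axioms)
  then show ?thesis unfolding e windowed_ft_def by simp
qed

lemma chord_average_le_1: "chord_average t \<le> 1"
proof -
  interpret pair_prob_space \<mu> \<mu> ..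
  have "chord_average t \<le> (\<integral>\<^sup>+ p. 1 \<partial>(\<mu> \<Otimes>\<^sub>M \<mu>))"
    unfolding chord_average_def using windowed_ft_le_1 by (intro nn_integral_mono) simp
  then show ?thesis using P.emeasure_space_1 by simp
qed

text \<open>
  The difference of squared distances from the pin. Squares are used because this difference, unlike that of
  the distances themselves, is affine in \<open>x\<close>.
\<close>
definition sq_dist_gap :: "real ^ 'n \<Rightarrow> (real ^ 'n) \<times> (real ^ 'n) \<Rightarrow> real" where
  "sq_dist_gap x p = (norm (x - fst p))\<^sup>2 - (norm (x - snd p))\<^sup>2"

text \<open>
  As the gap is affine in \<open>x\<close>, integrating over \<open>x\<close> first produces the windowed transform at \<open>2t (y' - y)\<close> times a
  phase that depends on \<open>y\<close> and \<open>y'\<close> only.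
\<close>
lemma sq_dist_gap_phase_le:
  "ennreal (cmod (\<integral>q. cis (2 * pi * (t * sq_dist_gap (fst q) (snd q))) * complex_of_real (exp (- pi * (norm (fst q))\<^sup>2))
      \<partial>(\<mu> \<Otimes>\<^sub>M (\<mu> \<Otimes>\<^sub>M \<mu>)))) \<le> chord_average t"
proof -
  interpret PP: pair_prob_space \<mu> \<mu> ..
  interpret Q: pair_prob_space \<mu> "\<mu> \<Otimes>\<^sub>M \<mu>" ..
  define h where "h x p = cis (2 * pi * (t * sq_dist_gap x p)) * complex_of_real (exp (- pi * (norm x)\<^sup>2))" for x p
  have hm: "case_prod h \<in> borel_measurable (\<mu> \<Otimes>\<^sub>M (\<mu> \<Otimes>\<^sub>M \<mu>))"
    unfolding h_def[abs_def] sq_dist_gap_def by measurable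
  have hi: "integrable (\<mu> \<Otimes>\<^sub>M (\<mu> \<Otimes>\<^sub>M \<mu>)) (case_prod h)"
    by (rule Q.P.integrable_const_bound[where B = 1]) (auto simp: hm h_def norm_mult)
  have hx: "h x p = cis (2 * pi * (t * ((norm (fst p))\<^sup>2 - (norm (snd p))\<^sup>2))) *
     (exp (- pi * (norm x)\<^sup>2) *\<^sub>R cis (2 * pi * (((2 * t) *\<^sub>R (snd p - fst p)) \<bullet> x)))" for x p
  proof -
    have sx: "sq_dist_gap x p = ((norm (fst p))\<^sup>2 - (norm (snd p))\<^sup>2) + 2 * ((snd p - fst p) \<bullet> x)"
      by (simp add: sq_dist_gap_def power2_norm_eq_inner inner_diff_left inner_diff_right inner_commute algebra_simps)
    have "2 * pi * (t * sq_dist_gap x p) = 2 * pi * (t * ((norm (fst p))\<^sup>2 - (norm (snd p))\<^sup>2)) +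
         2 * pi * (((2 * t) *\<^sub>R (snd p - fst p)) \<bullet> x)"
      unfolding sx by (simp add: algebra_simps)
    then show ?thesis
      unfolding h_def by (simp add: cis_mult[symmetric] scaleR_conv_of_real mult_ac)
  qed
  have inner: "(\<integral>x. h x p \<partial>\<mu>) = cis (2 * pi * (t * ((norm (fst p))\<^sup>2 - (norm (snd p))\<^sup>2))) * windowed_ft ((2 * t) *\<^sub>R (snd p - fst p))" for p
    unfolding hx windowed_ft_def by (rule integral_mult_right_zero)
  have "(\<integral>q. h (fst q) (snd q) \<partial>(\<mu> \<Otimes>\<^sub>M (\<mu> \<Otimes>\<^sub>M \<mu>))) = (\<integral>p. (\<integral>x. h x p \<partial>\<mu>) \<partial>(\<mu> \<Otimes>\<^sub>M \<mu>))"
    using Q.integral_snd[OF hi] by (simp add: case_prod_beta')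
  moreover have "ennreal (cmod (\<integral>p. (\<integral>x. h x p \<partial>\<mu>) \<partial>(\<mu> \<Otimes>\<^sub>M \<mu>))) \<le> (\<integral>\<^sup>+ p. ennreal (cmod (\<integral>x. h x p \<partial>\<mu>)) \<partial>(\<mu> \<Otimes>\<^sub>M \<mu>))"
    by (intro integral_norm_bound_ennreal Q.integrable_snd[OF hi])
  ultimately show ?thesis
    unfolding chord_average_def inner by (simp add: h_def norm_mult)
qed

text \<open>
  The proportion of pairs whose squared distances from the pin differ by at most about \<open>1 / \<tau>\<close>, averaged over the
  pin, is controlled by the chord average over frequencies up to about \<open>\<tau>\<close>.
\<close>
lemma sq_dist_gap_concentration:
  assumes \<tau>: "\<tau> > 0"
  shows "(\<integral>\<^sup>+ x. ennreal (exp (- pi * (norm x)\<^sup>2)) * (\<integral>\<^sup>+ p. ennreal (exp (- pi * \<tau>\<^sup>2 * (sq_dist_gap x p)\<^sup>2)) \<partial>(\<mu> \<Otimes>\<^sub>M \<mu>)) \<partial>\<mu>)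
    \<le> ennreal (1 / \<tau>) * (\<integral>\<^sup>+ t. ennreal (exp (- pi * t\<^sup>2 / \<tau>\<^sup>2)) * chord_average t \<partial>lborel)"
proof -
  interpret PP: pair_prob_space \<mu> \<mu> ..
  interpret Q: pair_prob_space \<mu> "\<mu> \<Otimes>\<^sub>M \<mu>" ..
  let ?M = "\<mu> \<Otimes>\<^sub>M (\<mu> \<Otimes>\<^sub>M \<mu>)"
  define u where "u q = sq_dist_gap (fst q) (snd q)" for q
  define f where "f q = exp (- pi * (norm (fst q))\<^sup>2)" for q :: "(real ^ 'n) \<times> (real ^ 'n) \<times> (real ^ 'n)"
  have um[measurable]: "u \<in> borel_measurable ?M" unfolding u_def[abs_def] sq_dist_gap_def by measurable
  have fm[measurable]: "f \<in> borel_measurable ?M" unfolding f_def[abs_def] by measurable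
  have f01: "0 \<le> f q" "f q \<le> 1" for q by (auto simp: f_def)
  have "(\<integral>\<^sup>+ q. ennreal (exp (- pi * \<tau>\<^sup>2 * (norm (u q))\<^sup>2) * f q) \<partial>?M) = (\<integral>\<^sup>+ x. \<integral>\<^sup>+ p. ennreal (f (x, p) * exp (- pi * \<tau>\<^sup>2 * (u (x, p))\<^sup>2)) \<partial>(\<mu> \<Otimes>\<^sub>M \<mu>) \<partial>\<mu>)"
    by (subst PP.nn_integral_fst[symmetric]) (auto simp: mult.commute)
  also have "\<dots> = (\<integral>\<^sup>+ x. ennreal (exp (- pi * (norm x)\<^sup>2)) * (\<integral>\<^sup>+ p. ennreal (exp (- pi * \<tau>\<^sup>2 * (sq_dist_gap x p)\<^sup>2)) \<partial>(\<mu> \<Otimes>\<^sub>M \<mu>)) \<partial>\<mu>)"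
  proof (rule nn_integral_cong)
    fix x :: "real ^ 'n"
    have [measurable]: "sq_dist_gap x \<in> borel_measurable (\<mu> \<Otimes>\<^sub>M \<mu>)" unfolding sq_dist_gap_def[abs_def] by measurable
    show "(\<integral>\<^sup>+ p. ennreal (f (x, p) * exp (- pi * \<tau>\<^sup>2 * (u (x, p))\<^sup>2)) \<partial>(\<mu> \<Otimes>\<^sub>M \<mu>))
      = ennreal (exp (- pi * (norm x)\<^sup>2)) * (\<integral>\<^sup>+ p. ennreal (exp (- pi * \<tau>\<^sup>2 * (sq_dist_gap x p)\<^sup>2)) \<partial>(\<mu> \<Otimes>\<^sub>M \<mu>))"
      by (subst nn_integral_cmult[symmetric]) (auto simp: f_def u_def ennreal_mult)
  qed
  finally have eq: "(\<integral>\<^sup>+ q. ennreal (exp (- pi * \<tau>\<^sup>2 * (norm (u q))\<^sup>2) * f q) \<partial>?M)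
    = (\<integral>\<^sup>+ x. ennreal (exp (- pi * (norm x)\<^sup>2)) * (\<integral>\<^sup>+ p. ennreal (exp (- pi * \<tau>\<^sup>2 * (sq_dist_gap x p)\<^sup>2)) \<partial>(\<mu> \<Otimes>\<^sub>M \<mu>)) \<partial>\<mu>)" .
  have "(\<integral>\<^sup>+ q. ennreal (exp (- pi * \<tau>\<^sup>2 * (norm (u q))\<^sup>2) * f q) \<partial>?M)
    \<le> ennreal (1 / \<tau> ^ DIM(real)) * (\<integral>\<^sup>+ t. ennreal (exp (- pi * (norm t)\<^sup>2 / \<tau>\<^sup>2) * cmod (\<integral>q. cis (2 * pi * (t \<bullet> u q)) * complex_of_real (f q) \<partial>?M)) \<partial>lborel)"
    by (rule nn_integral_gaussian_weighted_le) (use \<tau> f01 Q.P.finite_measure_axioms in auto)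
  also have "\<dots> \<le> ennreal (1 / \<tau>) * (\<integral>\<^sup>+ t. ennreal (exp (- pi * t\<^sup>2 / \<tau>\<^sup>2)) * chord_average t \<partial>lborel)"
    using sq_dist_gap_phase_le
    by (auto simp: ennreal_mult u_def f_def intro!: mult_left_mono nn_integral_mono)
  finally show ?thesis unfolding eq .
qed

section \<open>Pinned distance sets under decay of the chord average\<close>

text \<open>
  Since \<open>|x| \<le> R\<close> almost everywhere, the Gaussian weight in \<open>x\<close> can be removed at the cost of the factor \<open>E\<close>.
\<close>
lemma sq_dist_gap_small_average:
  assumes b: "0 < b'" "b' < b" "b' \<le> 1" and C: "C \<ge> 0"
    and decay: "\<And>t. chord_average t \<le> ennreal (C * (1 + \<bar>t\<bar>) powr (- b))"
  shows "\<exists>C'\<ge>0. \<forall>\<tau>>0. (\<integral>\<^sup>+ x. \<integral>\<^sup>+ p. ennreal (exp (- pi * \<tau>\<^sup>2 * (sq_dist_gap x p)\<^sup>2)) \<partial>(\<mu> \<Otimes>\<^sub>M \<mu>) \<partial>\<mu>)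
     \<le> ennreal (C' * \<tau> powr (- b'))"
proof -
  obtain K where K: "K \<ge> 0" "\<And>\<tau>. \<tau> > 0 \<Longrightarrow> (\<integral>\<^sup>+ t. ennreal (exp (- pi * (norm (t::real))\<^sup>2 / \<tau>\<^sup>2) * (1 + norm t) powr (- b)) \<partial>lborel)
     \<le> ennreal (K * \<tau> powr (1 - b'))"
    using nn_integral_gaussian_powr_le[where 'a=real, of b' b] b by auto
  define E where "E = exp (pi * R\<^sup>2)"
  have "(\<integral>\<^sup>+ x. \<integral>\<^sup>+ p. ennreal (exp (- pi * \<tau>\<^sup>2 * (sq_dist_gap x p)\<^sup>2)) \<partial>(\<mu> \<Otimes>\<^sub>M \<mu>) \<partial>\<mu>)
     \<le> ennreal ((E * C * K) * \<tau> powr (- b'))" if \<tau>: "\<tau> > 0" for \<tau>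
  proof -
    let ?I = "\<lambda>x. \<integral>\<^sup>+ p. ennreal (exp (- pi * \<tau>\<^sup>2 * (sq_dist_gap x p)\<^sup>2)) \<partial>(\<mu> \<Otimes>\<^sub>M \<mu>)"
    have [measurable]: "?I \<in> borel_measurable \<mu>"
    proof -
      interpret PP: pair_prob_space \<mu> \<mu> ..
      show ?thesis unfolding sq_dist_gap_def by measurable
    qed
    have "(\<integral>\<^sup>+ x. ?I x \<partial>\<mu>) \<le> (\<integral>\<^sup>+ x. ennreal E * (ennreal (exp (- pi * (norm x)\<^sup>2)) * ?I x) \<partial>\<mu>)"
    proof (rule nn_integral_mono_AE)
      show "AE x in \<mu>. ?I x \<le> ennreal E * (ennreal (exp (- pi * (norm x)\<^sup>2)) * ?I x)"
        using norm_le_R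
      proof eventually_elim
        case (elim x)
        have "(norm x)\<^sup>2 \<le> R\<^sup>2" using elim by (intro power_mono) auto
        then have "1 \<le> E * exp (- pi * (norm x)\<^sup>2)" by (simp add: E_def exp_add[symmetric])
        then have "1 \<le> ennreal E * ennreal (exp (- pi * (norm x)\<^sup>2))"
          by (simp add: E_def ennreal_mult[symmetric])
        then have "1 * ?I x \<le> (ennreal E * ennreal (exp (- pi * (norm x)\<^sup>2))) * ?I x"
          by (rule mult_right_mono) simp
        then show ?case by (simp add: mult.assoc)
      qed
    qed
    also have "\<dots> = ennreal E * (\<integral>\<^sup>+ x. ennreal (exp (- pi * (norm x)\<^sup>2)) * ?I x \<partial>\<mu>)"
      by (rule nn_integral_cmult) measurable
    also have "\<dots> \<le> ennreal E * (ennreal (1 / \<tau>) * (\<integral>\<^sup>+ t. ennreal (exp (- pi * t\<^sup>2 / \<tau>\<^sup>2)) * chord_average t \<partial>lborel))"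
      by (intro mult_left_mono sq_dist_gap_concentration \<tau>) simp
    also have "\<dots> \<le> ennreal E * (ennreal (1 / \<tau>) * (\<integral>\<^sup>+ t. ennreal C * ennreal (exp (- pi * (norm (t::real))\<^sup>2 / \<tau>\<^sup>2) * (1 + norm t) powr (- b)) \<partial>lborel))"
    proof (intro mult_left_mono nn_integral_mono)
      fix t :: real
      have "ennreal (exp (- pi * t\<^sup>2 / \<tau>\<^sup>2)) * chord_average t \<le> ennreal (exp (- pi * t\<^sup>2 / \<tau>\<^sup>2)) * ennreal (C * (1 + \<bar>t\<bar>) powr (- b))"
        by (intro mult_left_mono decay) simp
      also have "\<dots> = ennreal C * ennreal (exp (- pi * (norm t)\<^sup>2 / \<tau>\<^sup>2) * (1 + norm t) powr (- b))"
        using C by (simp add: ennreal_mult[symmetric] mult_ac)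
      finally show "ennreal (exp (- pi * t\<^sup>2 / \<tau>\<^sup>2)) * chord_average t \<le> ennreal C * ennreal (exp (- pi * (norm t)\<^sup>2 / \<tau>\<^sup>2) * (1 + norm t) powr (- b))" .
    qed auto
    also have "\<dots> = ennreal E * (ennreal (1 / \<tau>) * (ennreal C * (\<integral>\<^sup>+ t. ennreal (exp (- pi * (norm (t::real))\<^sup>2 / \<tau>\<^sup>2) * (1 + norm t) powr (- b)) \<partial>lborel)))"
      by (subst nn_integral_cmult) auto
    also have "\<dots> \<le> ennreal E * (ennreal (1 / \<tau>) * (ennreal C * ennreal (K * \<tau> powr (1 - b'))))"
      by (intro mult_left_mono K \<tau>) auto
    also have "\<dots> = ennreal ((E * C * K) * \<tau> powr (- b'))"
    proof -
      have "\<tau> powr (1 - b') = \<tau> * \<tau> powr (- b')" using \<tau> by (simp add: powr_diff powr_minus field_simps)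
      then show ?thesis using \<tau> C K(1) by (simp add: E_def ennreal_mult[symmetric] mult_ac)
    qed
    finally show ?thesis .
  qed
  moreover have "E * C * K \<ge> 0" using C K by (simp add: E_def)
  ultimately show ?thesis by blast
qed

text \<open>
  The intermediate exponent \<open>b'\<close> between \<open>\<beta>\<close> and \<open>b\<close> makes the sum over dyadic scales converge after integration
  over the pin, hence for almost every pin.
\<close>
lemma AE_dyadic_sq_dist_gap_finite:
  assumes b: "0 < \<beta>" "\<beta> < b" "b \<le> 1" and C: "C \<ge> 0"
    and decay: "\<And>t. chord_average t \<le> ennreal (C * (1 + \<bar>t\<bar>) powr (- b))"
  shows "AE x in \<mu>. (\<Sum>k. ennreal ((2 ^ k) powr \<beta>) * (\<integral>\<^sup>+ p. ennreal (exp (- pi * (2 ^ k)\<^sup>2 * (sq_dist_gap x p)\<^sup>2)) \<partial>(\<mu> \<Otimes>\<^sub>M \<mu>))) \<noteq> \<infinity>"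
proof -
  interpret PP: pair_prob_space \<mu> \<mu> ..
  define b' where "b' = (\<beta> + b) / 2"
  have b': "0 < b'" "b' < b" "b' \<le> 1" "\<beta> < b'" using b by (auto simp: b'_def)
  obtain C' where C': "C' \<ge> 0" "\<And>\<tau>. \<tau> > 0 \<Longrightarrow> (\<integral>\<^sup>+ x. \<integral>\<^sup>+ p. ennreal (exp (- pi * \<tau>\<^sup>2 * (sq_dist_gap x p)\<^sup>2)) \<partial>(\<mu> \<Otimes>\<^sub>M \<mu>) \<partial>\<mu>)
     \<le> ennreal (C' * \<tau> powr (- b'))"
    using sq_dist_gap_small_average[OF b'(1-3) C decay] by blast
  have meas: "(\<lambda>x. \<integral>\<^sup>+ p. ennreal (exp (- pi * c * (sq_dist_gap x p)\<^sup>2)) \<partial>(\<mu> \<Otimes>\<^sub>M \<mu>)) \<in> borel_measurable \<mu>" for c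
    unfolding sq_dist_gap_def by measurable
  have cm: "(\<lambda>x. c * J x) \<in> borel_measurable \<mu>" if "J \<in> borel_measurable \<mu>" for c :: ennreal and J
    using that by measurable
  have "(\<integral>\<^sup>+ x. (\<Sum>k. ennreal ((2 ^ k) powr \<beta>) * (\<integral>\<^sup>+ p. ennreal (exp (- pi * (2 ^ k)\<^sup>2 * (sq_dist_gap x p)\<^sup>2)) \<partial>(\<mu> \<Otimes>\<^sub>M \<mu>))) \<partial>\<mu>)
    = (\<Sum>k. ennreal ((2 ^ k) powr \<beta>) * (\<integral>\<^sup>+ x. \<integral>\<^sup>+ p. ennreal (exp (- pi * (2 ^ k)\<^sup>2 * (sq_dist_gap x p)\<^sup>2)) \<partial>(\<mu> \<Otimes>\<^sub>M \<mu>) \<partial>\<mu>))"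
  proof (subst nn_integral_suminf)
    have m: "(\<lambda>x. \<integral>\<^sup>+ p. ennreal (exp (- pi * (2 ^ k)\<^sup>2 * (sq_dist_gap x p)\<^sup>2)) \<partial>(\<mu> \<Otimes>\<^sub>M \<mu>)) \<in> borel_measurable \<mu>" for k :: nat
      by (rule meas)
    then show "(\<lambda>x. ennreal ((2 ^ k) powr \<beta>) * (\<integral>\<^sup>+ p. ennreal (exp (- pi * (2 ^ k)\<^sup>2 * (sq_dist_gap x p)\<^sup>2)) \<partial>(\<mu> \<Otimes>\<^sub>M \<mu>))) \<in> borel_measurable \<mu>" for k :: nat
      by (rule cm)
    show "(\<Sum>k. \<integral>\<^sup>+ x. ennreal ((2 ^ k) powr \<beta>) * (\<integral>\<^sup>+ p. ennreal (exp (- pi * (2 ^ k)\<^sup>2 * (sq_dist_gap x p)\<^sup>2)) \<partial>(\<mu> \<Otimes>\<^sub>M \<mu>)) \<partial>\<mu>)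
      = (\<Sum>k. ennreal ((2 ^ k) powr \<beta>) * (\<integral>\<^sup>+ x. \<integral>\<^sup>+ p. ennreal (exp (- pi * (2 ^ k)\<^sup>2 * (sq_dist_gap x p)\<^sup>2)) \<partial>(\<mu> \<Otimes>\<^sub>M \<mu>) \<partial>\<mu>))"
      by (intro suminf_cong nn_integral_cmult m)
  qed
  also have "\<dots> \<le> (\<Sum>k. ennreal C' * ennreal ((2 ^ k) powr (- (b' - \<beta>))))"
  proof (intro suminf_le)
    fix k :: nat
    have "ennreal ((2 ^ k) powr \<beta>) * (\<integral>\<^sup>+ x. \<integral>\<^sup>+ p. ennreal (exp (- pi * (2 ^ k)\<^sup>2 * (sq_dist_gap x p)\<^sup>2)) \<partial>(\<mu> \<Otimes>\<^sub>M \<mu>) \<partial>\<mu>)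
      \<le> ennreal ((2 ^ k) powr \<beta>) * ennreal (C' * (2 ^ k) powr (- b'))"
      by (intro mult_left_mono C') auto
    also have "\<dots> = ennreal C' * ennreal ((2 ^ k) powr (- (b' - \<beta>)))"
    proof -
      have "((2::real) ^ k) powr (- (b' - \<beta>)) = (2 ^ k) powr \<beta> * (2 ^ k) powr (- b')"
        by (simp add: powr_add[symmetric])
      then show ?thesis using C'(1) by (simp add: ennreal_mult[symmetric] mult_ac)
    qed
    finally show "ennreal ((2 ^ k) powr \<beta>) * (\<integral>\<^sup>+ x. \<integral>\<^sup>+ p. ennreal (exp (- pi * (2 ^ k)\<^sup>2 * (sq_dist_gap x p)\<^sup>2)) \<partial>(\<mu> \<Otimes>\<^sub>M \<mu>) \<partial>\<mu>)
      \<le> ennreal C' * ennreal ((2 ^ k) powr (- (b' - \<beta>)))" .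
  qed auto
  also have "\<dots> = ennreal C' * ennreal (1 / (1 - 2 powr (- (b' - \<beta>))))"
    using b' by (subst ennreal_suminf_cmult) (subst suminf_dyadic_powr, auto)
  also have "\<dots> < \<top>" by (simp add: ennreal_mult_less_top)
  finally show ?thesis
    by (intro nn_integral_noteq_infinite borel_measurable_suminf_order cm meas) simp
qed

text \<open>
  On a ball of radius \<open>R\<close> the squared distances differ by at most \<open>4 R\<close> times the difference of the distances. Hence
  pairs with \<open>|dist x y - dist x y'| \<le> 1 / 2 ^ k\<close> contribute at least \<open>1 / E0\<close> to the Gaussian integral at scale
  \<open>2 ^ k\<close>, and the dyadic energy of the image of \<open>\<mu>\<close> under \<open>dist x\<close> is finite.
\<close>
lemma hausdorff_dim_pinned_ge:
  assumes S: "compact S" "AE y in \<mu>. y \<in> S" and x: "norm x \<le> R" and \<beta>: "\<beta> > 0"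
    and fin: "(\<Sum>k. ennreal ((2 ^ k) powr \<beta>) * (\<integral>\<^sup>+ p. ennreal (exp (- pi * (2 ^ k)\<^sup>2 * (sq_dist_gap x p)\<^sup>2)) \<partial>(\<mu> \<Otimes>\<^sub>M \<mu>))) \<noteq> \<infinity>"
  shows "ennreal \<beta> \<le> hausdorff_dim (pinned_distance_set x S)"
proof -
  interpret PP: pair_prob_space \<mu> \<mu> ..
  define \<nu> where "\<nu> = distr \<mu> borel (dist x)"
  have dm[measurable]: "dist x \<in> \<mu> \<rightarrow>\<^sub>M borel" by measurable
  have E: "pinned_distance_set x S = dist x ` S" by (auto simp: pinned_distance_set_def)
  have Em: "dist x ` S \<in> sets borel"
    by (intro borel_compact compact_continuous_image S continuous_intros)
  define E0 where "E0 = exp (16 * pi * R\<^sup>2)"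
  have sm[measurable]: "sq_dist_gap x \<in> borel_measurable (\<mu> \<Otimes>\<^sub>M \<mu>)" unfolding sq_dist_gap_def[abs_def] by measurable
  have ball: "(\<integral>\<^sup>+ a. emeasure \<nu> (cball a (1 / 2 ^ k)) \<partial>\<nu>)
     \<le> ennreal E0 * (\<integral>\<^sup>+ p. ennreal (exp (- pi * (2 ^ k)\<^sup>2 * (sq_dist_gap x p)\<^sup>2)) \<partial>(\<mu> \<Otimes>\<^sub>M \<mu>))" for k :: nat
  proof -
    let ?g = "\<lambda>y y'. ennreal (exp (- pi * (2 ^ k)\<^sup>2 * (sq_dist_gap x (y, y'))\<^sup>2))"
    have meq: "emeasure \<nu> (cball a r) = (\<integral>\<^sup>+ y'. indicator {y'. dist a (dist x y') \<le> r} y' \<partial>\<mu>)" for a r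
      unfolding \<nu>_def by (subst emeasure_distr) (auto simp: sets_eq_imp_space_eq[OF sets_mu] intro!: arg_cong[where f="emeasure \<mu>"])
    have bm: "(\<lambda>a. emeasure \<nu> (cball a r)) \<in> borel_measurable borel" for r
      unfolding meq indicator_def by measurable
    have "(\<integral>\<^sup>+ a. emeasure \<nu> (cball a (1 / 2 ^ k)) \<partial>\<nu>) = (\<integral>\<^sup>+ y. emeasure \<nu> (cball (dist x y) (1 / 2 ^ k)) \<partial>\<mu>)"
      unfolding \<nu>_def by (rule nn_integral_distr[OF dm]) (simp add: bm[unfolded \<nu>_def])
    also have "\<dots> = (\<integral>\<^sup>+ y. \<integral>\<^sup>+ y'. indicator {y'. dist (dist x y) (dist x y') \<le> 1 / 2 ^ k} y' \<partial>\<mu> \<partial>\<mu>)"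
      unfolding meq ..
    also have "\<dots> \<le> (\<integral>\<^sup>+ y. \<integral>\<^sup>+ y'. ennreal E0 * ?g y y' \<partial>\<mu> \<partial>\<mu>)"
    proof (rule nn_integral_mono_AE)
      show "AE y in \<mu>. (\<integral>\<^sup>+ y'. indicator {y'. dist (dist x y) (dist x y') \<le> 1 / 2 ^ k} y' \<partial>\<mu>) \<le> (\<integral>\<^sup>+ y'. ennreal E0 * ?g y y' \<partial>\<mu>)"
        using norm_le_R
      proof eventually_elim
        case (elim y)
        note y = elim
        show ?case
        proof (rule nn_integral_mono_AE)
          show "AE y' in \<mu>. indicator {y'. dist (dist x y) (dist x y') \<le> 1 / 2 ^ k} y' \<le> ennreal E0 * ?g y y'"
            using norm_le_R
          proof eventually_elim
            case (elim y')
            show ?case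
            proof (cases "dist (dist x y) (dist x y') \<le> 1 / 2 ^ k")
              case True
              have "sq_dist_gap x (y, y') = (dist x y - dist x y') * (dist x y + dist x y')"
                by (simp add: sq_dist_gap_def dist_norm power2_eq_square algebra_simps)
              then have "\<bar>sq_dist_gap x (y, y')\<bar> = \<bar>dist x y - dist x y'\<bar> * (dist x y + dist x y')"
                by (simp add: abs_mult)
              also have "\<dots> \<le> (1 / 2 ^ k) * (4 * R)"
              proof (intro mult_mono)
                show "\<bar>dist x y - dist x y'\<bar> \<le> 1 / 2 ^ k" using True by (simp add: dist_real_def)
                have "dist x y \<le> norm x + norm y" "dist x y' \<le> norm x + norm y'"
                  by (simp_all add: dist_norm norm_triangle_ineq4)
                then show "dist x y + dist x y' \<le> 4 * R" using x y elim by linarith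
              qed auto
              finally have "\<bar>sq_dist_gap x (y, y')\<bar> \<le> 4 * R / 2 ^ k" by simp
              then have "2 ^ k * \<bar>sq_dist_gap x (y, y')\<bar> \<le> 4 * R" by (simp add: field_simps)
              then have "(2 ^ k * \<bar>sq_dist_gap x (y, y')\<bar>)\<^sup>2 \<le> (4 * R)\<^sup>2" by (intro power_mono) auto
              then have "pi * (2 ^ k)\<^sup>2 * (sq_dist_gap x (y, y'))\<^sup>2 \<le> 16 * pi * R\<^sup>2"
                by (simp add: power_mult_distrib mult.assoc)
              then have "1 \<le> E0 * exp (- pi * (2 ^ k)\<^sup>2 * (sq_dist_gap x (y, y'))\<^sup>2)"
                by (simp add: E0_def exp_add[symmetric])
              then show ?thesis using True by (simp add: indicator_def E0_def ennreal_mult[symmetric])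
            qed simp
          qed
        qed
      qed
    qed
    also have "\<dots> = (\<integral>\<^sup>+ p. ennreal E0 * ?g (fst p) (snd p) \<partial>(\<mu> \<Otimes>\<^sub>M \<mu>))"
      by (subst nn_integral_fst[symmetric]) auto
    also have "\<dots> = ennreal E0 * (\<integral>\<^sup>+ p. ennreal (exp (- pi * (2 ^ k)\<^sup>2 * (sq_dist_gap x p)\<^sup>2)) \<partial>(\<mu> \<Otimes>\<^sub>M \<mu>))"
      by (subst nn_integral_cmult) auto
    finally show ?thesis .
  qed
  show ?thesis unfolding E
  proof (rule hausdorff_dim_ge_if_dyadic_energy[OF _ _ Em _ \<beta>])
    show "prob_space \<nu>" unfolding \<nu>_def by (rule prob_space_distr[OF dm])
    show "sets \<nu> = sets borel" by (simp add: \<nu>_def)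
    show "AE a in \<nu>. a \<in> dist x ` S"
      unfolding \<nu>_def using S(2) Em by (subst AE_distr_iff[OF dm]) auto
    have "(\<Sum>k. ennreal ((2 ^ k) powr \<beta>) * (\<integral>\<^sup>+ a. emeasure \<nu> (cball a (1 / 2 ^ k)) \<partial>\<nu>))
      \<le> (\<Sum>k. ennreal E0 * (ennreal ((2 ^ k) powr \<beta>) * (\<integral>\<^sup>+ p. ennreal (exp (- pi * (2 ^ k)\<^sup>2 * (sq_dist_gap x p)\<^sup>2)) \<partial>(\<mu> \<Otimes>\<^sub>M \<mu>))))"
      by (intro suminf_le summableI, subst mult.left_commute, intro mult_left_mono ball) simp
    also have "\<dots> < \<top>"
      using fin by (subst ennreal_suminf_cmult) (auto simp: ennreal_mult_less_top less_top simp del: mult_minus_left)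
    finally show "(\<Sum>k. ennreal ((2 ^ k) powr \<beta>) * (\<integral>\<^sup>+ a. emeasure \<nu> (cball a (1 / 2 ^ k)) \<partial>\<nu>)) < \<top>" .
  qed
qed

end

text \<open>
  The exceptional pins for the countably many exponents \<open>1 - 1 / (n + 2)\<close> form a null set. The full distance set
  contains the pinned one of any single good pin in the support.
\<close>
lemma hausdorff_dim_distance_sets:
  fixes \<mu> :: "(real ^ 'n) measure"
  assumes "bounded_prob \<mu> R" and cS: "compact (measure_support \<mu>)"
    and decay: "\<And>b. 0 < b \<Longrightarrow> b < 1 \<Longrightarrow> \<exists>C\<ge>0. \<forall>t. bounded_prob.chord_average \<mu> t \<le> ennreal (C * (1 + \<bar>t\<bar>) powr (- b))"
  shows "hausdorff_dim (distance_set (measure_support \<mu>)) = 1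
       \<and> (AE x in \<mu>. hausdorff_dim (pinned_distance_set x (measure_support \<mu>)) = 1)"
proof -
  interpret bounded_prob \<mu> R by fact
  let ?S = "measure_support \<mu>"
  have aeS: "AE x in \<mu>. x \<in> ?S" by (rule AE_in_measure_support[OF sets_mu])
  have pin: "pinned_distance_set x ?S = dist x ` ?S" for x by (auto simp: pinned_distance_set_def)
  have le: "hausdorff_dim (pinned_distance_set x ?S) \<le> 1" for x
    unfolding pin by (intro hausdorff_dim_bounded_real_le_1 compact_imp_bounded compact_continuous_image cS continuous_intros)
  have dset: "distance_set ?S = (\<lambda>p. dist (fst p) (snd p)) ` (?S \<times> ?S)"
    by (force simp: distance_set_def)
  have led: "hausdorff_dim (distance_set ?S) \<le> 1"
    unfolding dset by (intro hausdorff_dim_bounded_real_le_1 compact_imp_bounded compact_continuous_image compact_Times cS continuous_intros)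
  define \<beta> :: "nat \<Rightarrow> real" where "\<beta> n = 1 - 1 / (n + 2)" for n
  have \<beta>: "0 < \<beta> n" "\<beta> n < 1" for n by (auto simp: \<beta>_def field_simps)
  have "AE x in \<mu>. ennreal (\<beta> n) \<le> hausdorff_dim (pinned_distance_set x ?S)" for n
  proof -
    define b where "b = (1 + \<beta> n) / 2"
    have b: "0 < b" "b < 1" "\<beta> n < b" using \<beta>[of n] by (auto simp: b_def)
    obtain C where C: "C \<ge> 0" "\<And>t. chord_average t \<le> ennreal (C * (1 + \<bar>t\<bar>) powr (- b))"
      using decay[OF b(1,2)] by blast
    have "b \<le> 1" using b by simp
    from AE_dyadic_sq_dist_gap_finite[OF \<beta>(1) b(3) this C] norm_le_R show ?thesis
      by eventually_elim (rule hausdorff_dim_pinned_ge[OF cS aeS _ \<beta>(1)])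
  qed
  then have "AE x in \<mu>. \<forall>n. ennreal (\<beta> n) \<le> hausdorff_dim (pinned_distance_set x ?S)"
    by (subst AE_all_countable) simp
  then have ae: "AE x in \<mu>. hausdorff_dim (pinned_distance_set x ?S) = 1"
  proof eventually_elim
    case (elim x)
    have "(\<lambda>n. 1 - 1 / (real n + 2)) \<longlonglongrightarrow> 1"
      by real_asymp
    then have "\<beta> \<longlonglongrightarrow> 1" unfolding \<beta>_def[abs_def] by (simp add: add.commute)
    then have "(\<lambda>n. ennreal (\<beta> n)) \<longlonglongrightarrow> ennreal 1" by (rule tendsto_ennrealI)
    then have "ennreal 1 \<le> hausdorff_dim (pinned_distance_set x ?S)"
      by (rule LIMSEQ_le_const2) (use elim in auto)
    then show ?case by (intro antisym le) simp
  qed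
  have "AE x in \<mu>. x \<in> ?S \<and> hausdorff_dim (pinned_distance_set x ?S) = 1" using aeS ae by eventually_elim auto
  then have "\<exists>x. x \<in> ?S \<and> hausdorff_dim (pinned_distance_set x ?S) = 1"
    proof (rule contrapos_pp)
    assume no: "\<not> (\<exists>x. x \<in> ?S \<and> hausdorff_dim (pinned_distance_set x ?S) = 1)"
    show "\<not> (AE x in \<mu>. x \<in> ?S \<and> hausdorff_dim (pinned_distance_set x ?S) = 1)"
    proof
      assume "AE x in \<mu>. x \<in> ?S \<and> hausdorff_dim (pinned_distance_set x ?S) = 1"
      then have "AE x in \<mu>. False" by (rule eventually_mono) (use no in blast)
      then show False by simp
    qed
  qed
  then obtain x where x: "x \<in> ?S" "hausdorff_dim (pinned_distance_set x ?S) = 1" by blast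
  have "pinned_distance_set x ?S \<subseteq> distance_set ?S"
    using x(1) by (auto simp: pinned_distance_set_def distance_set_def)
  from hausdorff_dim_mono[OF this] x(2) led have "hausdorff_dim (distance_set ?S) = 1" by simp
  with ae show ?thesis by blast
qed

section \<open>Chord average under pointwise Fourier decay\<close>

context bounded_prob
begin

lemma AE_pair_norm_le_R: "AE p in \<mu> \<Otimes>\<^sub>M \<mu>. norm (fst p) \<le> R \<and> norm (snd p) \<le> R"
proof -
  interpret PP: pair_prob_space \<mu> \<mu> ..
  show ?thesis
  proof (rule PP.AE_pair_measure)
    show "{p \<in> space (\<mu> \<Otimes>\<^sub>M \<mu>). norm (fst p) \<le> R \<and> norm (snd p) \<le> R} \<in> sets (\<mu> \<Otimes>\<^sub>M \<mu>)" by measurable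
    show "AE x in \<mu>. AE y in \<mu>. norm (fst (x, y)) \<le> R \<and> norm (snd (x, y)) \<le> R"
      using norm_le_R by eventually_elim (use norm_le_R in auto)
  qed
qed

text \<open>
  Smoothing turns integral control into pointwise control. By \<open>1 + |z| \<le> (1 + |u|) (1 + |u + z|)\<close> the weight \<open>(1 + |z|) powr a'\<close>
  can be split between the Gaussian, which absorbs it, and the transform, where \<open>bound\<close> applies: the constant \<open>K\<close>
  is integrated against the Gaussian and \<open>G\<close> against Lebesgue measure. Pointwise Fourier decay is the case \<open>G = 0\<close>.
\<close>
lemma windowed_ft_decay:
  assumes a: "0 \<le> a'" "a' \<le> a" and K: "K \<ge> 0"
    and G[measurable]: "G \<in> borel_measurable borel" and G0: "\<And>w. G w \<ge> 0"
    and Gfin: "(\<integral>\<^sup>+ w. ennreal (G w) \<partial>lborel) < \<top>"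
    and bound: "\<And>w. norm w \<ge> 1 \<Longrightarrow> abs_ft w * norm w powr a \<le> K + G w"
  shows "\<exists>C\<ge>0. \<forall>z. cmod (windowed_ft z) \<le> C * (1 + norm z) powr (- a')"
proof -
  define g where "g u = exp (- pi * (norm u)\<^sup>2 / (sqrt 2)\<^sup>2)" for u :: "real ^ 'n"
  have [measurable]: "g \<in> borel_measurable borel" unfolding g_def[abs_def] by measurable
  define c where "c = exp (a'\<^sup>2 / 2) * 2 powr a'"
  have c: "c > 0" by (simp add: c_def)
  define H where "H = ennreal (1 + K) * ennreal (sqrt 2 ^ CARD('n)) + (\<integral>\<^sup>+ w. ennreal (G w) \<partial>lborel)"
  have H: "H < \<top>" using Gfin by (simp add: H_def ennreal_mult_less_top)
  have Fw: "abs_ft w * (1 + norm w) powr a' \<le> 2 powr a' * (1 + K + G w)" for w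
  proof (cases "norm w \<ge> 1")
    case True
    have "(1 + norm w) powr a' \<le> (2 * norm w) powr a'" using True a by (intro powr_mono2) auto
    also have "\<dots> = 2 powr a' * norm w powr a'" by (simp add: powr_mult)
    also have "\<dots> \<le> 2 powr a' * norm w powr a" using True a by (intro mult_left_mono powr_mono) auto
    finally have "abs_ft w * (1 + norm w) powr a' \<le> abs_ft w * (2 powr a' * norm w powr a)" by (intro mult_left_mono) auto
    also have "\<dots> = 2 powr a' * (abs_ft w * norm w powr a)" by simp
    also have "\<dots> \<le> 2 powr a' * (1 + K + G w)" using bound[OF True] by (intro mult_left_mono) auto
    finally show ?thesis .
  next
    case False
    have "(1 + norm w) powr a' \<le> 2 powr a'" using False a by (intro powr_mono2) auto
    then have "abs_ft w * (1 + norm w) powr a' \<le> 1 * 2 powr a'" using abs_ft_le_1 by (intro mult_mono) auto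
    also have "\<dots> \<le> 2 powr a' * (1 + K + G w)"
      using K G0[of w] mult_left_mono[of 1 "1 + K + G w" "2 powr a'"] by simp
    finally show ?thesis .
  qed
  have main: "ennreal ((1 + norm z) powr a' * cmod (windowed_ft z)) \<le> ennreal c * H" for z
  proof -
    have pt: "(1 + norm z) powr a' * (exp (- pi * (norm u)\<^sup>2) * abs_ft (u + z)) \<le> c * ((1 + K) * g u + G (u + z))" for u
    proof -
      have "norm z \<le> norm u + norm (u + z)" using norm_triangle_ineq4[of "u + z" u] by simp
      also have "1 + \<dots> \<le> (1 + norm u) * (1 + norm (u + z))" by (simp add: algebra_simps)
      finally have "1 + norm z \<le> (1 + norm u) * (1 + norm (u + z))" by simp
      then have "(1 + norm z) powr a' \<le> ((1 + norm u) * (1 + norm (u + z))) powr a'"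
        using a by (intro powr_mono2) auto
      also have "\<dots> = (1 + norm u) powr a' * (1 + norm (u + z)) powr a'" by (rule powr_mult)
      finally have "(1 + norm z) powr a' * (exp (- pi * (norm u)\<^sup>2) * abs_ft (u + z))
          \<le> ((1 + norm u) powr a' * (1 + norm (u + z)) powr a') * (exp (- pi * (norm u)\<^sup>2) * abs_ft (u + z))"
        by (intro mult_right_mono) auto
      also have "\<dots> = (exp (- pi * (norm u)\<^sup>2) * (1 + norm u) powr a') * (abs_ft (u + z) * (1 + norm (u + z)) powr a')"
        by simp
      also have "\<dots> \<le> (exp (a'\<^sup>2 / 2) * g u) * (2 powr a' * (1 + K + G (u + z)))"
      proof (rule mult_mono)
        show "exp (- pi * (norm u)\<^sup>2) * (1 + norm u) powr a' \<le> exp (a'\<^sup>2 / 2) * g u"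
          using gaussian_powr_le[of "norm u" a'] a by (simp add: g_def)
      qed (use Fw in \<open>auto simp: g_def\<close>)
      also have "\<dots> = c * ((1 + K) * g u + g u * G (u + z))" by (simp add: c_def algebra_simps)
      also have "\<dots> \<le> c * ((1 + K) * g u + G (u + z))"
        using c G0[of "u + z"] by (intro mult_left_mono add_left_mono) (auto simp: g_def mult_left_le_one_le)
      finally show ?thesis .
    qed
    have "ennreal ((1 + norm z) powr a' * cmod (windowed_ft z)) = ennreal ((1 + norm z) powr a') * ennreal (cmod (windowed_ft z))"
      by (simp add: ennreal_mult)
    also have "\<dots> \<le> ennreal ((1 + norm z) powr a') * (\<integral>\<^sup>+ u. ennreal (exp (- pi * (norm u)\<^sup>2) * abs_ft (u + z)) \<partial>lborel)"
      by (intro mult_left_mono windowed_ft_le_gaussian_average) auto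
    also have "\<dots> = (\<integral>\<^sup>+ u. ennreal ((1 + norm z) powr a' * (exp (- pi * (norm u)\<^sup>2) * abs_ft (u + z))) \<partial>lborel)"
      by (subst nn_integral_cmult[symmetric]) (auto simp: ennreal_mult[symmetric])
    also have "\<dots> \<le> (\<integral>\<^sup>+ u. ennreal c * (ennreal (1 + K) * ennreal (g u) + ennreal (G (u + z))) \<partial>lborel)"
    proof (intro nn_integral_mono)
      fix u
      have "ennreal c * (ennreal (1 + K) * ennreal (g u) + ennreal (G (u + z))) = ennreal (c * ((1 + K) * g u + G (u + z)))"
        using c K G0[of "u + z"] by (simp add: ennreal_mult[symmetric] ennreal_plus[symmetric] g_def del: ennreal_plus)
      then show "ennreal ((1 + norm z) powr a' * (exp (- pi * (norm u)\<^sup>2) * abs_ft (u + z)))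
         \<le> ennreal c * (ennreal (1 + K) * ennreal (g u) + ennreal (G (u + z)))"
        using pt[of u] by (simp add: ennreal_leI)
    qed
    also have "\<dots> = ennreal c * (ennreal (1 + K) * (\<integral>\<^sup>+ u. ennreal (g u) \<partial>lborel) + (\<integral>\<^sup>+ u. ennreal (G (u + z)) \<partial>lborel))"
      by (simp add: nn_integral_cmult nn_integral_add del: ennreal_plus)
    also have "(\<integral>\<^sup>+ u. ennreal (g u) \<partial>lborel) = ennreal (sqrt 2 ^ CARD('n))"
      unfolding g_def by (subst nn_integral_gaussian) auto
    also have "(\<integral>\<^sup>+ u. ennreal (G (u + z)) \<partial>lborel) = (\<integral>\<^sup>+ w. ennreal (G w) \<partial>lborel)"
      by (rule nn_integral_lborel_translate) measurable
    finally show ?thesis by (simp add: H_def)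
  qed
  define C where "C = enn2real (ennreal c * H)"
  have fin: "ennreal c * H < \<top>" using H by (simp add: ennreal_mult_less_top)
  have "cmod (windowed_ft z) \<le> C * (1 + norm z) powr (- a')" for z
  proof -
    have pos: "(1 + norm z) powr a' > 0"
    proof -
      have "1 + norm z > 0" using norm_ge_zero[of z] by linarith
      then show ?thesis by simp
    qed
    have "ennreal ((1 + norm z) powr a' * cmod (windowed_ft z)) \<le> ennreal C"
      using main[of z] fin by (simp add: C_def)
    then have "(1 + norm z) powr a' * cmod (windowed_ft z) \<le> C" by (simp add: C_def)
    then show ?thesis using pos by (simp add: powr_minus field_simps)
  qed
  moreover have "C \<ge> 0" by (simp add: C_def)
  ultimately show ?thesis by blast
qed

text \<open>
  Small differences are rare if the transform decays: as in the classical link between Fourier decay and energy, but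
  only one of the two factors \<open>windowed_ft w\<close> and \<open>windowed_ft (- w)\<close> is estimated by the decay, which
  yields exponents below \<open>a\<close> rather than below \<open>2 a\<close>.
\<close>
lemma difference_small_average:
  assumes a: "0 < a'" "a' < a" "a' \<le> 1" and C: "C \<ge> 0"
    and decay: "\<And>z. cmod (windowed_ft z) \<le> C * (1 + norm z) powr (- a)"
  shows "\<exists>C'\<ge>0. \<forall>\<tau>>0. (\<integral>\<^sup>+ p. ennreal (exp (- pi * \<tau>\<^sup>2 * (norm (snd p - fst p))\<^sup>2)) \<partial>(\<mu> \<Otimes>\<^sub>M \<mu>)) \<le> ennreal (C' * \<tau> powr (- a'))"
proof -
  interpret PP: pair_prob_space \<mu> \<mu> ..
  have "1 \<le> DIM(real ^ 'n)" using DIM_positive[where 'a="real ^ 'n"] by linarith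
  then have "a' \<le> DIM(real ^ 'n)" using a(3) by linarith
  then obtain K where K: "K \<ge> 0" "\<And>\<tau>. \<tau> > 0 \<Longrightarrow> (\<integral>\<^sup>+ w. ennreal (exp (- pi * (norm (w::real ^ 'n))\<^sup>2 / \<tau>\<^sup>2) * (1 + norm w) powr (- a)) \<partial>lborel)
     \<le> ennreal (K * \<tau> powr (DIM(real ^ 'n) - a'))"
    using nn_integral_gaussian_powr_le[where 'a="real ^ 'n", of a' a] a(1,2) by blast
  define E where "E = exp (2 * pi * R\<^sup>2)"
  define e where "e x = exp (- pi * (norm x)\<^sup>2)" for x :: "real ^ 'n"
  have e[measurable]: "e \<in> borel_measurable borel" unfolding e_def[abs_def] by measurable
  have e01: "0 \<le> e x" "e x \<le> 1" for x by (auto simp: e_def)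
  have phase: "cmod (\<integral>p. cis (2 * pi * (w \<bullet> (snd p - fst p))) * complex_of_real (e (fst p) * e (snd p)) \<partial>(\<mu> \<Otimes>\<^sub>M \<mu>)) \<le> C * (1 + norm w) powr (- a)" for w
  proof -
    have "(\<integral>p. cis (2 * pi * (w \<bullet> (snd p - fst p))) * complex_of_real (e (fst p) * e (snd p)) \<partial>(\<mu> \<Otimes>\<^sub>M \<mu>))
      = (\<integral>p. (e (fst p) *\<^sub>R cis (2 * pi * (- w \<bullet> fst p))) * (e (snd p) *\<^sub>R cis (2 * pi * (w \<bullet> snd p))) \<partial>(\<mu> \<Otimes>\<^sub>M \<mu>))"
    proof (intro Bochner_Integration.integral_cong refl)
      fix p :: "(real ^ 'n) \<times> (real ^ 'n)"
      have "cis (2 * pi * (w \<bullet> (snd p - fst p))) = cis (2 * pi * (- w \<bullet> fst p)) * cis (2 * pi * (w \<bullet> snd p))"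
        unfolding cis_mult by (simp add: inner_diff_right algebra_simps)
      then show "cis (2 * pi * (w \<bullet> (snd p - fst p))) * complex_of_real (e (fst p) * e (snd p))
        = (e (fst p) *\<^sub>R cis (2 * pi * (- w \<bullet> fst p))) * (e (snd p) *\<^sub>R cis (2 * pi * (w \<bullet> snd p)))"
        by (simp add: scaleR_conv_of_real mult_ac)
    qed
    also have "\<dots> = windowed_ft (- w) * windowed_ft w"
      unfolding windowed_ft_def e_def[symmetric]
      by (rule integral_prod_mult) (use e01 in \<open>auto intro: prob_space_axioms\<close>)
    finally show ?thesis
      using windowed_ft_le_1[of "- w"] decay[of w] by (simp add: norm_mult mult_left_le_one_le order_trans[of _ "cmod (windowed_ft w)"])
  qed
  have "(\<integral>\<^sup>+ p. ennreal (exp (- pi * \<tau>\<^sup>2 * (norm (snd p - fst p))\<^sup>2)) \<partial>(\<mu> \<Otimes>\<^sub>M \<mu>)) \<le> ennreal ((E * C * K) * \<tau> powr (- a'))" if \<tau>: "\<tau> > 0" for \<tau>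
  proof -
    let ?g = "\<lambda>p. exp (- pi * \<tau>\<^sup>2 * (norm (snd p - fst p))\<^sup>2)"
    have "(\<integral>\<^sup>+ p. ennreal (?g p) \<partial>(\<mu> \<Otimes>\<^sub>M \<mu>)) \<le> (\<integral>\<^sup>+ p. ennreal E * ennreal (?g p * (e (fst p) * e (snd p))) \<partial>(\<mu> \<Otimes>\<^sub>M \<mu>))"
    proof (rule nn_integral_mono_AE)
      show "AE p in \<mu> \<Otimes>\<^sub>M \<mu>. ennreal (?g p) \<le> ennreal E * ennreal (?g p * (e (fst p) * e (snd p)))"
        using AE_pair_norm_le_R
      proof eventually_elim
        case (elim p)
        have "(norm (fst p))\<^sup>2 \<le> R\<^sup>2" "(norm (snd p))\<^sup>2 \<le> R\<^sup>2" using elim by (auto intro: power_mono)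
        then have "pi * (norm (fst p))\<^sup>2 \<le> pi * R\<^sup>2" "pi * (norm (snd p))\<^sup>2 \<le> pi * R\<^sup>2" by auto
        then have "0 \<le> 2 * pi * R\<^sup>2 + (- pi * (norm (fst p))\<^sup>2 + - pi * (norm (snd p))\<^sup>2)" by linarith
        then have "1 \<le> exp (2 * pi * R\<^sup>2 + (- pi * (norm (fst p))\<^sup>2 + - pi * (norm (snd p))\<^sup>2))"
          by (simp only: one_le_exp_iff)
        then have "1 \<le> E * (e (fst p) * e (snd p))" unfolding E_def e_def exp_add .
        then have "?g p * 1 \<le> ?g p * (E * (e (fst p) * e (snd p)))" by (intro mult_left_mono) auto
        also have "\<dots> = E * (?g p * (e (fst p) * e (snd p)))" by simp
        finally show ?case using e01 by (simp add: E_def ennreal_mult[symmetric] ennreal_leI)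
      qed
    qed
    also have "\<dots> = ennreal E * (\<integral>\<^sup>+ p. ennreal (?g p * (e (fst p) * e (snd p))) \<partial>(\<mu> \<Otimes>\<^sub>M \<mu>))"
      by (rule nn_integral_cmult) measurable
    also have "\<dots> \<le> ennreal E * (ennreal (1 / \<tau> ^ DIM(real ^ 'n)) *
       (\<integral>\<^sup>+ w. ennreal (exp (- pi * (norm w)\<^sup>2 / \<tau>\<^sup>2) * cmod (\<integral>p. cis (2 * pi * (w \<bullet> (snd p - fst p))) * complex_of_real (e (fst p) * e (snd p)) \<partial>(\<mu> \<Otimes>\<^sub>M \<mu>))) \<partial>lborel))"
      by (intro mult_left_mono nn_integral_gaussian_weighted_le)
         (use \<tau> e01 PP.P.finite_measure_axioms in \<open>auto intro: mult_le_one\<close>)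
    also have "\<dots> \<le> ennreal E * (ennreal (1 / \<tau> ^ DIM(real ^ 'n)) *
       (\<integral>\<^sup>+ w. ennreal C * ennreal (exp (- pi * (norm (w::real ^ 'n))\<^sup>2 / \<tau>\<^sup>2) * (1 + norm w) powr (- a)) \<partial>lborel))"
    proof (intro mult_left_mono nn_integral_mono)
      fix w :: "real ^ 'n"
      have "exp (- pi * (norm w)\<^sup>2 / \<tau>\<^sup>2) * cmod (\<integral>p. cis (2 * pi * (w \<bullet> (snd p - fst p))) * complex_of_real (e (fst p) * e (snd p)) \<partial>(\<mu> \<Otimes>\<^sub>M \<mu>))
         \<le> exp (- pi * (norm w)\<^sup>2 / \<tau>\<^sup>2) * (C * (1 + norm w) powr (- a))"
        by (intro mult_left_mono phase) auto
      then show "ennreal (exp (- pi * (norm w)\<^sup>2 / \<tau>\<^sup>2) * cmod (\<integral>p. cis (2 * pi * (w \<bullet> (snd p - fst p))) * complex_of_real (e (fst p) * e (snd p)) \<partial>(\<mu> \<Otimes>\<^sub>M \<mu>)))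
        \<le> ennreal C * ennreal (exp (- pi * (norm w)\<^sup>2 / \<tau>\<^sup>2) * (1 + norm w) powr (- a))"
        using C by (subst ennreal_mult[symmetric]) (auto intro!: ennreal_leI simp: mult.left_commute)
    qed auto
    also have "\<dots> = ennreal E * (ennreal (1 / \<tau> ^ DIM(real ^ 'n)) * (ennreal C *
       (\<integral>\<^sup>+ w. ennreal (exp (- pi * (norm (w::real ^ 'n))\<^sup>2 / \<tau>\<^sup>2) * (1 + norm w) powr (- a)) \<partial>lborel)))"
      by (subst nn_integral_cmult) auto
    also have "\<dots> \<le> ennreal E * (ennreal (1 / \<tau> ^ DIM(real ^ 'n)) * (ennreal C * ennreal (K * \<tau> powr (DIM(real ^ 'n) - a'))))"
      by (intro mult_left_mono K \<tau>) auto
    also have "\<dots> = ennreal ((E * C * K) * \<tau> powr (- a'))"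
    proof -
      have "\<tau> powr (DIM(real ^ 'n) - a') = \<tau> ^ DIM(real ^ 'n) * \<tau> powr (- a')"
        using \<tau> by (simp add: powr_diff powr_minus powr_realpow divide_inverse)
      then show ?thesis using \<tau> C K(1) by (simp add: E_def ennreal_mult[symmetric] mult_ac)
    qed
    finally show ?thesis .
  qed
  moreover have "E * C * K \<ge> 0" using C K by (simp add: E_def)
  ultimately show ?thesis by blast
qed

lemma chord_average_decay_if_large:
  assumes C: "C \<ge> 0" and b: "b \<ge> 0" and large: "\<And>t. \<bar>t\<bar> \<ge> 1 \<Longrightarrow> chord_average t \<le> ennreal (C * \<bar>t\<bar> powr (- b))"
  shows "\<exists>C'\<ge>0. \<forall>t. chord_average t \<le> ennreal (C' * (1 + \<bar>t\<bar>) powr (- b))"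
proof -
  define C' where "C' = (1 + C) * 2 powr b"
  have "chord_average t \<le> ennreal (C' * (1 + \<bar>t\<bar>) powr (- b))" for t
  proof -
    define m where "m = max 1 \<bar>t\<bar>"
    have m: "m \<ge> 1" "1 + \<bar>t\<bar> \<le> 2 * m" by (auto simp: m_def)
    have "(2 * m) powr (- b) \<le> (1 + \<bar>t\<bar>) powr (- b)" using m b by (intro powr_mono2') auto
    moreover have "(2 * m) powr (- b) = 2 powr (- b) * m powr (- b)" by (rule powr_mult)
    ultimately have "2 powr b * (2 powr (- b) * m powr (- b)) \<le> 2 powr b * (1 + \<bar>t\<bar>) powr (- b)"
      by (intro mult_left_mono) auto
    then have m2: "m powr (- b) \<le> 2 powr b * (1 + \<bar>t\<bar>) powr (- b)"
      by (simp add: mult.assoc[symmetric] powr_add[symmetric])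
    have "chord_average t \<le> ennreal ((1 + C) * m powr (- b))"
    proof (cases "\<bar>t\<bar> \<ge> 1")
      case True
      then have mt: "m = \<bar>t\<bar>" by (simp add: m_def)
      show ?thesis
        unfolding mt by (intro order_trans[OF large[OF True]] ennreal_leI mult_right_mono) auto
    next
      case False
      then have "m = 1" by (simp add: m_def)
      then have "(1::ennreal) \<le> ennreal ((1 + C) * m powr (- b))" using C by (simp del: ennreal_plus)
      then show ?thesis by (rule order_trans[OF chord_average_le_1])
    qed
    also have "\<dots> \<le> ennreal (C' * (1 + \<bar>t\<bar>) powr (- b))"
      using mult_left_mono[OF m2, of "1 + C"] C unfolding C'_def by (intro ennreal_leI) (simp add: mult.assoc)
    finally show ?thesis .
  qed
  moreover have "C' \<ge> 0" using C by (simp add: C'_def)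
  ultimately show ?thesis by blast
qed

text \<open>
  The decay at \<open>2t (y' - y)\<close> is useless when \<open>y'\<close> is close to \<open>y\<close>, so it is written as a superposition of Gaussians in
  \<open>y' - y\<close> and each of these is averaged by \<open>difference_small_average\<close>. The gap between \<open>a'\<close> and \<open>a\<close> makes the
  sum over scales converge.
\<close>
lemma chord_average_decay_if_windowed_ft_decay:
  assumes a: "0 < a'" "a' < a" "a' \<le> 1" and C: "C \<ge> 0"
    and decay: "\<And>z. cmod (windowed_ft z) \<le> C * (1 + norm z) powr (- a)"
  shows "\<exists>C'\<ge>0. \<forall>t. chord_average t \<le> ennreal (C' * (1 + \<bar>t\<bar>) powr (- a'))"
proof -
  interpret PP: pair_prob_space \<mu> \<mu> ..
  obtain K where K: "K \<ge> 0" "\<And>\<tau>. \<tau> > 0 \<Longrightarrow> (\<integral>\<^sup>+ p. ennreal (exp (- pi * \<tau>\<^sup>2 * (norm (snd p - fst p))\<^sup>2)) \<partial>(\<mu> \<Otimes>\<^sub>M \<mu>)) \<le> ennreal (K * \<tau> powr (- a'))"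
    using difference_small_average[OF a C decay] by blast
  define D where "D = C * (2 powr a * exp pi)"
  have D: "D \<ge> 0" using C by (simp add: D_def)
  define S where "S = 1 / (1 - 2 powr (- (a - a')))"
  have "2 powr (- (a - a')) < (1::real)" using a by (simp add: powr_less_one)
  then have S: "S \<ge> 0" by (simp add: S_def)
  show ?thesis
  proof (rule chord_average_decay_if_large)
    show "0 \<le> D * (K * S)" using D K S by simp
    show "0 \<le> a'" using a by simp
    fix t :: real assume t: "\<bar>t\<bar> \<ge> 1"
    define s where "s = 2 * \<bar>t\<bar>"
    have s: "s > 0" using t by (simp add: s_def)
    have "chord_average t \<le> (\<integral>\<^sup>+ p. ennreal D * (\<Sum>k. ennreal ((2 ^ k) powr (- a)) * ennreal (exp (- pi * (s / 2 ^ k)\<^sup>2 * (norm (snd p - fst p))\<^sup>2))) \<partial>(\<mu> \<Otimes>\<^sub>M \<mu>))"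
      unfolding chord_average_def
    proof (rule nn_integral_mono)
      fix p :: "(real ^ 'n) \<times> (real ^ 'n)"
      define v where "v = (2 * t) *\<^sub>R (snd p - fst p)"
      have nv: "(norm v)\<^sup>2 = s\<^sup>2 * (norm (snd p - fst p))\<^sup>2" by (simp add: v_def s_def power_mult_distrib)
      have "ennreal (cmod (windowed_ft v)) \<le> ennreal C * ennreal ((1 + norm v) powr (- a))"
        using decay[of v] C by (simp add: ennreal_mult[symmetric] ennreal_leI)
      also have "\<dots> \<le> ennreal C * (ennreal (2 powr a * exp pi) * (\<Sum>k. ennreal ((2 ^ k) powr (- a) * exp (- pi * (norm v)\<^sup>2 / (2 ^ k)\<^sup>2))))"
        using a by (intro mult_left_mono powr_le_suminf_gaussian) auto
      also have "\<dots> = ennreal D * (\<Sum>k. ennreal ((2 ^ k) powr (- a) * exp (- pi * (norm v)\<^sup>2 / (2 ^ k)\<^sup>2)))"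
        using C by (simp add: D_def ennreal_mult mult.assoc)
      also have "(\<lambda>k. ennreal ((2 ^ k) powr (- a) * exp (- pi * (norm v)\<^sup>2 / (2 ^ k)\<^sup>2)))
         = (\<lambda>k. ennreal ((2 ^ k) powr (- a)) * ennreal (exp (- pi * (s / 2 ^ k)\<^sup>2 * (norm (snd p - fst p))\<^sup>2)))"
        unfolding nv by (simp add: ennreal_mult power_divide mult.assoc)
      finally show "ennreal (cmod (windowed_ft ((2 * t) *\<^sub>R (snd p - fst p)))) \<le> ennreal D * (\<Sum>k. ennreal ((2 ^ k) powr (- a)) * ennreal (exp (- pi * (s / 2 ^ k)\<^sup>2 * (norm (snd p - fst p))\<^sup>2)))"
        by (simp add: v_def)
    qed
    also have "\<dots> = ennreal D * (\<Sum>k. ennreal ((2 ^ k) powr (- a)) * (\<integral>\<^sup>+ p. ennreal (exp (- pi * (s / 2 ^ k)\<^sup>2 * (norm (snd p - fst p))\<^sup>2)) \<partial>(\<mu> \<Otimes>\<^sub>M \<mu>)))"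
    proof -
      have m: "(\<lambda>p. ennreal (exp (- pi * c * (norm (snd p - fst p))\<^sup>2))) \<in> borel_measurable (\<mu> \<Otimes>\<^sub>M \<mu>)" for c :: real
        by measurable
      have cm: "(\<lambda>x. c * J x) \<in> borel_measurable (\<mu> \<Otimes>\<^sub>M \<mu>)" if "J \<in> borel_measurable (\<mu> \<Otimes>\<^sub>M \<mu>)" for c :: ennreal and J
        using that by measurable
      show ?thesis
        by (subst nn_integral_cmult, intro borel_measurable_suminf_order cm m,
            subst nn_integral_suminf, intro cm m, subst nn_integral_cmult, rule m, rule refl)
    qed
    also have "\<dots> \<le> ennreal D * (\<Sum>k. ennreal (K * s powr (- a')) * ennreal ((2 ^ k) powr (- (a - a'))))"
    proof (intro mult_left_mono suminf_le)
      fix k :: nat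
      have "ennreal ((2 ^ k) powr (- a)) * (\<integral>\<^sup>+ p. ennreal (exp (- pi * (s / 2 ^ k)\<^sup>2 * (norm (snd p - fst p))\<^sup>2)) \<partial>(\<mu> \<Otimes>\<^sub>M \<mu>))
        \<le> ennreal ((2 ^ k) powr (- a)) * ennreal (K * (s / 2 ^ k) powr (- a'))"
        using s by (intro mult_left_mono K) auto
      also have "\<dots> = ennreal (K * s powr (- a')) * ennreal ((2 ^ k) powr (- (a - a')))"
      proof -
        have "(s / 2 ^ k) powr (- a') = s powr (- a') * (2 ^ k) powr a'"
          using s by (simp add: powr_divide powr_minus field_simps)
        moreover have "((2::real) ^ k) powr (- (a - a')) = (2 ^ k) powr (- a) * (2 ^ k) powr a'"
          by (simp add: powr_add[symmetric])
        ultimately show ?thesis using K(1) by (simp add: ennreal_mult[symmetric] mult_ac)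
      qed
      finally show "ennreal ((2 ^ k) powr (- a)) * (\<integral>\<^sup>+ p. ennreal (exp (- pi * (s / 2 ^ k)\<^sup>2 * (norm (snd p - fst p))\<^sup>2)) \<partial>(\<mu> \<Otimes>\<^sub>M \<mu>))
        \<le> ennreal (K * s powr (- a')) * ennreal ((2 ^ k) powr (- (a - a')))" .
    qed auto
    also have "\<dots> = ennreal D * (ennreal (K * s powr (- a')) * ennreal S)"
      using a unfolding S_def by (subst ennreal_suminf_cmult) (subst suminf_dyadic_powr, auto)
    also have "\<dots> = ennreal ((D * (K * S)) * s powr (- a'))"
      using D K S by (simp add: ennreal_mult[symmetric] mult_ac)
    also have "\<dots> \<le> ennreal ((D * (K * S)) * \<bar>t\<bar> powr (- a'))"
      using D K S a t by (intro ennreal_leI mult_left_mono powr_mono2') (auto simp: s_def)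
    finally show "chord_average t \<le> ennreal (D * (K * S) * \<bar>t\<bar> powr (- a'))" .
  qed
qed

section \<open>Chord average under weighted integrability of the Fourier transform\<close>

text \<open>
  The density of the law of \<open>2t (y' - y)\<close> convolved with the standard Gaussian.
\<close>
definition chord_density :: "real \<Rightarrow> real ^ 'n \<Rightarrow> real" where
  "chord_density t z = (\<integral>p. exp (- pi * (norm (z - (2 * t) *\<^sub>R (snd p - fst p)))\<^sup>2) \<partial>(\<mu> \<Otimes>\<^sub>M \<mu>))"

lemma chord_density_measurable [measurable]: "chord_density t \<in> borel_measurable borel"
proof -
  interpret PP: pair_prob_space \<mu> \<mu> ..
  show ?thesis unfolding chord_density_def[abs_def] by measurable
qed

lemma chord_density_nonneg: "chord_density t z \<ge> 0"
  unfolding chord_density_def by (rule integral_nonneg_AE) simp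

lemma ennreal_chord_density: "ennreal (chord_density t z) = (\<integral>\<^sup>+ p. ennreal (exp (- pi * (norm (z - (2 * t) *\<^sub>R (snd p - fst p)))\<^sup>2)) \<partial>(\<mu> \<Otimes>\<^sub>M \<mu>))"
proof -
  interpret PP: pair_prob_space \<mu> \<mu> ..
  show ?thesis unfolding chord_density_def
    by (intro nn_integral_eq_integral[symmetric] PP.P.integrable_const_bound[where B = 1]) auto
qed

lemma nn_integral_chord_density_mult:
  assumes h[measurable]: "h \<in> borel_measurable borel"
  shows "(\<integral>\<^sup>+ z. ennreal (chord_density t z) * h z \<partial>lborel)
    = (\<integral>\<^sup>+ p. (\<integral>\<^sup>+ z. ennreal (exp (- pi * (norm z)\<^sup>2)) * h (z + (2 * t) *\<^sub>R (snd p - fst p)) \<partial>lborel) \<partial>(\<mu> \<Otimes>\<^sub>M \<mu>))"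
proof -
  interpret PP: pair_prob_space \<mu> \<mu> ..
  interpret L: pair_sigma_finite "\<mu> \<Otimes>\<^sub>M \<mu>" "lborel :: (real ^ 'n) measure" ..
  let ?g = "\<lambda>z p. ennreal (exp (- pi * (norm (z - (2 * t) *\<^sub>R (snd p - fst p)))\<^sup>2))"
  have "(\<integral>\<^sup>+ z. ennreal (chord_density t z) * h z \<partial>lborel) = (\<integral>\<^sup>+ z. (\<integral>\<^sup>+ p. ?g z p * h z \<partial>(\<mu> \<Otimes>\<^sub>M \<mu>)) \<partial>lborel)"
    unfolding ennreal_chord_density by (intro nn_integral_cong nn_integral_multc[symmetric]) measurable
  also have "\<dots> = (\<integral>\<^sup>+ p. (\<integral>\<^sup>+ z. ?g z p * h z \<partial>lborel) \<partial>(\<mu> \<Otimes>\<^sub>M \<mu>))"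
    by (rule L.Fubini') measurable
  also have "\<dots> = (\<integral>\<^sup>+ p. (\<integral>\<^sup>+ z. ennreal (exp (- pi * (norm z)\<^sup>2)) * h (z + (2 * t) *\<^sub>R (snd p - fst p)) \<partial>lborel) \<partial>(\<mu> \<Otimes>\<^sub>M \<mu>))"
  proof (rule nn_integral_cong)
    fix p :: "(real ^ 'n) \<times> (real ^ 'n)"
    show "(\<integral>\<^sup>+ z. ?g z p * h z \<partial>lborel) = (\<integral>\<^sup>+ z. ennreal (exp (- pi * (norm z)\<^sup>2)) * h (z + (2 * t) *\<^sub>R (snd p - fst p)) \<partial>lborel)"
      using nn_integral_lborel_translate[of "\<lambda>z. ?g z p * h z" "(2 * t) *\<^sub>R (snd p - fst p)"] by simp
  qed
  finally show ?thesis .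
qed

lemma nn_integral_unit_gaussian: "(\<integral>\<^sup>+ z. ennreal (exp (- pi * (norm (z::real ^ 'n))\<^sup>2)) \<partial>lborel) = 1"
  using nn_integral_gaussian[of 1, where 'a="real ^ 'n"] by simp

lemma nn_integral_chord_density: "(\<integral>\<^sup>+ z. ennreal (chord_density t z) \<partial>lborel) = 1"
proof -
  interpret PP: pair_prob_space \<mu> \<mu> ..
  show ?thesis
    using nn_integral_chord_density_mult[of "\<lambda>_. 1" t] nn_integral_unit_gaussian PP.P.emeasure_space_1 by simp
qed

lemma chord_average_le_chord_integral: "chord_average t \<le> (\<integral>\<^sup>+ z. ennreal (abs_ft z * chord_density t z) \<partial>lborel)"
proof -
  have "chord_average t \<le> (\<integral>\<^sup>+ p. (\<integral>\<^sup>+ z. ennreal (exp (- pi * (norm z)\<^sup>2)) * ennreal (abs_ft (z + (2 * t) *\<^sub>R (snd p - fst p))) \<partial>lborel) \<partial>(\<mu> \<Otimes>\<^sub>M \<mu>))"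
    unfolding chord_average_def using windowed_ft_le_gaussian_average by (intro nn_integral_mono) (simp add: ennreal_mult)
  also have "\<dots> = (\<integral>\<^sup>+ z. ennreal (chord_density t z) * ennreal (abs_ft z) \<partial>lborel)"
    by (rule nn_integral_chord_density_mult[symmetric]) measurable
  finally show ?thesis using chord_density_nonneg by (simp add: ennreal_mult mult.commute)
qed

text \<open>
  The vectors \<open>2t (y' - y)\<close> have length at most \<open>4 R |t|\<close>, so beyond \<open>(4 R + 1) |t|\<close> only the part of the Gaussian
  outside the ball of radius \<open>|t|\<close> contributes. The bound \<open>1 / |t|\<close> is as much decay as will be needed.
\<close>
lemma chord_density_tail:
  assumes t: "\<bar>t\<bar> \<ge> 1"
  shows "(\<integral>\<^sup>+ z. ennreal (chord_density t z) * indicator {z. norm z > (4 * R + 1) * \<bar>t\<bar>} z \<partial>lborel) \<le> ennreal (sqrt 2 ^ CARD('n) * \<bar>t\<bar> powr (- 1))"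
proof -
  interpret PP: pair_prob_space \<mu> \<mu> ..
  let ?T = "{z :: real ^ 'n. norm z > (4 * R + 1) * \<bar>t\<bar>}"
  have "(\<integral>\<^sup>+ z. ennreal (chord_density t z) * indicator ?T z \<partial>lborel)
    = (\<integral>\<^sup>+ p. (\<integral>\<^sup>+ z. ennreal (exp (- pi * (norm z)\<^sup>2)) * indicator ?T (z + (2 * t) *\<^sub>R (snd p - fst p)) \<partial>lborel) \<partial>(\<mu> \<Otimes>\<^sub>M \<mu>))"
    by (rule nn_integral_chord_density_mult) measurable
  also have "\<dots> \<le> (\<integral>\<^sup>+ p. (\<integral>\<^sup>+ z. ennreal (\<bar>t\<bar> powr (- 1)) * ennreal (exp (- pi * (norm (z::real ^ 'n))\<^sup>2 / (sqrt 2)\<^sup>2)) \<partial>lborel) \<partial>(\<mu> \<Otimes>\<^sub>M \<mu>))"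
  proof (rule nn_integral_mono_AE)
    show "AE p in \<mu> \<Otimes>\<^sub>M \<mu>. (\<integral>\<^sup>+ z. ennreal (exp (- pi * (norm z)\<^sup>2)) * indicator ?T (z + (2 * t) *\<^sub>R (snd p - fst p)) \<partial>lborel)
       \<le> (\<integral>\<^sup>+ z. ennreal (\<bar>t\<bar> powr (- 1)) * ennreal (exp (- pi * (norm (z::real ^ 'n))\<^sup>2 / (sqrt 2)\<^sup>2)) \<partial>lborel)"
      using AE_pair_norm_le_R
    proof eventually_elim
      case (elim p)
      show ?case
      proof (rule nn_integral_mono)
        fix z :: "real ^ 'n"
        show "ennreal (exp (- pi * (norm z)\<^sup>2)) * indicator ?T (z + (2 * t) *\<^sub>R (snd p - fst p))
           \<le> ennreal (\<bar>t\<bar> powr (- 1)) * ennreal (exp (- pi * (norm z)\<^sup>2 / (sqrt 2)\<^sup>2))"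
        proof (cases "z + (2 * t) *\<^sub>R (snd p - fst p) \<in> ?T")
          case True
          have "norm (snd p - fst p) \<le> 2 * R" using elim norm_triangle_ineq4[of "snd p" "fst p"] by linarith
          then have "2 * \<bar>t\<bar> * norm (snd p - fst p) \<le> 2 * \<bar>t\<bar> * (2 * R)"
            by (intro mult_left_mono) auto
          then have "norm ((2 * t) *\<^sub>R (snd p - fst p)) \<le> 2 * \<bar>t\<bar> * (2 * R)"
            by (simp add: abs_mult)
          moreover have "(4 * R + 1) * \<bar>t\<bar> < norm z + norm ((2 * t) *\<^sub>R (snd p - fst p))"
            using True norm_triangle_ineq[of z "(2 * t) *\<^sub>R (snd p - fst p)"] by simp
          ultimately have "\<bar>t\<bar> \<le> norm z" by (simp add: algebra_simps)
          also have "norm z \<le> exp (pi * (norm z)\<^sup>2 / 2)"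
          proof -
            have "norm z \<le> 1 + (norm z)\<^sup>2 / 2" using sum_squares_bound[of "norm z" 1] by simp
            also have "\<dots> \<le> 1 + pi * (norm z)\<^sup>2 / 2" using pi_gt3 mult_right_mono[of 1 pi "(norm z)\<^sup>2"] by simp
            also have "\<dots> \<le> exp (pi * (norm z)\<^sup>2 / 2)" by (rule exp_ge_add_one_self)
            finally show ?thesis .
          qed
          finally have "\<bar>t\<bar> * exp (- pi * (norm z)\<^sup>2) \<le> exp (pi * (norm z)\<^sup>2 / 2) * exp (- pi * (norm z)\<^sup>2)"
            by (intro mult_right_mono) auto
          also have "\<dots> = exp (- pi * (norm z)\<^sup>2 / (sqrt 2)\<^sup>2)" by (simp add: exp_add[symmetric])
          finally have "exp (- pi * (norm z)\<^sup>2) \<le> \<bar>t\<bar> powr (- 1) * exp (- pi * (norm z)\<^sup>2 / (sqrt 2)\<^sup>2)"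
            using t by (simp add: powr_minus field_simps)
          then show ?thesis using True by (simp add: ennreal_mult[symmetric] ennreal_leI del: mult_minus_left)
        qed simp
      qed
    qed
  qed
  also have "\<dots> = ennreal (\<bar>t\<bar> powr (- 1)) * ennreal (sqrt 2 ^ CARD('n))"
    using PP.P.emeasure_space_1 nn_integral_gaussian[of "sqrt 2", where 'a="real ^ 'n"]
    by (subst nn_integral_cmult) (simp_all add: nn_integral_const del: mult_minus_left real_sqrt_pow2)
  finally show ?thesis by (simp add: ennreal_mult[symmetric] mult.commute)
qed

text \<open>
  Two Gaussian bumps at distance \<open>b\<close> overlap by at most \<open>exp (- pi |b|\<^sup>2 / 2)\<close>, by the parallelogram law. So the left-hand side is at
  most the proportion of quadruples with \<open>y\<^sub>2 - y\<^sub>1\<close> and \<open>y\<^sub>4 - y\<^sub>3\<close> nearly equal, and the characteristic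
  function of \<open>(y\<^sub>2 - y\<^sub>1) - (y\<^sub>4 - y\<^sub>3)\<close> is the fourth power of \<open>abs_ft\<close>.
\<close>
lemma nn_integral_chord_density_squared_le:
  assumes t: "\<bar>t\<bar> \<ge> 1" and \<tau>: "\<tau> = sqrt 2 * \<bar>t\<bar>"
  shows "(\<integral>\<^sup>+ z. ennreal ((chord_density t z)\<^sup>2) \<partial>lborel)
    \<le> ennreal (1 / \<tau> ^ CARD('n)) * (\<integral>\<^sup>+ w. ennreal (exp (- pi * (norm w)\<^sup>2 / \<tau>\<^sup>2) * abs_ft w ^ 4) \<partial>lborel)"
proof -
  interpret PP: pair_prob_space \<mu> \<mu> ..
  interpret QQ: pair_prob_space "\<mu> \<Otimes>\<^sub>M \<mu>" "\<mu> \<Otimes>\<^sub>M \<mu>" ..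
  let ?M = "(\<mu> \<Otimes>\<^sub>M \<mu>) \<Otimes>\<^sub>M (\<mu> \<Otimes>\<^sub>M \<mu>)"
  have \<tau>0: "\<tau> > 0" using t \<tau> by simp
  define v where "v p = snd p - fst p" for p :: "(real ^ 'n) \<times> (real ^ 'n)"
  have [measurable]: "v \<in> borel_measurable (\<mu> \<Otimes>\<^sub>M \<mu>)" unfolding v_def[abs_def] by measurable
  have inner: "(\<integral>\<^sup>+ z. ennreal (exp (- pi * (norm z)\<^sup>2)) * ennreal (exp (- pi * (norm (z + (2 * t) *\<^sub>R v p - (2 * t) *\<^sub>R v p'))\<^sup>2)) \<partial>lborel)
     \<le> ennreal (exp (- pi * \<tau>\<^sup>2 * (norm (v p - v p'))\<^sup>2))" for p p'
  proof -
    define b where "b = (2 * t) *\<^sub>R (v p - v p')"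
    have "exp (- pi * (norm z)\<^sup>2) * exp (- pi * (norm (z + b))\<^sup>2) \<le> exp (- pi * (norm b)\<^sup>2 / 2) * exp (- pi * (norm (z + (1/2) *\<^sub>R b))\<^sup>2)" for z
    proof -
      have "(norm z)\<^sup>2 + (norm (z + b))\<^sup>2 = (norm b)\<^sup>2 / 2 + 2 * (norm (z + (1/2) *\<^sub>R b))\<^sup>2"
        by (simp add: power2_norm_eq_inner inner_add_left inner_add_right inner_commute algebra_simps)
      then have "(norm b)\<^sup>2 / 2 + (norm (z + (1/2) *\<^sub>R b))\<^sup>2 \<le> (norm z)\<^sup>2 + (norm (z + b))\<^sup>2" by simp
      then have "pi * ((norm b)\<^sup>2 / 2 + (norm (z + (1/2) *\<^sub>R b))\<^sup>2) \<le> pi * ((norm z)\<^sup>2 + (norm (z + b))\<^sup>2)"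
        by (intro mult_left_mono) auto
      then show ?thesis by (simp add: exp_add[symmetric] algebra_simps)
    qed
    then have "(\<integral>\<^sup>+ z. ennreal (exp (- pi * (norm z)\<^sup>2)) * ennreal (exp (- pi * (norm (z + b))\<^sup>2)) \<partial>lborel)
       \<le> (\<integral>\<^sup>+ z. ennreal (exp (- pi * (norm b)\<^sup>2 / 2)) * ennreal (exp (- pi * (norm (z + (1/2) *\<^sub>R b))\<^sup>2)) \<partial>lborel)"
      by (intro nn_integral_mono) (simp add: ennreal_mult[symmetric] ennreal_leI)
    also have "\<dots> = ennreal (exp (- pi * (norm b)\<^sup>2 / 2)) * (\<integral>\<^sup>+ z. ennreal (exp (- pi * (norm (z + (1/2) *\<^sub>R b))\<^sup>2)) \<partial>lborel)"
      by (rule nn_integral_cmult) measurable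
    also have "(\<integral>\<^sup>+ z. ennreal (exp (- pi * (norm (z + (1/2) *\<^sub>R b))\<^sup>2)) \<partial>lborel) = 1"
      by (subst nn_integral_lborel_translate[of "\<lambda>z. ennreal (exp (- pi * (norm z)\<^sup>2))"]) (use nn_integral_unit_gaussian in auto)
    also have "- pi * (norm b)\<^sup>2 / 2 = - pi * \<tau>\<^sup>2 * (norm (v p - v p'))\<^sup>2"
      by (simp add: b_def \<tau> power_mult_distrib)
    finally have "(\<integral>\<^sup>+ z. ennreal (exp (- pi * (norm z)\<^sup>2)) * ennreal (exp (- pi * (norm (z + b))\<^sup>2)) \<partial>lborel)
       \<le> ennreal (exp (- pi * \<tau>\<^sup>2 * (norm (v p - v p'))\<^sup>2))" by simp
    moreover have "z + b = z + (2 * t) *\<^sub>R v p - (2 * t) *\<^sub>R v p'" for z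
      by (simp add: b_def scaleR_diff_right)
    ultimately show ?thesis by (simp only:)
  qed
  have "(\<integral>\<^sup>+ z. ennreal ((chord_density t z)\<^sup>2) \<partial>lborel) = (\<integral>\<^sup>+ z. ennreal (chord_density t z) * ennreal (chord_density t z) \<partial>lborel)"
    using chord_density_nonneg by (simp add: power2_eq_square ennreal_mult)
  also have "\<dots> = (\<integral>\<^sup>+ p. (\<integral>\<^sup>+ z. ennreal (exp (- pi * (norm z)\<^sup>2)) * ennreal (chord_density t (z + (2 * t) *\<^sub>R v p)) \<partial>lborel) \<partial>(\<mu> \<Otimes>\<^sub>M \<mu>))"
    unfolding v_def by (rule nn_integral_chord_density_mult) measurable
  also have "\<dots> = (\<integral>\<^sup>+ p. (\<integral>\<^sup>+ p'. (\<integral>\<^sup>+ z. ennreal (exp (- pi * (norm z)\<^sup>2)) * ennreal (exp (- pi * (norm (z + (2 * t) *\<^sub>R v p - (2 * t) *\<^sub>R v p'))\<^sup>2)) \<partial>lborel) \<partial>(\<mu> \<Otimes>\<^sub>M \<mu>)) \<partial>(\<mu> \<Otimes>\<^sub>M \<mu>))"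
  proof (rule nn_integral_cong)
    interpret L: pair_sigma_finite "\<mu> \<Otimes>\<^sub>M \<mu>" "lborel :: (real ^ 'n) measure" ..
    fix p :: "(real ^ 'n) \<times> (real ^ 'n)"
    let ?h = "\<lambda>z p'. ennreal (exp (- pi * (norm z)\<^sup>2)) * ennreal (exp (- pi * (norm (z + (2 * t) *\<^sub>R v p - (2 * t) *\<^sub>R v p'))\<^sup>2))"
    have "(\<integral>\<^sup>+ z. ennreal (exp (- pi * (norm z)\<^sup>2)) * ennreal (chord_density t (z + (2 * t) *\<^sub>R v p)) \<partial>lborel)
      = (\<integral>\<^sup>+ z. (\<integral>\<^sup>+ p'. ?h z p' \<partial>(\<mu> \<Otimes>\<^sub>M \<mu>)) \<partial>lborel)"
      unfolding ennreal_chord_density v_def[symmetric] by (intro nn_integral_cong nn_integral_cmult[symmetric]) measurable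
    also have "\<dots> = (\<integral>\<^sup>+ p'. (\<integral>\<^sup>+ z. ?h z p' \<partial>lborel) \<partial>(\<mu> \<Otimes>\<^sub>M \<mu>))"
      by (rule L.Fubini') measurable
    finally show "(\<integral>\<^sup>+ z. ennreal (exp (- pi * (norm z)\<^sup>2)) * ennreal (chord_density t (z + (2 * t) *\<^sub>R v p)) \<partial>lborel) = (\<integral>\<^sup>+ p'. (\<integral>\<^sup>+ z. ?h z p' \<partial>lborel) \<partial>(\<mu> \<Otimes>\<^sub>M \<mu>))" .
  qed
  also have "\<dots> \<le> (\<integral>\<^sup>+ p. (\<integral>\<^sup>+ p'. ennreal (exp (- pi * \<tau>\<^sup>2 * (norm (v p - v p'))\<^sup>2)) \<partial>(\<mu> \<Otimes>\<^sub>M \<mu>)) \<partial>(\<mu> \<Otimes>\<^sub>M \<mu>))"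
    by (intro nn_integral_mono inner)
  also have "\<dots> = (\<integral>\<^sup>+ q. ennreal (exp (- pi * \<tau>\<^sup>2 * (norm (v (fst q) - v (snd q)))\<^sup>2) * 1) \<partial>?M)"
    by (subst PP.P.nn_integral_fst[symmetric]) auto
  also have "\<dots> \<le> ennreal (1 / \<tau> ^ DIM(real ^ 'n)) *
       (\<integral>\<^sup>+ w. ennreal (exp (- pi * (norm w)\<^sup>2 / \<tau>\<^sup>2) * cmod (\<integral>q. cis (2 * pi * (w \<bullet> (v (fst q) - v (snd q)))) * complex_of_real 1 \<partial>?M)) \<partial>lborel)"
    by (rule nn_integral_gaussian_weighted_le) (use \<tau>0 QQ.P.finite_measure_axioms in auto)
  also have "\<dots> = ennreal (1 / \<tau> ^ CARD('n)) * (\<integral>\<^sup>+ w. ennreal (exp (- pi * (norm w)\<^sup>2 / \<tau>\<^sup>2) * abs_ft w ^ 4) \<partial>lborel)"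
  proof -
    have Fm: "abs_ft (- w) = abs_ft w" for w
    proof -
      have "(\<integral>x. cis (2 * pi * (- w \<bullet> x)) \<partial>\<mu>) = cnj (\<integral>x. cis (2 * pi * (w \<bullet> x)) \<partial>\<mu>)"
        unfolding Bochner_Integration.integral_cnj[symmetric] cis_cnj by simp
      then show ?thesis unfolding cmod_integral_cis[symmetric] by (simp only: complex_mod_cnj)
    qed
    have two: "cmod (\<integral>p. cis (2 * pi * (w \<bullet> v p)) \<partial>(\<mu> \<Otimes>\<^sub>M \<mu>)) = abs_ft w ^ 2" for w
    proof -
      have "(\<integral>p. cis (2 * pi * (w \<bullet> v p)) \<partial>(\<mu> \<Otimes>\<^sub>M \<mu>)) = (\<integral>p. cis (2 * pi * (- w \<bullet> fst p)) * cis (2 * pi * (w \<bullet> snd p)) \<partial>(\<mu> \<Otimes>\<^sub>M \<mu>))"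
        unfolding cis_mult by (simp add: v_def inner_diff_right algebra_simps)
      also have "\<dots> = (\<integral>x. cis (2 * pi * (- w \<bullet> x)) \<partial>\<mu>) * (\<integral>x. cis (2 * pi * (w \<bullet> x)) \<partial>\<mu>)"
        by (rule integral_prod_mult) (auto intro: prob_space_axioms)
      finally show ?thesis by (simp only: norm_mult cmod_integral_cis Fm power2_eq_square)
    qed
    have four: "cmod (\<integral>q. cis (2 * pi * (w \<bullet> (v (fst q) - v (snd q)))) * complex_of_real 1 \<partial>?M) = abs_ft w ^ 4" for w
    proof -
      have "(\<integral>q. cis (2 * pi * (w \<bullet> (v (fst q) - v (snd q)))) * complex_of_real 1 \<partial>?M)
        = (\<integral>q. cis (2 * pi * (w \<bullet> v (fst q))) * cis (2 * pi * (- w \<bullet> v (snd q))) \<partial>?M)"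
        unfolding cis_mult by (simp add: inner_diff_right algebra_simps)
      also have "\<dots> = (\<integral>p. cis (2 * pi * (w \<bullet> v p)) \<partial>(\<mu> \<Otimes>\<^sub>M \<mu>)) * (\<integral>p. cis (2 * pi * (- w \<bullet> v p)) \<partial>(\<mu> \<Otimes>\<^sub>M \<mu>))"
        by (rule integral_prod_mult) (auto intro: PP.P.prob_space_axioms)
      finally have "cmod (\<integral>q. cis (2 * pi * (w \<bullet> (v (fst q) - v (snd q)))) * complex_of_real 1 \<partial>?M) = abs_ft w ^ 2 * abs_ft w ^ 2"
        by (simp only: norm_mult two Fm)
      then show ?thesis by (simp add: power2_eq_square power4_eq_xxxx mult.assoc)
    qed
    show ?thesis unfolding four by simp
  qed
  finally show ?thesis .
qed


text \<open>
  For \<open>\<theta> \<ge> 1/2\<close> one has \<open>2 / \<theta> \<le> 4\<close>, and \<open>abs_ft \<le> 1\<close> bounds the fourth power by the power \<open>2 / \<theta>\<close>. For \<open>\<theta> < 1/2\<close> the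
  fourth power lies between the powers \<open>0\<close> and \<open>2 / \<theta>\<close>, and one interpolates with weight \<open>2 \<theta>\<close> on the latter.
  On the Gaussian scale \<open>\<tau>\<close> the weight \<open>(1 + |w|) powr (- \<kappa>)\<close> is worth \<open>\<tau> powr (- \<kappa>)\<close>.
\<close>
lemma abs_ft_fourth_moment_le:
  fixes B \<kappa> s \<theta> h \<tau> :: real
  assumes \<theta>: "0 < \<theta>" and \<kappa>: "\<kappa> = CARD('n) - s / \<theta>" "\<kappa> \<ge> 0"
    and B: "B = (if \<theta> < 1/2 then 2 * s else s / \<theta>)"
    and h: "h \<ge> 0" "(\<integral>\<^sup>+ w. ennreal (abs_ft w powr (2 / \<theta>) * (1 + norm w) powr (- \<kappa>)) \<partial>lborel) = ennreal h"
    and \<tau>: "\<tau> \<ge> 1"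
  shows "(\<integral>\<^sup>+ w. ennreal (exp (- pi * (norm w)\<^sup>2 / \<tau>\<^sup>2) * abs_ft w ^ 4) \<partial>lborel)
     \<le> ennreal ((exp (\<kappa>\<^sup>2 / 2) * h + 2) * \<tau> powr (CARD('n) - B))"
proof -
  define d :: real where "d = CARD('n)"
  define K where "K = exp (\<kappa>\<^sup>2 / 2)"
  let ?e = "\<lambda>w::real ^ 'n. exp (- pi * (norm w)\<^sup>2 / \<tau>\<^sup>2)"
  let ?f = "\<lambda>w::real ^ 'n. abs_ft w powr (2 / \<theta>) * (1 + norm w) powr (- \<kappa>)"
  have K: "K > 0" by (simp add: K_def)
  have F4: "abs_ft w ^ 4 = abs_ft w powr 4" for w
    by (cases "abs_ft w = 0") (simp_all add: powr_numeral)
  have weight: "?e w \<le> K * \<tau> powr \<kappa> * (1 + norm w) powr (- \<kappa>)" for w :: "real ^ 'n"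
  proof -
    define x where "x = norm w / \<tau>"
    have x: "x \<ge> 0" using \<tau> by (simp add: x_def)
    have w1: "1 + norm w > 0" using norm_ge_zero[of w] by linarith
    have "1 + norm w \<le> \<tau> * (1 + x)" using \<tau> by (simp add: x_def distrib_left)
    then have "(1 + norm w) powr \<kappa> \<le> (\<tau> * (1 + x)) powr \<kappa>" using \<kappa>(2) by (intro powr_mono2) auto
    also have "\<dots> = \<tau> powr \<kappa> * (1 + x) powr \<kappa>" by (rule powr_mult)
    finally have "exp (- pi * x\<^sup>2) * (1 + norm w) powr \<kappa> \<le> exp (- pi * x\<^sup>2) * (\<tau> powr \<kappa> * (1 + x) powr \<kappa>)"
      by (intro mult_left_mono) auto
    also have "\<dots> = \<tau> powr \<kappa> * (exp (- pi * x\<^sup>2) * (1 + x) powr \<kappa>)" by simp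
    also have "\<dots> \<le> \<tau> powr \<kappa> * (K * exp (- pi * x\<^sup>2 / 2))"
      unfolding K_def by (intro mult_left_mono gaussian_powr_le x \<kappa>(2)) auto
    also have "\<dots> \<le> \<tau> powr \<kappa> * (K * 1)" using K by (intro mult_left_mono) auto
    finally have "exp (- pi * x\<^sup>2) * (1 + norm w) powr \<kappa> \<le> K * \<tau> powr \<kappa>" by (simp add: mult.commute)
    moreover have "- pi * x\<^sup>2 = - pi * (norm w)\<^sup>2 / \<tau>\<^sup>2" by (simp add: x_def power_divide)
    ultimately have "?e w * (1 + norm w) powr \<kappa> \<le> K * \<tau> powr \<kappa>" by simp
    then show ?thesis using w1 by (simp add: powr_minus field_simps)
  qed
  have pt: "?e w * abs_ft w ^ 4 \<le> \<tau> powr (d - B) * (K * ?f w + 2 * (\<tau> powr (- d) * ?e w))" for w :: "real ^ 'n"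
  proof (cases "\<theta> < 1/2")
    case False
    have "abs_ft w powr 4 \<le> abs_ft w powr (2 / \<theta>)"
    proof (cases "abs_ft w = 0")
      case nz: False
      have "2 / \<theta> \<le> 4" using False \<theta> by (simp add: field_simps)
      then show ?thesis using abs_ft_le_1[of w] by (intro powr_mono') auto
    qed simp
    then have "?e w * abs_ft w ^ 4 \<le> (K * \<tau> powr \<kappa> * (1 + norm w) powr (- \<kappa>)) * abs_ft w powr (2 / \<theta>)"
      unfolding F4 by (intro mult_mono weight) (use K in auto)
    also have "\<dots> = \<tau> powr (d - B) * (K * ?f w)" using False by (simp add: d_def \<kappa>(1) B)
    also have "\<dots> \<le> \<tau> powr (d - B) * (K * ?f w + 2 * (\<tau> powr (- d) * ?e w))"
      by (intro mult_left_mono) auto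
    finally show ?thesis .
  next
    case True
    define X where "X = abs_ft w powr (2 / \<theta>) * \<tau> powr (- \<kappa>)"
    have \<tau>0: "\<tau> > 0" using \<tau> by simp
    have "X powr (2 * \<theta>) * (\<tau> powr (- d)) powr (1 - 2 * \<theta>) * (\<tau> powr (- d)) powr 0 \<le> X + \<tau> powr (- d) + \<tau> powr (- d)"
      by (rule powr_mult_le_sum) (use True \<theta> in \<open>auto simp: X_def\<close>)
    moreover have "X powr (2 * \<theta>) * (\<tau> powr (- d)) powr (1 - 2 * \<theta>) * (\<tau> powr (- d)) powr 0 = abs_ft w ^ 4 * \<tau> powr (- (d - B))"
    proof -
      have "X powr (2 * \<theta>) = abs_ft w powr 4 * \<tau> powr (- \<kappa> * (2 * \<theta>))"
        unfolding X_def using \<theta> by (simp add: powr_mult powr_powr)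
      moreover have "- \<kappa> * (2 * \<theta>) + - d * (1 - 2 * \<theta>) = - (d - B)"
        using True \<theta> by (simp add: \<kappa>(1) B d_def field_simps)
      ultimately show ?thesis
        unfolding F4 using \<tau>0 by (simp add: powr_powr mult.assoc powr_add[symmetric])
    qed
    ultimately have "abs_ft w ^ 4 * \<tau> powr (- (d - B)) \<le> X + 2 * \<tau> powr (- d)" by simp
    then have "\<tau> powr (d - B) * (abs_ft w ^ 4 * \<tau> powr (- (d - B))) \<le> \<tau> powr (d - B) * (X + 2 * \<tau> powr (- d))"
      by (intro mult_left_mono) auto
    moreover have "\<tau> powr (d - B) * (abs_ft w ^ 4 * \<tau> powr (- (d - B))) = abs_ft w ^ 4"
    proof -
      have one: "\<tau> powr (d - B) * \<tau> powr (- (d - B)) = 1" using \<tau>0 by (simp flip: powr_add)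
      show ?thesis unfolding mult.left_commute[of "\<tau> powr (d - B)"] one by simp
    qed
    ultimately have "abs_ft w ^ 4 \<le> \<tau> powr (d - B) * (X + 2 * \<tau> powr (- d))" by (simp only:)
    then have "?e w * abs_ft w ^ 4 \<le> ?e w * (\<tau> powr (d - B) * (X + 2 * \<tau> powr (- d)))"
      by (intro mult_left_mono) auto
    also have "\<dots> = \<tau> powr (d - B) * (?e w * X + 2 * (\<tau> powr (- d) * ?e w))" by (simp add: algebra_simps)
    also have "\<dots> \<le> \<tau> powr (d - B) * (K * ?f w + 2 * (\<tau> powr (- d) * ?e w))"
    proof (intro mult_left_mono add_right_mono)
      have "?e w * X \<le> (K * \<tau> powr \<kappa> * (1 + norm w) powr (- \<kappa>)) * X"
        by (intro mult_right_mono weight) (simp add: X_def)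
      also have "\<dots> = K * ?f w * (\<tau> powr \<kappa> * \<tau> powr (- \<kappa>))" by (simp add: X_def)
      also have "\<tau> powr \<kappa> * \<tau> powr (- \<kappa>) = 1" using \<tau>0 by (simp flip: powr_add)
      finally show "?e w * X \<le> K * ?f w" by simp
    qed auto
    finally show ?thesis .
  qed
  have "(\<integral>\<^sup>+ w. ennreal (?e w * abs_ft w ^ 4) \<partial>lborel)
    \<le> (\<integral>\<^sup>+ w. ennreal (\<tau> powr (d - B)) * (ennreal K * ennreal (?f w) + ennreal (2 * \<tau> powr (- d)) * ennreal (?e w)) \<partial>lborel)"
  proof (rule nn_integral_mono)
    fix w :: "real ^ 'n"
    have "ennreal (\<tau> powr (d - B)) * (ennreal K * ennreal (?f w) + ennreal (2 * \<tau> powr (- d)) * ennreal (?e w))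
      = ennreal (\<tau> powr (d - B) * (K * ?f w + 2 * (\<tau> powr (- d) * ?e w)))"
      using K by (simp add: ennreal_mult[symmetric] ennreal_plus[symmetric] mult.assoc del: ennreal_plus)
    then show "ennreal (?e w * abs_ft w ^ 4) \<le> ennreal (\<tau> powr (d - B)) * (ennreal K * ennreal (?f w) + ennreal (2 * \<tau> powr (- d)) * ennreal (?e w))"
      using pt[of w] by (simp only: ennreal_leI)
  qed
  also have "\<dots> = ennreal (\<tau> powr (d - B)) * (ennreal K * (\<integral>\<^sup>+ w. ennreal (?f w) \<partial>lborel) + ennreal (2 * \<tau> powr (- d)) * (\<integral>\<^sup>+ w. ennreal (?e w) \<partial>lborel))"
    by (subst nn_integral_cmult, measurable, subst nn_integral_add, measurable, subst nn_integral_cmult, measurable, subst nn_integral_cmult) auto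
  also have "\<dots> = ennreal (\<tau> powr (d - B)) * (ennreal K * ennreal h + ennreal (2 * \<tau> powr (- d)) * ennreal (\<tau> ^ CARD('n)))"
    unfolding h(2) using nn_integral_gaussian[of \<tau>, where 'a="real ^ 'n"] \<tau> by simp
  also have "\<dots> = ennreal (\<tau> powr (d - B) * (K * h + 2 * (\<tau> powr (- d) * \<tau> ^ CARD('n))))"
    using K h(1) \<tau> by (simp add: ennreal_mult[symmetric] ennreal_plus[symmetric] mult.assoc del: ennreal_plus)
  also have "\<tau> powr (- d) * \<tau> ^ CARD('n) = 1"
    using \<tau> by (simp add: d_def powr_minus powr_realpow)
  finally show ?thesis by (simp add: K_def d_def mult.commute)
qed

text \<open>
  With \<open>T = |t|\<close>, the functions \<open>abs_ft powr (2/\<theta>) * T powr (- \<kappa>)\<close>, \<open>(chord_density t)\<^sup>2 * T powr B\<close> and \<open>chord_density t\<close>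
  all have integral \<open>O(1)\<close> over the ball of radius \<open>O(T)\<close>. Their geometric mean with weights \<open>\<theta>/2\<close>, \<open>\<theta>/2\<close>
  and \<open>1 - \<theta>\<close> is \<open>abs_ft * chord_density t * T powr c\<close>, so the integral of \<open>abs_ft * chord_density t\<close> over this ball is
  \<open>O(T powr (- c))\<close>. Outside the ball \<open>abs_ft \<le> 1\<close> and the tail bound suffice, as \<open>c \<le> 1\<close>.
\<close>
lemma chord_average_decay_if_weighted_Lp:
  fixes B \<kappa> s \<theta> c :: real
  assumes \<theta>: "0 < \<theta>" "\<theta> \<le> 1" and s: "s > 0" and \<kappa>: "\<kappa> = CARD('n) - s / \<theta>" "\<kappa> \<ge> 0"
    and B: "B = (if \<theta> < 1/2 then 2 * s else s / \<theta>)"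
    and c: "c = \<theta> * (B - \<kappa>) / 2" "0 \<le> c" "c \<le> 1"
    and fin: "(\<integral>\<^sup>+ w. ennreal (abs_ft w powr (2 / \<theta>) * (1 + norm w) powr (- \<kappa>)) \<partial>lborel) < \<top>"
  shows "\<exists>C\<ge>0. \<forall>t. chord_average t \<le> ennreal (C * (1 + \<bar>t\<bar>) powr (- c))"
proof -
  define L where "L = 4 * R + 1"
  have L: "L \<ge> 1" using R_nonneg by (simp add: L_def)
  obtain h where h: "h \<ge> 0" "(\<integral>\<^sup>+ w. ennreal (abs_ft w powr (2 / \<theta>) * (1 + norm w) powr (- \<kappa>)) \<partial>lborel) = ennreal h"
    using fin by (cases "\<integral>\<^sup>+ w. ennreal (abs_ft w powr (2 / \<theta>) * (1 + norm w) powr (- \<kappa>)) \<partial>lborel") auto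
  define Y where "Y = exp (\<kappa>\<^sup>2 / 2) * h + 2"
  have Y: "Y \<ge> 0" using h by (simp add: Y_def)
  have B0: "B \<ge> 0" using s \<theta> by (simp add: B)
  let ?f = "\<lambda>w::real ^ 'n. abs_ft w powr (2 / \<theta>) * (1 + norm w) powr (- \<kappa>)"
  define D where "D = ((L + 1) powr \<kappa> * h + Y + 1) + sqrt 2 ^ CARD('n)"
  show ?thesis
  proof (rule chord_average_decay_if_large)
    show "0 \<le> D" using h Y by (simp add: D_def)
    show "0 \<le> c" by (rule c(2))
    fix t :: real assume t: "\<bar>t\<bar> \<ge> 1"
    define T where "T = \<bar>t\<bar>"
    have T: "T \<ge> 1" "T > 0" using t by (auto simp: T_def)
    define \<tau> where "\<tau> = sqrt 2 * T"
    have \<tau>: "\<tau> \<ge> T" "\<tau> \<ge> 1" "\<tau> > 0"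
    proof -
      show "\<tau> \<ge> T" using T mult_right_mono[of 1 "sqrt 2" T] by (simp add: \<tau>_def)
      then show "\<tau> \<ge> 1" "\<tau> > 0" using T by auto
    qed
    have sq: "(\<integral>\<^sup>+ z. ennreal ((chord_density t z)\<^sup>2) \<partial>lborel) \<le> ennreal (Y * T powr (- B))"
    proof -
      have "(\<integral>\<^sup>+ z. ennreal ((chord_density t z)\<^sup>2) \<partial>lborel)
        \<le> ennreal (1 / \<tau> ^ CARD('n)) * (\<integral>\<^sup>+ w. ennreal (exp (- pi * (norm w)\<^sup>2 / \<tau>\<^sup>2) * abs_ft w ^ 4) \<partial>lborel)"
        by (rule nn_integral_chord_density_squared_le[OF t]) (simp add: \<tau>_def T_def)
      also have "\<dots> \<le> ennreal (1 / \<tau> ^ CARD('n)) * ennreal (Y * \<tau> powr (CARD('n) - B))"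
        unfolding Y_def by (intro mult_left_mono abs_ft_fourth_moment_le[OF \<theta>(1) \<kappa> B h \<tau>(2)]) simp
      also have "\<dots> = ennreal (Y * \<tau> powr (- B))"
      proof -
        have "\<tau> powr (CARD('n) - B) = \<tau> ^ CARD('n) * \<tau> powr (- B)"
          using \<tau> by (simp add: powr_diff powr_minus powr_realpow divide_inverse)
        then show ?thesis using \<tau> Y by (simp add: ennreal_mult[symmetric])
      qed
      also have "\<dots> \<le> ennreal (Y * T powr (- B))"
        using Y \<tau> T B0 by (intro ennreal_leI mult_left_mono powr_mono2') auto
      finally show ?thesis .
    qed
    let ?I = "\<lambda>z::real ^ 'n. indicator {z. norm z > (4 * R + 1) * \<bar>t\<bar>} z :: ennreal"
    have pt: "ennreal (abs_ft z * chord_density t z) \<le> ennreal (T powr (- c)) * (ennreal ((L + 1) powr \<kappa>) * ennreal (?f z) + ennreal (T powr B) * ennreal ((chord_density t z)\<^sup>2) + ennreal (chord_density t z))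
        + ennreal (chord_density t z) * ?I z" for z
    proof (cases "norm z > L * T")
      case True
      have "abs_ft z * chord_density t z \<le> 1 * chord_density t z" by (intro mult_right_mono abs_ft_le_1 chord_density_nonneg)
      then have "ennreal (abs_ft z * chord_density t z) \<le> ennreal (chord_density t z) * ?I z"
        using True by (simp add: L_def T_def ennreal_leI)
      then show ?thesis by (rule order_trans) simp
    next
      case False
      define X where "X = abs_ft z powr (2 / \<theta>) * T powr (- \<kappa>)"
      have "X powr (\<theta> / 2) * ((chord_density t z)\<^sup>2 * T powr B) powr (\<theta> / 2) * chord_density t z powr (1 - \<theta>) \<le> X + (chord_density t z)\<^sup>2 * T powr B + chord_density t z"
        by (rule powr_mult_le_sum) (use \<theta> chord_density_nonneg[of t z] in \<open>auto simp: X_def\<close>)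
      moreover have "X powr (\<theta> / 2) * ((chord_density t z)\<^sup>2 * T powr B) powr (\<theta> / 2) * chord_density t z powr (1 - \<theta>) = abs_ft z * chord_density t z * T powr c"
      proof -
        have r2: "(chord_density t z)\<^sup>2 = chord_density t z powr 2"
          using chord_density_nonneg[of t z] by (cases "chord_density t z = 0") (auto simp: powr_numeral)
        have e1: "X powr (\<theta> / 2) = abs_ft z * T powr (- \<kappa> * (\<theta> / 2))"
          unfolding X_def using \<theta> by (simp add: powr_mult powr_powr)
        have e2: "((chord_density t z)\<^sup>2 * T powr B) powr (\<theta> / 2) = chord_density t z powr \<theta> * T powr (B * (\<theta> / 2))"
          unfolding r2 by (simp add: powr_mult powr_powr)
        have e3: "chord_density t z powr \<theta> * chord_density t z powr (1 - \<theta>) = chord_density t z"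
          using chord_density_nonneg[of t z] by (simp flip: powr_add)
        have e4: "T powr (- \<kappa> * (\<theta> / 2)) * T powr (B * (\<theta> / 2)) = T powr c"
        proof -
          have "- \<kappa> * (\<theta> / 2) + B * (\<theta> / 2) = c" unfolding c(1) by (simp add: field_simps)
          then show ?thesis unfolding powr_add[symmetric] by (rule arg_cong)
        qed
        have "X powr (\<theta> / 2) * ((chord_density t z)\<^sup>2 * T powr B) powr (\<theta> / 2) * chord_density t z powr (1 - \<theta>)
            = abs_ft z * (chord_density t z powr \<theta> * chord_density t z powr (1 - \<theta>)) * (T powr (- \<kappa> * (\<theta> / 2)) * T powr (B * (\<theta> / 2)))"
          unfolding e1 e2 by (simp only: mult_ac)
        then show ?thesis unfolding e3 e4 .
      qed
      ultimately have "abs_ft z * chord_density t z * T powr c \<le> X + (chord_density t z)\<^sup>2 * T powr B + chord_density t z" by simp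
      moreover have "X \<le> (L + 1) powr \<kappa> * ?f z"
      proof -
        have z1: "1 + norm z > 0" using norm_ge_zero[of z] by linarith
        have "1 + norm z \<le> (L + 1) * T" using False T by (simp add: algebra_simps)
        then have "((L + 1) * T) powr (- \<kappa>) \<le> (1 + norm z) powr (- \<kappa>)"
          using \<kappa>(2) z1 by (intro powr_mono2') auto
        then have "(L + 1) powr \<kappa> * ((L + 1) powr (- \<kappa>) * T powr (- \<kappa>)) \<le> (L + 1) powr \<kappa> * (1 + norm z) powr (- \<kappa>)"
          unfolding powr_mult by (intro mult_left_mono) auto
        moreover have "(L + 1) powr \<kappa> * (L + 1) powr (- \<kappa>) = 1" using L by (simp flip: powr_add)
        ultimately have "T powr (- \<kappa>) \<le> (L + 1) powr \<kappa> * (1 + norm z) powr (- \<kappa>)"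
          by (simp add: mult.assoc[symmetric])
        then have "abs_ft z powr (2 / \<theta>) * T powr (- \<kappa>) \<le> abs_ft z powr (2 / \<theta>) * ((L + 1) powr \<kappa> * (1 + norm z) powr (- \<kappa>))"
          by (intro mult_left_mono) auto
        then show ?thesis by (simp add: X_def mult.left_commute)
      qed
      ultimately have "abs_ft z * chord_density t z * T powr c \<le> (L + 1) powr \<kappa> * ?f z + T powr B * (chord_density t z)\<^sup>2 + chord_density t z"
        by (simp add: mult.commute)
      then have "T powr (- c) * (abs_ft z * chord_density t z * T powr c) \<le> T powr (- c) * ((L + 1) powr \<kappa> * ?f z + T powr B * (chord_density t z)\<^sup>2 + chord_density t z)"
        by (intro mult_left_mono) auto
      moreover have "T powr (- c) * T powr c = 1" using T by (simp flip: powr_add)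
      then have "T powr (- c) * (abs_ft z * chord_density t z * T powr c) = abs_ft z * chord_density t z" by (simp add: mult.left_commute)
      ultimately have "ennreal (abs_ft z * chord_density t z) \<le> ennreal (T powr (- c) * ((L + 1) powr \<kappa> * ?f z + T powr B * (chord_density t z)\<^sup>2 + chord_density t z))"
        by (intro ennreal_leI) simp
      also have "\<dots> = ennreal (T powr (- c)) * (ennreal ((L + 1) powr \<kappa>) * ennreal (?f z) + ennreal (T powr B) * ennreal ((chord_density t z)\<^sup>2) + ennreal (chord_density t z))"
        using chord_density_nonneg[of t z] by (simp add: ennreal_mult[symmetric] ennreal_plus[symmetric] del: ennreal_plus)
      finally show ?thesis by (rule order_trans) simp
    qed
    have "chord_average t \<le> (\<integral>\<^sup>+ z. ennreal (abs_ft z * chord_density t z) \<partial>lborel)" by (rule chord_average_le_chord_integral)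
    also have "\<dots> \<le> (\<integral>\<^sup>+ z. ennreal (T powr (- c)) * (ennreal ((L + 1) powr \<kappa>) * ennreal (?f z) + ennreal (T powr B) * ennreal ((chord_density t z)\<^sup>2) + ennreal (chord_density t z))
        + ennreal (chord_density t z) * ?I z \<partial>lborel)"
      by (intro nn_integral_mono pt)
    also have "\<dots> = ennreal (T powr (- c)) * (ennreal ((L + 1) powr \<kappa>) * ennreal h + ennreal (T powr B) * (\<integral>\<^sup>+ z. ennreal ((chord_density t z)\<^sup>2) \<partial>lborel) + 1)
        + (\<integral>\<^sup>+ z. ennreal (chord_density t z) * ?I z \<partial>lborel)"
      unfolding h(2)[symmetric] nn_integral_chord_density[of t, symmetric]
      by (simp add: nn_integral_add nn_integral_cmult)
    also have "\<dots> \<le> ennreal (T powr (- c)) * (ennreal ((L + 1) powr \<kappa>) * ennreal h + ennreal (T powr B) * ennreal (Y * T powr (- B)) + 1)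
        + ennreal (sqrt 2 ^ CARD('n) * T powr (- 1))"
      using chord_density_tail[OF t] by (intro add_mono mult_left_mono sq) (simp_all add: T_def)
    also have "\<dots> = ennreal (T powr (- c) * ((L + 1) powr \<kappa> * h + Y + 1) + sqrt 2 ^ CARD('n) * T powr (- 1))"
    proof -
      have "T powr B * (Y * T powr (- B)) = Y * (T powr B * T powr (- B))" by simp
      also have "\<dots> = Y" using T by (simp flip: powr_add)
      finally have TB: "T powr B * (Y * T powr (- B)) = Y" .
      have e1: "ennreal (T powr B) * ennreal (Y * T powr (- B)) = ennreal Y"
        using Y by (subst ennreal_mult[symmetric]) (use TB in auto)
      have e2: "ennreal ((L + 1) powr \<kappa>) * ennreal h + ennreal Y + 1 = ennreal ((L + 1) powr \<kappa> * h + Y + 1)"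
        using h(1) Y by (simp add: ennreal_mult)
      show ?thesis
        unfolding e1 e2 using h(1) Y T by (simp add: ennreal_mult[symmetric] ennreal_plus[symmetric] del: ennreal_plus)
    qed
    also have "\<dots> \<le> ennreal (D * T powr (- c))"
    proof (rule ennreal_leI)
      have "T powr (- 1) \<le> T powr (- c)" using T c(3) by (intro powr_mono) auto
      then have "sqrt 2 ^ CARD('n) * T powr (- 1) \<le> sqrt 2 ^ CARD('n) * T powr (- c)"
        by (intro mult_left_mono) auto
      then show "T powr (- c) * ((L + 1) powr \<kappa> * h + Y + 1) + sqrt 2 ^ CARD('n) * T powr (- 1) \<le> D * T powr (- c)"
        by (simp add: D_def algebra_simps)
    qed
    finally show "chord_average t \<le> ennreal (D * \<bar>t\<bar> powr (- c))" by (simp add: T_def)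
  qed
qed

end

section \<open>The spectrum threshold\<close>

text \<open>
  Case \<open>decay\<close> is the first piece of the threshold, together with the corner \<open>\<theta> = 0\<close>, \<open>d = 4\<close>, where that piece is empty
  and the constant \<open>sqrt 4\<close> coincides with \<open>2 + d \<theta>\<close>. In case \<open>Lp\<close> the exponent \<open>\<theta>'\<close> is the larger of \<open>\<theta>\<close> and
  \<open>1 / sqrt d\<close>; the constant piece is the value of the third formula (of the fourth one if \<open>d = 4\<close>) at \<open>1 / sqrt d\<close>.
\<close>
lemma spectrum_threshold_cases:
  fixes d :: nat and \<theta> :: real
  assumes d: "d \<ge> 4" and \<theta>: "0 \<le> \<theta>" "\<theta> \<le> 1"
  obtains (decay) "spectrum_threshold d \<theta> = 2 + d * \<theta>"
  | (Lp) \<theta>' :: real where "0 < \<theta>" "\<theta> \<le> \<theta>'" "\<theta>' \<le> 1" "1 \<le> d * \<theta>'\<^sup>2"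
      "spectrum_threshold d \<theta> = (if \<theta>' < 1/2 then (2 + d * \<theta>') / (1 + 2 * \<theta>') else 1 + d * \<theta>' / 2)"
proof -
  define r where "r = sqrt d"
  have d4: "real d \<ge> 2\<^sup>2" using d by simp
  have "2 \<le> r" unfolding r_def by (rule real_le_rsqrt[OF d4])
  moreover have "r\<^sup>2 = real d" unfolding r_def by (rule real_sqrt_pow2) simp
  ultimately have r: "r \<ge> 2" "r\<^sup>2 = d" by blast+
  then have rr: "real d = r * r" by (simp add: power2_eq_square)
  have dr: "d powr (- 1 / 2) = 1 / r"
  proof -
    have "real d powr (1 / 2) = r" unfolding r_def by (rule powr_half_sqrt) simp
    then have "real d powr (- (1 / 2)) = inverse r" unfolding powr_minus by simp
    then show ?thesis by (simp add: inverse_eq_divide)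
  qed
  consider "\<theta> < (r - 2) / d" | "(r - 2) / d \<le> \<theta>" "\<theta> < 1 / r" "\<theta> = 0" | "(r - 2) / d \<le> \<theta>" "\<theta> < 1 / r" "\<theta> > 0"
    | "(r - 2) / d \<le> \<theta>" "1 / r \<le> \<theta>" using \<theta> by linarith
  then show ?thesis
  proof cases
    case 1
    then show ?thesis by (intro decay) (simp add: spectrum_threshold_def r_def)
  next
    case 2
    then have "r = 2" using r d by (simp add: field_simps)
    then show ?thesis using 2 dr by (intro decay) (simp add: spectrum_threshold_def r_def)
  next
    case 3
    have T: "spectrum_threshold d \<theta> = r" using 3 dr by (simp add: spectrum_threshold_def r_def)
    show ?thesis
    proof (rule Lp[of "1 / r"])
      show "0 < \<theta>" "\<theta> \<le> 1 / r" using 3 by auto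
      show "1 / r \<le> 1" using r by simp
      show "1 \<le> real d * (1 / r)\<^sup>2" using r by (simp add: rr power2_eq_square)
      show "spectrum_threshold d \<theta> = (if 1 / r < 1/2 then (2 + d * (1 / r)) / (1 + 2 * (1 / r)) else 1 + d * (1 / r) / 2)"
      proof (cases "r = 2")
        case True then show ?thesis by (simp add: T rr)
      next
        case False
        then have "r > 2" using r by simp
        then have "1 / r < 1 / 2" by (simp add: field_simps)
        moreover have "(2 + d * (1 / r)) / (1 + 2 * (1 / r)) = r"
          using \<open>r > 2\<close> by (simp add: rr field_simps)
        ultimately show ?thesis by (simp add: T)
      qed
    qed
  next
    case 4
    have "r > 0" using r by simp
    show ?thesis
    proof (rule Lp[of \<theta>])
      show pos: "0 < \<theta>" using 4 \<open>r > 0\<close> by (smt (verit) zero_less_divide_1_iff)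
      have "1 \<le> r * \<theta>" using 4 \<open>r > 0\<close> by (simp add: field_simps)
      then have "1 * 1 \<le> (r * \<theta>) * (r * \<theta>)" by (intro mult_mono) auto
      then show "1 \<le> real d * \<theta>\<^sup>2" by (simp add: rr power2_eq_square mult_ac)
      show "spectrum_threshold d \<theta> = (if \<theta> < 1/2 then (2 + d * \<theta>) / (1 + 2 * \<theta>) else 1 + d * \<theta> / 2)"
        using 4 dr by (simp add: spectrum_threshold_def r_def)
    qed (use \<theta> in auto)
  qed
qed

lemma fourier_energy_finite_below_spectrum:
  assumes "ennreal T \<le> fourier_spectrum \<theta> \<mu>" "0 \<le> u" "u < T"
  obtains s where "u < s" "fourier_energy s \<theta> \<mu> < \<top>"
proof -
  have "ennreal u < fourier_spectrum \<theta> \<mu>"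
    using assms by (intro less_le_trans[OF _ assms(1)]) (simp add: ennreal_less_iff)
  then obtain s where "0 \<le> s" "fourier_energy s \<theta> \<mu> < \<top>" "ennreal u < ennreal s"
    unfolding fourier_spectrum_def less_Sup_iff by auto
  then show ?thesis using that assms(2) by (auto simp: ennreal_less_iff)
qed

lemma fourier_energy_finite_iff:
  fixes \<mu> :: "(real ^ 'n) measure"
  assumes "\<theta> > 0"
  shows "fourier_energy s \<theta> \<mu> < \<top> \<longleftrightarrow>
    (\<integral>\<^sup>+ z. ennreal (cmod (fourier_transform \<mu> z) powr (2 / \<theta>) * norm z powr (s / \<theta> - real CARD('n))) \<partial>lborel) < \<top>"
  using assms by (simp add: fourier_energy_def ennreal_powr_def less_top)

context bounded_prob
begin

text \<open>
  Put \<open>x = |abs_ft w|\<^sup>2 |w| powr s\<close>. Away from the origin the energy is the integral of \<open>x powr (1/\<theta>)\<close> against \<open>dw / |w| powr d\<close>. That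
  measure is infinite, but only logarithmically: lowering \<open>s\<close> provides a factor \<open>|w| powr (- \<epsilon>)\<close> that makes it finite,
  and \<open>x powr (1/\<theta>') \<le> 1 + x powr (1/\<theta>)\<close> then allows any larger \<open>\<theta>'\<close>. The weight \<open>1 + |w|\<close> in place of \<open>|w|\<close> avoids the
  singularity at the origin.
\<close>
lemma weighted_Lp_if_energy:
  assumes \<theta>: "0 < \<theta>" "\<theta> \<le> \<theta>'" and s: "s' < s" and \<kappa>: "\<kappa> = CARD('n) - s' / \<theta>'" "\<kappa> \<ge> 0"
    and fin: "(\<integral>\<^sup>+ w. ennreal (abs_ft w powr (2 / \<theta>) * norm w powr (s / \<theta> - CARD('n))) \<partial>lborel) < \<top>"
  shows "(\<integral>\<^sup>+ w. ennreal (abs_ft w powr (2 / \<theta>') * (1 + norm w) powr (- \<kappa>)) \<partial>lborel) < \<top>"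
proof -
  define d :: real where "d = CARD('n)"
  define \<epsilon> where "\<epsilon> = (s - s') / \<theta>'"
  have \<theta>': "\<theta>' > 0" using \<theta> by simp
  have \<epsilon>: "\<epsilon> > 0" using s \<theta>' by (simp add: \<epsilon>_def)
  have d0: "d \<ge> 0" by (simp add: d_def)
  define G where "G w = (1 + norm w) powr (- (d + \<epsilon>))" for w :: "real ^ 'n"
  have [measurable]: "G \<in> borel_measurable borel" unfolding G_def[abs_def] by measurable
  have pt: "abs_ft w powr (2 / \<theta>') * (1 + norm w) powr (- \<kappa>) \<le> 2 powr (d + \<epsilon>) * G w + abs_ft w powr (2 / \<theta>) * norm w powr (s / \<theta> - d)" for w
  proof (cases "norm w \<ge> 1")
    case True
    have w1: "1 + norm w > 0" using True by linarith
    define x where "x = abs_ft w powr 2 * norm w powr s"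
    have x0: "x \<ge> 0" by (simp add: x_def)
    have px: "x powr (1 / p) = abs_ft w powr (2 / p) * norm w powr (s / p)" if "p > 0" for p
      unfolding x_def powr_mult powr_powr by simp
    have "x powr (1 / \<theta>') \<le> 1 + x powr (1 / \<theta>)"
    proof (cases "x \<le> 1")
      case True
      then have "x powr (1 / \<theta>') \<le> 1" using \<theta>' x0 by (intro powr_le1) auto
      then show ?thesis by (simp add: add_increasing2)
    next
      case False
      then have "x powr (1 / \<theta>') \<le> x powr (1 / \<theta>)" using \<theta> by (intro powr_mono) (auto simp: field_simps)
      then show ?thesis by simp
    qed
    then have "x powr (1 / \<theta>') * norm w powr (- (d + \<epsilon>)) \<le> (1 + x powr (1 / \<theta>)) * norm w powr (- (d + \<epsilon>))"
      by (intro mult_right_mono) auto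
    also have "\<dots> = norm w powr (- (d + \<epsilon>)) + x powr (1 / \<theta>) * norm w powr (- (d + \<epsilon>))" by (simp add: algebra_simps)
    also have "\<dots> \<le> 2 powr (d + \<epsilon>) * G w + x powr (1 / \<theta>) * norm w powr (- d)"
    proof (intro add_mono mult_left_mono)
      have "(2 * norm w) powr (- (d + \<epsilon>)) \<le> G w"
        unfolding G_def using True d0 \<epsilon> w1 by (intro powr_mono2') auto
      then have "2 powr (d + \<epsilon>) * (2 powr (- (d + \<epsilon>)) * norm w powr (- (d + \<epsilon>))) \<le> 2 powr (d + \<epsilon>) * G w"
        unfolding powr_mult by (intro mult_left_mono) auto
      moreover have "2 powr (d + \<epsilon>) * 2 powr (- (d + \<epsilon>)) = (1::real)" by (simp flip: powr_add)
      ultimately show "norm w powr (- (d + \<epsilon>)) \<le> 2 powr (d + \<epsilon>) * G w"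
        by (metis mult.assoc mult_1)
      show "norm w powr (- (d + \<epsilon>)) \<le> norm w powr (- d)" using True \<epsilon> by (intro powr_mono) auto
    qed auto
    also have "x powr (1 / \<theta>) * norm w powr (- d) = abs_ft w powr (2 / \<theta>) * norm w powr (s / \<theta> - d)"
      unfolding px[OF \<theta>(1)] by (simp add: powr_diff powr_minus divide_inverse)
    finally have "x powr (1 / \<theta>') * norm w powr (- (d + \<epsilon>)) \<le> 2 powr (d + \<epsilon>) * G w + abs_ft w powr (2 / \<theta>) * norm w powr (s / \<theta> - d)" .
    moreover have "x powr (1 / \<theta>') * norm w powr (- (d + \<epsilon>)) = abs_ft w powr (2 / \<theta>') * norm w powr (- \<kappa>)"
    proof -
      have "s / \<theta>' + - (d + \<epsilon>) = - \<kappa>" by (simp add: \<epsilon>_def \<kappa>(1) d_def diff_divide_distrib)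
      then show ?thesis unfolding px[OF \<theta>'] by (simp only: mult.assoc powr_add[symmetric])
    qed
    moreover have "abs_ft w powr (2 / \<theta>') * (1 + norm w) powr (- \<kappa>) \<le> abs_ft w powr (2 / \<theta>') * norm w powr (- \<kappa>)"
      using True \<kappa>(2) by (intro mult_left_mono powr_mono2') auto
    ultimately show ?thesis by linarith
  next
    case False
    have w1: "1 + norm w > 0" using norm_ge_zero[of w] by linarith
    have "abs_ft w powr (2 / \<theta>') * (1 + norm w) powr (- \<kappa>) \<le> 1 * 1"
    proof (intro mult_mono)
      show "abs_ft w powr (2 / \<theta>') \<le> 1" using abs_ft_le_1[of w] \<theta>' by (intro powr_le1) auto
      show "(1 + norm w) powr (- \<kappa>) \<le> 1" using \<kappa>(2) powr_mono[of "- \<kappa>" 0 "1 + norm w"] w1 by simp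
    qed auto
    also have "\<dots> \<le> 2 powr (d + \<epsilon>) * G w"
    proof -
      have "2 powr (- (d + \<epsilon>)) \<le> G w" unfolding G_def using False d0 \<epsilon> w1 by (intro powr_mono2') auto
      then have le: "2 powr (d + \<epsilon>) * 2 powr (- (d + \<epsilon>)) \<le> 2 powr (d + \<epsilon>) * G w" by (intro mult_left_mono) auto
      have one: "2 powr (d + \<epsilon>) * 2 powr (- (d + \<epsilon>)) = (1::real)" by (simp flip: powr_add)
      show ?thesis using le unfolding one by simp
    qed
    finally show ?thesis by (simp add: add_increasing2)
  qed
  have "(\<integral>\<^sup>+ w. ennreal (abs_ft w powr (2 / \<theta>') * (1 + norm w) powr (- \<kappa>)) \<partial>lborel)
    \<le> (\<integral>\<^sup>+ w. ennreal (2 powr (d + \<epsilon>)) * ennreal (G w) + ennreal (abs_ft w powr (2 / \<theta>) * norm w powr (s / \<theta> - d)) \<partial>lborel)"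
  proof (rule nn_integral_mono)
    fix w :: "real ^ 'n"
    have "G w \<ge> 0" by (simp add: G_def)
    then have "ennreal (2 powr (d + \<epsilon>)) * ennreal (G w) + ennreal (abs_ft w powr (2 / \<theta>) * norm w powr (s / \<theta> - d))
      = ennreal (2 powr (d + \<epsilon>) * G w + abs_ft w powr (2 / \<theta>) * norm w powr (s / \<theta> - d))"
      by (simp add: ennreal_mult[symmetric] ennreal_plus[symmetric] del: ennreal_plus)
    then show "ennreal (abs_ft w powr (2 / \<theta>') * (1 + norm w) powr (- \<kappa>)) \<le> ennreal (2 powr (d + \<epsilon>)) * ennreal (G w) + ennreal (abs_ft w powr (2 / \<theta>) * norm w powr (s / \<theta> - d))"
      using pt[of w] by (simp only: ennreal_leI)
  qed
  also have "\<dots> = ennreal (2 powr (d + \<epsilon>)) * (\<integral>\<^sup>+ w. ennreal (G w) \<partial>lborel) + (\<integral>\<^sup>+ w. ennreal (abs_ft w powr (2 / \<theta>) * norm w powr (s / \<theta> - d)) \<partial>lborel)"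
    by (subst nn_integral_add, measurable, subst nn_integral_cmult) auto
  also have "\<dots> < \<top>"
    using fin nn_integral_powr_finite[OF \<epsilon>, where 'a="real ^ 'n"]
    by (simp add: ennreal_mult_less_top G_def d_def)
  finally show ?thesis .
qed


text \<open>
  For \<open>\<theta> > 0\<close> the integrand of the energy is \<open>x powr (2/\<theta>)\<close> with \<open>x = abs_ft w * |w| powr ((s - d \<theta>) / 2)\<close>, and \<open>x \<le> 1 + x powr (2/\<theta>)\<close>
  because \<open>2 / \<theta> \<ge> 1\<close>.
\<close>
lemma windowed_ft_decay_if_energy:
  fixes a s \<theta> :: real
  assumes \<theta>: "0 \<le> \<theta>" "\<theta> \<le> 1" and a: "0 \<le> a" "2 * a + CARD('n) * \<theta> \<le> s"
    and fin: "fourier_energy s \<theta> \<mu> < \<top>"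
  shows "\<exists>C\<ge>0. \<forall>z. cmod (windowed_ft z) \<le> C * (1 + norm z) powr (- a)"
proof (cases "\<theta> = 0")
  case True
  define E where "E = fourier_energy s \<theta> \<mu>"
  have E: "ennreal ((abs_ft w)\<^sup>2 * norm w powr s) \<le> E" for w
    unfolding E_def fourier_energy_def using True by (auto intro: SUP_upper)
  have b: "(abs_ft w)\<^sup>2 * norm w powr s \<le> enn2real E" for w
  proof -
    have "ennreal ((abs_ft w)\<^sup>2 * norm w powr s) \<le> ennreal (enn2real E)"
      using E[of w] fin by (simp add: E_def)
    then show ?thesis by simp
  qed
  show ?thesis
  proof (rule windowed_ft_decay[where a = "s / 2" and K = "sqrt (enn2real E)" and G = "\<lambda>_. 0"])
    fix w :: "real ^ 'n" assume "norm w \<ge> 1"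
    have "(abs_ft w * norm w powr (s / 2))\<^sup>2 = (abs_ft w)\<^sup>2 * norm w powr s"
      unfolding power_mult_distrib by (simp add: power2_eq_square flip: powr_add)
    then have "abs_ft w * norm w powr (s / 2) \<le> sqrt (enn2real E)"
      using b[of w] by (intro real_le_rsqrt) simp
    then show "abs_ft w * norm w powr (s / 2) \<le> sqrt (enn2real E) + 0" by simp
  qed (use a True in auto)
next
  case False
  then have \<theta>0: "\<theta> > 0" using \<theta> by simp
  define b where "b = (s - CARD('n) * \<theta>) / 2"
  show ?thesis
  proof (rule windowed_ft_decay[where a = b and K = 1 and G = "\<lambda>w. abs_ft w powr (2 / \<theta>) * norm w powr (s / \<theta> - CARD('n))"])
    show "0 \<le> a" "a \<le> b" using a by (auto simp: b_def)
    show "(\<integral>\<^sup>+ w. ennreal (abs_ft w powr (2 / \<theta>) * norm w powr (s / \<theta> - CARD('n))) \<partial>lborel) < \<top>"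
      using fin by (simp only: fourier_energy_finite_iff[OF \<theta>0])
    fix w :: "real ^ 'n" assume "norm w \<ge> 1"
    define x where "x = abs_ft w * norm w powr b"
    have x0: "x \<ge> 0" by (simp add: x_def)
    have "x \<le> 1 + x powr (2 / \<theta>)"
    proof (cases "x \<le> 1")
      case False
      then have "x powr 1 \<le> x powr (2 / \<theta>)" using \<theta> \<theta>0 by (intro powr_mono) (auto simp: field_simps)
      then show ?thesis using False by simp
    qed (simp add: add_increasing2)
    moreover have "x powr (2 / \<theta>) = abs_ft w powr (2 / \<theta>) * norm w powr (s / \<theta> - CARD('n))"
    proof -
      have "b * (2 / \<theta>) = s / \<theta> - CARD('n)" using \<theta>0 by (simp add: b_def field_simps)
      then show ?thesis unfolding x_def powr_mult powr_powr by simp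
    qed
    ultimately show "abs_ft w * norm w powr b \<le> 1 + abs_ft w powr (2 / \<theta>) * norm w powr (s / \<theta> - CARD('n))"
      by (simp add: x_def)
  qed auto
qed

text \<open>
  The energy may be infinite at the threshold itself; working with \<open>s\<close> slightly below it costs an arbitrarily small
  part of the decay exponent \<open>1\<close>.
\<close>
lemma chord_average_decay_if_spectrum:
  fixes b \<theta> :: real
  assumes d: "CARD('n) \<ge> 4" and \<theta>: "0 \<le> \<theta>" "\<theta> \<le> 1"
    and spec: "ennreal (spectrum_threshold CARD('n) \<theta>) \<le> fourier_spectrum \<theta> \<mu>"
    and b: "0 < b" "b < 1"
  shows "\<exists>C\<ge>0. \<forall>t. chord_average t \<le> ennreal (C * (1 + \<bar>t\<bar>) powr (- b))"
  using d \<theta>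
proof (cases rule: spectrum_threshold_cases)
  case decay
  define a where "a = (1 + b) / 2"
  have a: "b < a" "a < 1" using b by (auto simp: a_def)
  have "0 \<le> CARD('n) * \<theta>" using \<theta> by simp
  then have "0 \<le> 2 * a + CARD('n) * \<theta>" "2 * a + CARD('n) * \<theta> < spectrum_threshold CARD('n) \<theta>"
    using a b unfolding decay by linarith+
  then obtain s where s: "2 * a + CARD('n) * \<theta> < s" "fourier_energy s \<theta> \<mu> < \<top>"
    using fourier_energy_finite_below_spectrum[OF spec] by blast
  then obtain C where "C \<ge> 0" "\<And>z. cmod (windowed_ft z) \<le> C * (1 + norm z) powr (- a)"
    using windowed_ft_decay_if_energy[OF \<theta>, of a s] a b by auto
  then show ?thesis using a b by (intro chord_average_decay_if_windowed_ft_decay[of b a]) auto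
next
  case (Lp \<theta>')
  define d where "d = real CARD('n)"
  define T where "T = spectrum_threshold CARD('n) \<theta>"
  define \<eta> where "\<eta> = 1 - b"
  define s where "s = T - \<eta>"
  have d4: "d \<ge> 4" using assms(1) by (simp add: d_def)
  have \<theta>': "0 < \<theta>'" using Lp by simp
  have T: "T = (if \<theta>' < 1/2 then (2 + d * \<theta>') / (1 + 2 * \<theta>') else 1 + d * \<theta>' / 2)"
    using Lp(5) by (simp add: T_def d_def)
  have T1: "T \<ge> 1"
  proof (cases "\<theta>' < 1/2")
    case True
    have "2 * \<theta>' \<le> d * \<theta>'" using d4 \<theta>' by (intro mult_right_mono) auto
    then have "1 + 2 * \<theta>' \<le> 2 + d * \<theta>'" by linarith
    then show ?thesis using True \<theta>' by (simp add: T le_divide_eq)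
  next
    case False
    then show ?thesis using d4 \<theta>' by (simp add: T)
  qed
  have T2: "T \<le> d * \<theta>'"
  proof (cases "\<theta>' < 1/2")
    case True
    have "d * \<theta>' * (1 + 2 * \<theta>') = d * \<theta>' + 2 * (d * \<theta>'\<^sup>2)" by (simp add: power2_eq_square algebra_simps)
    then have "2 + d * \<theta>' \<le> d * \<theta>' * (1 + 2 * \<theta>')" using Lp(4) by (simp add: d_def)
    then show ?thesis using True \<theta>' by (simp add: T divide_le_eq)
  next
    case False
    have "4 * (1/2) \<le> d * \<theta>'" using d4 False by (intro mult_mono) auto
    then show ?thesis using False by (simp add: T)
  qed
  have s0: "s > 0" "s < T" using T1 b by (auto simp: s_def \<eta>_def)
  obtain s1 where s1: "s < s1" "fourier_energy s1 \<theta> \<mu> < \<top>"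
    using fourier_energy_finite_below_spectrum[OF spec, of s] s0 by (auto simp: T_def)
  define \<kappa> where "\<kappa> = CARD('n) - s / \<theta>'"
  have \<kappa>: "\<kappa> \<ge> 0" using s0 T2 \<theta>' by (simp add: \<kappa>_def d_def divide_le_eq)
  have fin: "(\<integral>\<^sup>+ w. ennreal (abs_ft w powr (2 / \<theta>') * (1 + norm w) powr (- \<kappa>)) \<partial>lborel) < \<top>"
    by (rule weighted_Lp_if_energy[OF Lp(1,2) s1(1) \<kappa>_def \<kappa>])
       (use s1(2) in \<open>simp only: fourier_energy_finite_iff[OF Lp(1)]\<close>)
  define B where "B = (if \<theta>' < 1/2 then 2 * s else s / \<theta>')"
  define c where "c = \<theta>' * (B - \<kappa>) / 2"
  have \<eta>: "0 < \<eta>" "\<eta> < 1" using b by (auto simp: \<eta>_def)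
  \<comment> \<open>At \<open>s = T\<close> the exponent \<open>c\<close> would be exactly \<open>1\<close>; it is affine in \<open>s\<close> with slope at most \<open>1\<close>.\<close>
  have c: "1 - \<eta> \<le> c" "c \<le> 1"
  proof -
    have "c = 1 - \<eta> * (if \<theta>' < 1/2 then (1 + 2 * \<theta>') / 2 else 1)"
    proof (cases "\<theta>' < 1/2")
      case True
      have "T * (1 + 2 * \<theta>') = 2 + d * \<theta>'" using True \<theta>' by (simp add: T)
      then have "s * (1 + 2 * \<theta>') = 2 + d * \<theta>' - \<eta> * (1 + 2 * \<theta>')" by (simp add: s_def left_diff_distrib)
      moreover have "c = (s * (1 + 2 * \<theta>') - d * \<theta>') / 2"
        using True \<theta>' by (simp add: c_def B_def \<kappa>_def d_def field_simps)
      ultimately show ?thesis using True by (simp add: diff_divide_distrib)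
    next
      case False
      have "c = s - d * \<theta>' / 2" using False \<theta>' by (simp add: c_def B_def \<kappa>_def d_def field_simps)
      then show ?thesis using False by (simp add: s_def T)
    qed
    moreover have "0 \<le> \<eta> * (if \<theta>' < 1/2 then (1 + 2 * \<theta>') / 2 else 1)" using \<eta> \<theta>' by simp
    moreover have "\<eta> * (if \<theta>' < 1/2 then (1 + 2 * \<theta>') / 2 else 1) \<le> \<eta> * 1"
      using \<eta> \<theta>' by (intro mult_left_mono) auto
    ultimately show "1 - \<eta> \<le> c" "c \<le> 1" by linarith+
  qed
  have c0: "0 \<le> c" using c \<eta> by linarith
  obtain C where C: "C \<ge> 0" "\<And>t. chord_average t \<le> ennreal (C * (1 + \<bar>t\<bar>) powr (- c))"
    using chord_average_decay_if_weighted_Lp[OF \<theta>' Lp(3) s0(1) \<kappa>_def \<kappa> B_def c_def c0 c(2) fin] by blast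
  have "chord_average t \<le> ennreal (C * (1 + \<bar>t\<bar>) powr (- b))" for t
    using C(1) c(1) by (intro order_trans[OF C(2)] ennreal_leI mult_left_mono powr_mono) (auto simp: \<eta>_def)
  then show ?thesis using C(1) by blast
qed

end

theorem corollary2p8:
  fixes \<mu> :: "(real ^ 'n) measure"
  assumes "CARD('n) \<ge> 4"
    and "prob_space \<mu>"
    and "sets \<mu> = sets borel"
    and "compact (measure_support \<mu>)"
    and "\<exists>\<theta>\<in>{0..1}. fourier_spectrum \<theta> \<mu> \<ge> ennreal (spectrum_threshold CARD('n) \<theta>)"
  shows "hausdorff_dim (distance_set (measure_support \<mu>)) = 1
       \<and> (AE x in \<mu>. hausdorff_dim (pinned_distance_set x (measure_support \<mu>)) = 1)"
proof -
  obtain R where R: "R > 0" "\<And>x. x \<in> measure_support \<mu> \<Longrightarrow> norm x \<le> R"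
    using compact_imp_bounded[OF assms(4)] unfolding bounded_pos by auto
  have ae: "AE x in \<mu>. norm x \<le> R"
    using AE_in_measure_support[OF assms(3)] by eventually_elim (rule R(2))
  have cp: "bounded_prob \<mu> R"
    using assms(2,3) ae R(1) by (intro bounded_prob.intro bounded_prob_axioms.intro) auto
  obtain \<theta> where \<theta>: "0 \<le> \<theta>" "\<theta> \<le> 1" "ennreal (spectrum_threshold CARD('n) \<theta>) \<le> fourier_spectrum \<theta> \<mu>"
    using assms(5) by auto
  show ?thesis
    by (rule hausdorff_dim_distance_sets[OF cp assms(4) bounded_prob.chord_average_decay_if_spectrum[OF cp assms(1) \<theta>]])
qed

end
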